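(* Let $d\ge 1$ be an integer and $0<\alpha<2$. Assume: (a) $\varphi:\mathbb{R}\to[0,\infty)$ is a convex differentiable function with $\varphi(0)=0$ and $\varphi(x)>0$ if $x\neq 0$; (b) $h:[0,\infty)\to[0,\infty)$ is a continuous function with $h(x)>0$ if $x\neq 0$; (c) $k:[0,\infty)\to[0,\infty)$ is a continuous function; (d) $\sup_{t\in[0,T]}\int_0^t\left(\int_s^t k(r)\,dr\right)^{-1/\alpha}ds<\infty$ for every $T>0$; (e) $u_0\in C_b(\mathbb{R}^d)\cap L^1(\mathbb{R}^d)$. Suppose in addition $u_0\ge 0$ and $\|u_0\|_1>0$, and let $u$ be the solution in $C_b^{1,2}((0,\infty)\times\mathbb{R}^d)$ of $$\partial_t u(t,x)=k(t)\Delta_\alpha u(t,x)-h(t)\varphi(u(t,x)),\quad (t,x)\in(0,\infty)\times\mathbb{R}^d,\qquad u(0,x)=u_0(x),\quad x\in\mathbb{R}^d.$$ Let $K(t)=\int_0^t k(s)\,ds$ and $M(\infty)=\lim_{t\to\infty}\int_{\mathbb{R}^d}u(t,x)\,dx$. If $\int_1^\infty k(s)\,ds=\infty$, then for each real $q\ge 1$, $$\lim_{t\to\infty}K(t)^{\frac{d}{\alpha}\left(1-\frac1q\right)}\left\|u(t,\cdot)-M(\infty)\,p(K(t),\cdot)\right\|_q=0.$$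
   Context: $C_b(\mathbb{R}^d)$ is the space of bounded continuous real functions on $\mathbb{R}^d$; $C_b^2(\mathbb{R}^d)$ is the space of $C^2$ functions that are bounded together with their derivatives up to order two. $\|\cdot\|_q$ is the $L^q(\mathbb{R}^d)$ norm. $\Delta_\alpha=-(-\Delta)^{\alpha/2}$ is the fractional Laplacian (Fourier symbol $-\|\xi\|^\alpha$), defined on $C_b^2(\mathbb{R}^d)$ by $$\Delta_\alpha f(x)=c\left(\int_{\|z\|<r}\frac{f(x+z)-f(x)-\nabla f(x)\cdot z}{\|z\|^{d+\alpha}}dz+\int_{\|z\|\ge r}\frac{f(x+z)-f(x)}{\|z\|^{d+\alpha}}dz\right),$$ where $c=c(\alpha,d)>0$ is the normalizing constant giving the symbol $-\|\xi\|^\alpha$, and the value does not depend on $r>0$. In the equation $\Delta_\alpha$ acts in the $x$ variable. For $t>0$, $p(t,\cdot)$ is the symmetric $\alpha$-stable density, determined by $\int_{\mathbb{R}^d}e^{i z\cdot x}p(t,x)\,dx=e^{-t\|z\|^\alpha}$ for all $z\in\mathbb{R}^d$. A solution $u\in C_b^{1,2}((0,\infty)\times\mathbb{R}^d)$ is a classical one: $u$ is bounded, continuous on $[0,\infty)\times\mathbb{R}^d$ with $u(0,\cdot)=u_0$, continuously differentiable in $t$ on $(0,\infty)\times\mathbb{R}^d$, $u(t,\cdot)\in C_b^2(\mathbb{R}^d)$ for each $t>0$, and the equation holds pointwise for $t>0$. Under the hypotheses, for $u_0\ge0$ such a solution exists, is unique and is non-negative, and the limit $M(\infty)$ exists. 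*)

theory Defs
  imports "HOL-Analysis.Analysis"
begin

definition Cb :: "('a::topological_space \<Rightarrow> real) set" where
  "Cb = {f. continuous_on UNIV f \<and> bounded (range f)}"

definition Cb2 :: "('a::real_normed_vector \<Rightarrow> real) set" where
  "Cb2 = {f. bounded (range f) \<and>
     (\<exists>(f' :: 'a \<Rightarrow> 'a \<Rightarrow>\<^sub>L real) (f'' :: 'a \<Rightarrow> 'a \<Rightarrow>\<^sub>L 'a \<Rightarrow>\<^sub>L real).
        (\<forall>x. (f has_derivative blinfun_apply (f' x)) (at x)) \<and>
        (\<forall>x. (f' has_derivative blinfun_apply (f'' x)) (at x)) \<and>
        continuous_on UNIV f'' \<and> bounded (range f') \<and> bounded (range f''))}"

(* The L^q norm for real q >= 1, with value \<infinity> outside L^q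
   (the Bochner integral would give 0 there). *)
definition Lq_norm :: "real \<Rightarrow> ('a::euclidean_space \<Rightarrow> real) \<Rightarrow> ennreal" where
  "Lq_norm q f =
     (let I = \<integral>\<^sup>+x. ennreal (\<bar>f x\<bar> powr q) \<partial>lborel
      in if I = \<infinity> then \<infinity> else ennreal (enn2real I powr (1 / q)))"

(* The singular integral with the splitting radius r = 1; for f in Cb2 the value is the same
   for every r > 0.  frechet_derivative f (at x) z is the gradient of f at x applied to z.
   The codomain is left general so that the operator also applies to the complex plane waves
   that fix the normalizing constant below. *)
definition levy_integral ::
    "real \<Rightarrow> (real^'n \<Rightarrow> 'b::{banach,second_countable_topology}) \<Rightarrow> real^'n \<Rightarrow> 'b" where
  "levy_integral \<alpha> f x =
     (LINT z:{z. norm z < 1}|lborel.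
        (1 / norm z powr (real CARD('n) + \<alpha>)) *\<^sub>R
          (f (x + z) - f x - frechet_derivative f (at x) z)) +
     (LINT z:{z. norm z \<ge> 1}|lborel.
        (1 / norm z powr (real CARD('n) + \<alpha>)) *\<^sub>R (f (x + z) - f x))"

(* The normalizing constant c(\<alpha>,d) with d = CARD('n): the operator c * levy_integral has
   Fourier symbol -|\<xi>|^\<alpha>, i.e. it multiplies the plane wave exp(i \<xi>.x) by -|\<xi>|^\<alpha>. *)
definition frac_laplacian_const :: "'n::finite itself \<Rightarrow> real \<Rightarrow> real" where
  "frac_laplacian_const (T :: 'n itself) \<alpha> =
     (THE c. c > 0 \<and>
        (\<forall>(\<xi> :: real^'n) x.
           c *\<^sub>R levy_integral \<alpha> (\<lambda>y. cis (\<xi> \<bullet> y)) x = - (norm \<xi> powr \<alpha>) *\<^sub>R cis (\<xi> \<bullet> x)))"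

definition frac_laplacian :: "real \<Rightarrow> (real^'n \<Rightarrow> real) \<Rightarrow> real^'n \<Rightarrow> real" where
  "frac_laplacian \<alpha> f x = frac_laplacian_const TYPE('n) \<alpha> * levy_integral \<alpha> f x"

(* This determines f up to a null set, which is immaterial inside an L^q norm. *)
definition symmetric_stable_density :: "real \<Rightarrow> real \<Rightarrow> (real^'n \<Rightarrow> real) \<Rightarrow> bool" where
  "symmetric_stable_density \<alpha> t f \<longleftrightarrow>
     (\<forall>x. 0 \<le> f x) \<and> integrable lborel f \<and>
     (\<forall>z. (LINT x|lborel. cis (z \<bullet> x) * complex_of_real (f x)) =
          complex_of_real (exp (- t * norm z powr \<alpha>)))"

definition Cb12 :: "(real \<Rightarrow> 'a::real_normed_vector \<Rightarrow> real) set" where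
  "Cb12 = {u.
     bounded ((\<lambda>(t, x). u t x) ` ({0..} \<times> UNIV)) \<and>
     continuous_on ({0..} \<times> UNIV) (\<lambda>(t, x). u t x) \<and>
     (\<forall>t>0. \<forall>x. (\<lambda>s. u s x) differentiable (at t)) \<and>
     continuous_on ({0<..} \<times> UNIV) (\<lambda>(t, x). deriv (\<lambda>s. u s x) t) \<and>
     (\<forall>t>0. u t \<in> Cb2)}"

definition classical_solution ::
    "real \<Rightarrow> (real \<Rightarrow> real) \<Rightarrow> (real \<Rightarrow> real) \<Rightarrow> (real \<Rightarrow> real) \<Rightarrow> (real^'n \<Rightarrow> real) \<Rightarrow>
     (real \<Rightarrow> real^'n \<Rightarrow> real) \<Rightarrow> bool" where
  "classical_solution \<alpha> k h \<phi> u\<^sub>0 u \<longleftrightarrow>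
     u \<in> Cb12 \<and>
     (\<forall>t>0. \<forall>x. deriv (\<lambda>s. u s x) t = k t * frac_laplacian \<alpha> (u t) x - h t * \<phi> (u t x)) \<and>
     (\<forall>x. u 0 x = u\<^sub>0 x)"

(* The value of int_0^t (int_s^t k(r) dr)^(-1/\<alpha>) ds in [0,\<infinity>].  The inverse is taken in
   ennreal so that 0^(-1/\<alpha>) = \<infinity>, whereas 0 powr (-1/\<alpha>) = 0 for reals. *)
definition smoothing_integral :: "real \<Rightarrow> (real \<Rightarrow> real) \<Rightarrow> real \<Rightarrow> ennreal" where
  "smoothing_integral \<alpha> k t =
     (\<integral>\<^sup>+s\<in>{0..t}. inverse (ennreal ((LINT r:{s..t}|lborel. k r) powr (1 / \<alpha>))) \<partial>lborel)"

end

theory Submission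
  imports Defs "HOL-Probability.Probability"
begin

text \<open>The solution is compared with the linear flow; no Duhamel formula is needed. By a nonlocal maximum
  principle with a logarithmic barrier, \<open>0 \<le> u t \<le> P (K t - K s) (u s)\<close> for \<open>s \<le> t\<close>, where \<open>P\<close> is the
  stable semigroup. Hence the mass \<open>M\<close> is nonincreasing and \<open>u t\<close> differs from \<open>P (K t - K s) (u s)\<close> in
  \<open>L\<^sup>1\<close> by exactly \<open>M s - M t\<close>, while \<open>P (K t - K s) (u s)\<close> approaches \<open>M s\<close> times the stable density at
  time \<open>K t\<close> by scaling and Scheffe's lemma. Letting first \<open>t\<close> and then \<open>s\<close> tend to infinity proves the case
  \<open>q = 1\<close>; the comparison with \<open>s = 0\<close> gives a sup norm bound of order \<open>K t powr (- d / \<alpha>)\<close>, and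
  interpolation gives the other \<open>q\<close>. The smooth supersolutions fed into the maximum principle are
  superpositions of plane waves, on which the fractional Laplacian acts by its symbol; that the given
  densities have this form (almost everywhere) is Fourier inversion.\<close>

section \<open>Invariance of Lebesgue measure and the Levy kernel\<close>

text \<open>Two features of the setting shape the proof. On the whole space the difference of
  \<open>u\<close> and a supersolution need not attain its supremum, and bounded continuous data
  need not be approached uniformly by their smoothed versions. In both places a small multiple of
  the same barrier restores compactness, and it disappears at the end because its coefficient is
  arbitrary. The barrier is unbounded, so the Levy integral is treated for functions of slow growth
  and not only on \<open>Cb2\<close>. Moreover, the stable density is known only through its
  characteristic function. Positivity and unit mass of the kernel are drawn from the given
  densities, while continuity, bounds and scaling come from the inversion formula; the two
  descriptions meet in an almost everywhere equality, which is enough inside an Lq norm. The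
  constant in \<open>frac_laplacian\<close> is a definite description, so it is evaluated only after
  rotation invariance and homogeneity have shown that the symbol of the Levy integral is a negative
  multiple of \<open>norm \<xi> powr \<alpha>\<close>.\<close>

lemma nn_integral_lborel_affine:
  fixes f :: "'a::euclidean_space \<Rightarrow> ennreal"
  assumes [measurable]: "f \<in> borel_measurable borel" and c: "c \<noteq> 0"
  shows "(\<integral>\<^sup>+x. f x \<partial>lborel) = ennreal (\<bar>c\<bar> ^ DIM('a)) * (\<integral>\<^sup>+x. f (t + c *\<^sub>R x) \<partial>lborel)"
  by (subst lborel_affine[OF c, of t])
     (simp add: nn_integral_density nn_integral_distr nn_integral_cmult)

lemma integrable_lborel_affine:
  fixes f :: "'a::euclidean_space \<Rightarrow> 'b::{banach, second_countable_topology}"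
  assumes f: "integrable lborel f" and c: "c \<noteq> 0"
  shows "integrable lborel (\<lambda>x. f (t + c *\<^sub>R x))"
  using f f[THEN borel_measurable_integrable] c unfolding integrable_iff_bounded
  by (subst (asm) nn_integral_lborel_affine[where c=c and t=t]) 
     (auto simp: ennreal_mult_less_top ennreal_mult_eq_top_iff less_top[symmetric])

lemma integral_lborel_affine:
  fixes f :: "'a::euclidean_space \<Rightarrow> 'b::{banach, second_countable_topology}"
  assumes f: "f \<in> borel_measurable borel" and c: "c \<noteq> 0"
  shows "(\<integral>x. f x \<partial>lborel) = (\<bar>c\<bar> ^ DIM('a)) *\<^sub>R (\<integral>x. f (t + c *\<^sub>R x) \<partial>lborel)"
  using f by (subst lborel_affine[OF c, of t])
     (simp add: integral_density integral_distr)

lemma borel_measurable_orthogonal_transformation: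
  fixes T :: "'a::euclidean_space \<Rightarrow> 'a"
  shows "orthogonal_transformation T \<Longrightarrow> T \<in> borel_measurable borel"
  by (intro borel_measurable_continuous_onI)
     (simp add: linear_continuous_on orthogonal_transformation_linear linear_conv_bounded_linear[symmetric])

text \<open>Uniqueness of Haar measure, tested against the unit ball, which \<open>T\<close> preserves.\<close>

lemma nn_integral_lborel_orthogonal:
  fixes T :: "'a::euclidean_space \<Rightarrow> 'a"
  assumes T: "orthogonal_transformation T" and [measurable]: "f \<in> borel_measurable borel"
  shows "(\<integral>\<^sup>+x. f (T x) \<partial>lborel) = (\<integral>\<^sup>+x. f x \<partial>lborel)"
proof -
  define B where "B = ball (0::'a) 1"
  have [measurable]: "B \<in> sets borel" by (simp add: B_def)
  note [measurable] = borel_measurable_orthogonal_transformation[OF T]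
  have iT: "orthogonal_transformation (inv T)" using T by (rule orthogonal_transformation_inv)
  have TiT: "T (inv T y) = y" for y
    using T by (metis orthogonal_transformation_surj surj_f_inv_f)
  have add: "T (x + y) = T x + T y" for x y
    using T by (simp add: orthogonal_transformation_linear linear_add)
  have nT: "norm (T x) = norm x" for x
    using T by (simp add: orthogonal_transformation_norm)
  have emB: "emeasure lborel B \<noteq> 0" "emeasure lborel B \<noteq> \<infinity>"
    using less_imp_neq[OF unit_ball_vol_pos[of "real DIM('a)", OF of_nat_0_le_iff]]
    by (simp_all add: B_def emeasure_ball)
  have "emeasure lborel B * (\<integral>\<^sup>+x. f (T x) \<partial>lborel) = (\<integral>\<^sup>+y. (\<integral>\<^sup>+x. f (T x) \<partial>lborel) * indicator B y \<partial>lborel)"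
    by (subst nn_integral_cmult_indicator) (auto simp: mult_ac)
  also have "\<dots> = (\<integral>\<^sup>+y. (\<integral>\<^sup>+x. f (T x + y) * indicator B y \<partial>lborel) \<partial>lborel)"
  proof (rule nn_integral_cong)
    fix y
    have "(\<integral>\<^sup>+x. f (T x) \<partial>lborel) = (\<integral>\<^sup>+x. f (T (inv T y + 1 *\<^sub>R x)) \<partial>lborel)"
      by (subst nn_integral_lborel_affine[where c=1 and t="inv T y"]) simp_all
    then show "(\<integral>\<^sup>+x. f (T x) \<partial>lborel) * indicator B y = (\<integral>\<^sup>+x. f (T x + y) * indicator B y \<partial>lborel)"
      by (simp add: add TiT nn_integral_multc add.commute)
  qed
  also have "\<dots> = (\<integral>\<^sup>+x. (\<integral>\<^sup>+y. f (T x + y) * indicator B y \<partial>lborel) \<partial>lborel)"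
    by (rule lborel_pair.Fubini') measurable
  also have "\<dots> = (\<integral>\<^sup>+x. (\<integral>\<^sup>+y. f y * indicator B (y - T x) \<partial>lborel) \<partial>lborel)"
  proof (rule nn_integral_cong)
    fix x
    show "(\<integral>\<^sup>+y. f (T x + y) * indicator B y \<partial>lborel) = (\<integral>\<^sup>+y. f y * indicator B (y - T x) \<partial>lborel)"
      by (subst (2) nn_integral_lborel_affine[where c=1 and t="T x"]) simp_all
  qed
  also have "\<dots> = (\<integral>\<^sup>+y. (\<integral>\<^sup>+x. f y * indicator B (y - T x) \<partial>lborel) \<partial>lborel)"
    by (rule lborel_pair.Fubini') measurable
  also have "\<dots> = (\<integral>\<^sup>+y. f y * emeasure lborel B \<partial>lborel)"
  proof (rule nn_integral_cong)
    fix y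
    \<comment> \<open>As \<open>T\<close> is an isometry, the points \<open>x\<close> with
      \<open>y - T x\<close> in the unit ball form the unit ball around \<open>inv T y\<close>,
      whose volume does not depend on \<open>y\<close>.\<close>
    have "norm (y - T x) = norm (inv T y - x)" for x
      by (metis T TiT nT linear_diff orthogonal_transformation_linear)
    then have "indicator B (y - T x) = (indicator (ball (inv T y) 1) x :: ennreal)" for x
      by (simp add: B_def indicator_def dist_norm[of "inv T y"])
    then show "(\<integral>\<^sup>+x. f y * indicator B (y - T x) \<partial>lborel) = f y * emeasure lborel B"
      by (simp add: nn_integral_cmult_indicator B_def emeasure_ball)
  qed
  also have "\<dots> = emeasure lborel B * (\<integral>\<^sup>+x. f x \<partial>lborel)"
    by (simp add: nn_integral_multc mult.commute)
  finally show ?thesis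
    using emB by (simp add: ennreal_mult_cancel_left)
qed

lemma distr_lborel_orthogonal:
  fixes T :: "'a::euclidean_space \<Rightarrow> 'a"
  assumes T: "orthogonal_transformation T"
  shows "distr lborel borel T = lborel"
proof (rule measure_eqI)
  note [measurable] = borel_measurable_orthogonal_transformation[OF T]
  fix A assume "A \<in> sets (distr lborel borel T)"
  then have [measurable]: "A \<in> sets borel" by simp
  have "emeasure (distr lborel borel T) A = (\<integral>\<^sup>+x. indicator A x \<partial>distr lborel borel T)" by simp
  also have "\<dots> = (\<integral>\<^sup>+x. indicator A (T x) \<partial>lborel)" by (subst nn_integral_distr) auto
  also have "\<dots> = emeasure lborel A" using nn_integral_lborel_orthogonal[OF T, of "indicator A"] by simp
  finally show "emeasure (distr lborel borel T) A = emeasure lborel A" .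
qed simp

section \<open>The Levy kernel\<close>

definition levy_kernel :: "real \<Rightarrow> real^'n \<Rightarrow> real" where
  "levy_kernel a z = 1 / norm z powr (real CARD('n) + a)"

lemma levy_kernel_nonneg [simp]: "0 \<le> levy_kernel a z"
  by (simp add: levy_kernel_def)

lemma borel_measurable_levy_kernel [measurable]: "levy_kernel a \<in> borel_measurable borel"
  unfolding levy_kernel_def by measurable

lemma levy_kernel_uminus [simp]: "levy_kernel a (- z) = levy_kernel a z"
  by (simp add: levy_kernel_def)

text \<open>In polar form the Levy measure condition is this one-dimensional integral:
  \<open>a < 2\<close> makes \<open>r powr (1 - a)\<close> integrable at 0, and \<open>0 < a\<close>
  makes \<open>r powr (- a - 1)\<close> integrable at infinity.\<close>

lemma nn_integral_powr_finite:
  assumes a: "0 < a" "a < 2"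
  shows "(\<integral>\<^sup>+r\<in>{0<..}. ennreal (min (r^2) 1 * r powr (- a - 1)) \<partial>lborel) < \<infinity>"
proof -
  have 1: "((\<lambda>r::real. r powr (1 - a)) has_integral (1 powr (2 - a) / (2 - a))) {0..1}"
    using has_integral_powr_from_0[of "1 - a" 1] a by (simp add: algebra_simps)
  have 2: "((\<lambda>r::real. r powr (- a - 1)) has_integral (- (1 powr (- a)) / (- a))) {1..}"
    using has_integral_powr_to_inf[of "- a - 1" 1] a by (simp add: algebra_simps)
  have "(\<integral>\<^sup>+r\<in>{0<..}. ennreal (min (r^2) 1 * r powr (- a - 1)) \<partial>lborel)
     \<le> (\<integral>\<^sup>+r. ennreal (r powr (1 - a)) * indicator {0..1} r + ennreal (r powr (- a - 1)) * indicator {1..} r \<partial>lborel)"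
  proof (rule nn_integral_mono)
    fix r :: real
    have "r\<^sup>2 * r powr (- a - 1) = r powr (1 - a)" if "0 < r"
    proof -
      have "r\<^sup>2 * r powr (- a - 1) = r powr 2 * r powr (- a - 1)" using that by simp
      also have "\<dots> = r powr (1 - a)" by (simp add: powr_add[symmetric])
      finally show ?thesis .
    qed
    then show "ennreal (min (r^2) 1 * r powr (- a - 1)) * indicator {0<..} r
       \<le> ennreal (r powr (1 - a)) * indicator {0..1} r + ennreal (r powr (- a - 1)) * indicator {1..} r"
      using power_le_one[of r 2] one_le_power[of r 2]
      by (cases "r \<le> 1") (auto simp: indicator_def min_def add_increasing2 not_le dest: antisym)
  qed
  also have "\<dots> = (\<integral>\<^sup>+r\<in>{0..1}. ennreal (r powr (1 - a)) \<partial>lborel) + (\<integral>\<^sup>+r\<in>{1..}. ennreal (r powr (- a - 1)) \<partial>lborel)"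
    by (rule nn_integral_add) auto
  also have "\<dots> < \<infinity>"
    using nn_integral_has_integral_lebesgue'[OF _ 1] nn_integral_has_integral_lebesgue'[OF _ 2] by simp
  finally show ?thesis .
qed

text \<open>Layer cake: \<open>\<bar>z\<bar>\<^sup>-\<^sup>d\<^sup>-\<^sup>a\<close> is \<open>d + a\<close> times the integral of \<open>r\<^sup>-\<^sup>d\<^sup>-\<^sup>a\<^sup>-\<^sup>1\<close> over \<open>r \<ge> \<bar>z\<bar>\<close>, and the ball of
  radius \<open>r\<close> has volume of order \<open>r\<^sup>d\<close>.\<close>

lemma integrable_min_levy_kernel:
  assumes a: "0 < a" "a < 2"
  shows "integrable lborel (\<lambda>z::real^'n. min ((norm z)^2) 1 * levy_kernel a z)"
proof (rule integrableI_bounded)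
  let ?d = "real CARD('n)"
  have d: "?d + a > 0" using a by simp
  have cake: "ennreal (levy_kernel a z) \<le> (\<integral>\<^sup>+r. ennreal ((?d + a) * r powr (- ?d - a - 1)) * indicator {norm z..} r \<partial>lborel)"
    if "z \<noteq> 0" for z :: "real^'n"
  proof -
    have "((\<lambda>r::real. r powr (- ?d - a - 1)) has_integral (- (norm z powr (- ?d - a)) / (- ?d - a))) {norm z..}"
      using has_integral_powr_to_inf[of "- ?d - a - 1" "norm z"] a that by simp
    from has_integral_mult_right[OF this, of "?d + a"]
    have "((\<lambda>r::real. (?d + a) * r powr (- ?d - a - 1)) has_integral levy_kernel a z) {norm z..}"
    proof (rule back_subst[where P="\<lambda>I. (_ has_integral I) _"])
      have "(?d + a) * (- (norm z powr (- ?d - a)) / (- ?d - a)) = norm z powr (- (?d + a))"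
        using d by (simp add: divide_simps) (simp add: algebra_simps)
      also have "\<dots> = levy_kernel a z"
        by (simp only: levy_kernel_def powr_minus_divide)
      finally show "(?d + a) * (- (norm z powr (- ?d - a)) / (- ?d - a)) = levy_kernel a z" .
    qed
    from nn_integral_has_integral_lebesgue'[OF _ this] d show ?thesis by simp
  qed
  have "(\<integral>\<^sup>+z. ennreal (norm (min ((norm z)^2) 1 * levy_kernel a (z::real^'n))) \<partial>lborel)
     \<le> (\<integral>\<^sup>+z. (\<integral>\<^sup>+r. ennreal (min (r^2) 1) * ennreal ((?d + a) * r powr (- ?d - a - 1)) * indicator {(r,z). norm z \<le> r \<and> r > 0} (r, z::real^'n) \<partial>lborel) \<partial>lborel)"
  proof (rule nn_integral_mono)
    fix z :: "real^'n"
    show "ennreal (norm (min ((norm z)^2) 1 * levy_kernel a z))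
      \<le> (\<integral>\<^sup>+r. ennreal (min (r^2) 1) * ennreal ((?d + a) * r powr (- ?d - a - 1)) * indicator {(r,z). norm z \<le> r \<and> r > 0} (r, z) \<partial>lborel)"
    proof (cases "z = 0")
      case False
      then have pos: "0 < r" if "norm z \<le> r" for r
        using that by (meson less_le_trans zero_less_norm_iff)
      have "ennreal (norm (min ((norm z)^2) 1 * levy_kernel a z)) = ennreal (min ((norm z)^2) 1) * ennreal (levy_kernel a z)"
        by (simp add: ennreal_mult)
      also have "\<dots> \<le> ennreal (min ((norm z)^2) 1) * (\<integral>\<^sup>+r. ennreal ((?d + a) * r powr (- ?d - a - 1)) * indicator {norm z..} r \<partial>lborel)"
        by (intro mult_left_mono cake False) simp
      also have "\<dots> = (\<integral>\<^sup>+r. ennreal (min ((norm z)^2) 1) * (ennreal ((?d + a) * r powr (- ?d - a - 1)) * indicator {norm z..} r) \<partial>lborel)"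
        by (rule nn_integral_cmult[symmetric]) simp
      also have "\<dots> \<le> (\<integral>\<^sup>+r. ennreal (min (r^2) 1) * ennreal ((?d + a) * r powr (- ?d - a - 1)) * indicator {(r,z). norm z \<le> r \<and> r > 0} (r, z) \<partial>lborel)"
        using pos d
        by (intro nn_integral_mono)
           (auto simp: indicator_def mult_ac min.coboundedI1 intro!: mult_left_mono mult_mono ennreal_leI min.mono power_mono)
      finally show ?thesis .
    qed simp
  qed
  also have "\<dots> = (\<integral>\<^sup>+r. (\<integral>\<^sup>+z. ennreal (min (r^2) 1) * ennreal ((?d + a) * r powr (- ?d - a - 1)) * indicator {(r,z). norm z \<le> r \<and> r > 0} (r, z::real^'n) \<partial>lborel) \<partial>lborel)"
    by (rule lborel_pair.Fubini') measurable
  also have "\<dots> = (\<integral>\<^sup>+r. ennreal ((?d + a) * unit_ball_vol ?d) * (ennreal (min (r^2) 1 * r powr (- a - 1)) * indicator {0<..} r) \<partial>lborel)"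
  proof (rule nn_integral_cong)
    fix r :: real
    show "(\<integral>\<^sup>+z. ennreal (min (r^2) 1) * ennreal ((?d + a) * r powr (- ?d - a - 1)) * indicator {(r,z). norm z \<le> r \<and> r > 0} (r, z::real^'n) \<partial>lborel)
      = ennreal ((?d + a) * unit_ball_vol ?d) * (ennreal (min (r^2) 1 * r powr (- a - 1)) * indicator {0<..} r)"
    proof (cases "r > 0")
      case True
      have "(\<integral>\<^sup>+z. ennreal (min (r^2) 1) * ennreal ((?d + a) * r powr (- ?d - a - 1)) * indicator {(r,z). norm z \<le> r \<and> r > 0} (r, z::real^'n) \<partial>lborel)
         = (\<integral>\<^sup>+z. ennreal (min (r^2) 1) * ennreal ((?d + a) * r powr (- ?d - a - 1)) * indicator (cball (0::real^'n) r) z \<partial>lborel)"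
        using True by (intro nn_integral_cong) (auto simp: indicator_def)
      also have "\<dots> = ennreal (min (r^2) 1) * ennreal ((?d + a) * r powr (- ?d - a - 1)) * emeasure lborel (cball (0::real^'n) r)"
        by (rule nn_integral_cmult_indicator) simp
      also have "emeasure lborel (cball (0::real^'n) r) = ennreal (unit_ball_vol ?d * r powr ?d)"
        using True by (subst emeasure_cball) (auto simp: powr_realpow)
      also have "ennreal (min (r^2) 1) * ennreal ((?d + a) * r powr (- ?d - a - 1)) * ennreal (unit_ball_vol ?d * r powr ?d)
         = ennreal (min (r^2) 1 * ((?d + a) * r powr (- ?d - a - 1)) * (unit_ball_vol ?d * r powr ?d))"
        using d by (simp add: ennreal_mult)
      also have "min (r^2) 1 * ((?d + a) * r powr (- ?d - a - 1)) * (unit_ball_vol ?d * r powr ?d)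
         = ((?d + a) * unit_ball_vol ?d) * (min (r^2) 1 * (r powr (- ?d - a - 1) * r powr ?d))"
        by (simp only: mult_ac)
      also have "r powr (- ?d - a - 1) * r powr ?d = r powr (- a - 1)"
        by (simp add: powr_add[symmetric])
      finally show ?thesis using True d by (simp add: ennreal_mult)
    qed simp
  qed
  also have "\<dots> = ennreal ((?d + a) * unit_ball_vol ?d) * (\<integral>\<^sup>+r\<in>{0<..}. ennreal (min (r^2) 1 * r powr (- a - 1)) \<partial>lborel)"
    by (rule nn_integral_cmult) measurable
  also have "\<dots> < \<infinity>"
    using nn_integral_powr_finite[OF a] by (simp add: ennreal_mult_less_top)
  finally show "(\<integral>\<^sup>+z. ennreal (norm (min ((norm z)^2) 1 * levy_kernel a (z::real^'n))) \<partial>lborel) < \<infinity>" .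
qed measurable

lemma inner_power2_le: "(x \<bullet> y)\<^sup>2 \<le> (norm x)\<^sup>2 * (norm y)\<^sup>2"
  using Cauchy_Schwarz_ineq[of x y] by (simp add: power2_norm_eq_inner)

section \<open>The Levy integral and its symbol\<close>

text \<open>One integrand replaces the two set integrals of \<open>levy_integral\<close>: the
  gradient term is cut off at radius 1, so that additivity, sign and Fubini arguments deal with a
  single integral.\<close>

definition levy_increment :: "(real^'n \<Rightarrow> 'b::real_normed_vector) \<Rightarrow> real^'n \<Rightarrow> real^'n \<Rightarrow> 'b" where
  "levy_increment f x z =
     f (x + z) - f x - (if norm z < 1 then frechet_derivative f (at x) z else 0)"

text \<open>Outside these conditions the default values are misleading:
  \<open>frechet_derivative\<close> of a non-differentiable function is an arbitrary choice, and a
  divergent Bochner integral is 0. Under them \<open>levy_integral\<close> is additive.\<close>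

definition levy_integrable ::
    "real \<Rightarrow> (real^'n \<Rightarrow> 'b::{banach,second_countable_topology}) \<Rightarrow> real^'n \<Rightarrow> bool" where
  "levy_integrable a f x \<longleftrightarrow> f differentiable (at x) \<and>
     integrable lborel (\<lambda>z. levy_kernel a z *\<^sub>R levy_increment f x z)"

lemma levy_integral_eq:
  assumes "levy_integrable a f x"
  shows "levy_integral a f x = (LINT z|lborel. levy_kernel a z *\<^sub>R levy_increment f x z)"
proof -
  let ?F = "\<lambda>z. levy_kernel a z *\<^sub>R levy_increment f x z"
  let ?L = "{z::real^'a. norm z < 1}" and ?G = "{z::real^'a. norm z \<ge> 1}"
  have F: "integrable lborel ?F" using assms by (simp add: levy_integrable_def)
  have L: "integrable lborel (\<lambda>z. indicat_real ?L z *\<^sub>R ?F z)"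
    by (rule integrable_mult_indicator[OF _ F]) measurable
  have G: "integrable lborel (\<lambda>z. indicat_real ?G z *\<^sub>R ?F z)"
    by (rule integrable_mult_indicator[OF _ F]) measurable
  have "levy_integral a f x = (LINT z|lborel. indicat_real ?L z *\<^sub>R ?F z) + (LINT z|lborel. indicat_real ?G z *\<^sub>R ?F z)"
    unfolding levy_integral_def set_lebesgue_integral_def
    by (intro arg_cong2[where f="(+)"] Bochner_Integration.integral_cong)
       (auto simp: levy_increment_def levy_kernel_def indicator_def)
  also have "\<dots> = (LINT z|lborel. indicat_real ?L z *\<^sub>R ?F z + indicat_real ?G z *\<^sub>R ?F z)"
    using L G by simp
  also have "\<dots> = (LINT z|lborel. ?F z)"
    by (intro Bochner_Integration.integral_cong) (auto simp: indicator_def)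
  finally show ?thesis .
qed

text \<open>The second summand pays for growth of order \<open>norm z powr b\<close> at large
  \<open>z\<close>, since the kernel of order \<open>a\<close> times \<open>norm z powr b\<close> is
  the kernel of order \<open>a - b\<close>.\<close>

definition levy_bound :: "'n::finite itself \<Rightarrow> real \<Rightarrow> real \<Rightarrow> real" where
  "levy_bound (T :: 'n itself) a b =
     (LINT z::real^'n|lborel. min ((norm z)\<^sup>2) 1 * levy_kernel a z + min ((norm z)\<^sup>2) 1 * levy_kernel (a - b) z)"

text \<open>Bounded functions enter with \<open>b = 0\<close>, the logarithmic barrier with
  \<open>b\<close> strictly between 0 and \<open>a\<close>. The bound depends on the function only
  through \<open>C\<close>, so estimates uniform in \<open>x\<close> carry over to the Levy
  integral.\<close>

lemma
  fixes f :: "real^'n \<Rightarrow> 'b::{banach,second_countable_topology}"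
  assumes a: "0 < a" "a < 2" and b: "0 \<le> b" "b < a"
    and [measurable]: "f \<in> borel_measurable borel"
    and f': "(f has_derivative f') (at x)"
    and near: "\<And>z. norm z < 1 \<Longrightarrow> norm (f (x + z) - f x - f' z) \<le> C * (norm z)\<^sup>2"
    and far: "\<And>z. 1 \<le> norm z \<Longrightarrow> norm (f (x + z) - f x) \<le> C * norm z powr b"
  shows levy_integrableI: "levy_integrable a f x"
    and norm_levy_integral_le: "norm (levy_integral a f x) \<le> C * levy_bound TYPE('n) a b"
proof -
  let ?g = "\<lambda>z::real^'n. min ((norm z)\<^sup>2) 1 * levy_kernel a z + min ((norm z)\<^sup>2) 1 * levy_kernel (a - b) z"
  let ?F = "\<lambda>z. levy_kernel a z *\<^sub>R levy_increment f x z"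
  have fr: "frechet_derivative f (at x) = f'" using f' by (metis frechet_derivative_at)
  have "bounded_linear f'" using f' by (rule has_derivative_bounded_linear)
  then have [measurable]: "f' \<in> borel_measurable borel"
    by (intro borel_measurable_continuous_onI linear_continuous_on)
  have C: "0 \<le> C"
  proof -
    \<comment> \<open>A unit vector tests \<open>far\<close> at \<open>norm z powr b = 1\<close>,
      which forces \<open>C\<close> to be nonnegative.\<close>
    obtain z :: "real^'n" where "norm z = 1" using vector_choose_size[of 1] by auto
    then show ?thesis using far[of z] by (auto intro: order_trans[OF norm_ge_zero])
  qed
  have g: "integrable lborel ?g"
    using a b by (intro Bochner_Integration.integrable_add integrable_min_levy_kernel) auto
  have meas: "?F \<in> borel_measurable lborel"
    unfolding levy_increment_def fr by measurable
  have bound: "norm (?F z) \<le> C * ?g z" for z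
  proof (cases "norm z < 1")
    case True
    then have "(norm z)\<^sup>2 \<le> 1" by (simp add: power_le_one)
    then have g: "levy_kernel a z * (norm z)\<^sup>2 \<le> ?g z" by (simp add: mult_ac min_def)
    have "norm (?F z) \<le> levy_kernel a z * (C * (norm z)\<^sup>2)"
      using near[OF True] True by (simp add: levy_increment_def fr mult_left_mono)
    also have "\<dots> = C * (levy_kernel a z * (norm z)\<^sup>2)" by simp
    also have "\<dots> \<le> C * ?g z" by (rule mult_left_mono[OF g C])
    finally show ?thesis .
  next
    case False
    then have k: "levy_kernel a z * norm z powr b = levy_kernel (a - b) z"
      by (simp add: levy_kernel_def powr_diff powr_add divide_simps)
    have "1 \<le> (norm z)\<^sup>2" using False by (simp add: one_le_power)
    then have g: "levy_kernel (a - b) z \<le> ?g z" by (simp add: min_def)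
    have "norm (?F z) \<le> levy_kernel a z * (C * norm z powr b)"
      using far[of z] False by (simp add: levy_increment_def mult_left_mono)
    also have "\<dots> = C * levy_kernel (a - b) z" by (simp add: k[symmetric])
    also have "\<dots> \<le> C * ?g z" by (rule mult_left_mono[OF g C])
    finally show ?thesis .
  qed
  have Cg: "integrable lborel (\<lambda>z. C * ?g z)" using g by (rule integrable_mult_right)
  have F: "integrable lborel ?F"
    by (rule Bochner_Integration.integrable_bound[OF Cg meas])
      (rule AE_I2, rule order_trans[OF bound], simp only: real_norm_def abs_ge_self)
  then show li: "levy_integrable a f x"
    using f' by (auto simp: levy_integrable_def differentiable_def)
  have "norm (levy_integral a f x) \<le> (LINT z|lborel. norm (?F z))"
    by (simp only: levy_integral_eq[OF li] integral_norm_bound)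
  also have "\<dots> \<le> (LINT z|lborel. C * ?g z)"
    by (rule integral_mono[OF integrable_norm[OF F] Cg]) (rule bound)
  also have "\<dots> = C * levy_bound TYPE('n) a b"
    by (simp add: levy_bound_def)
  finally show "norm (levy_integral a f x) \<le> C * levy_bound TYPE('n) a b" .
qed

lemma levy_increment_add:
  assumes "f differentiable (at x)" "g differentiable (at x)"
  shows "levy_increment (\<lambda>y. f y + g y) x z = levy_increment f x z + levy_increment g x z"
proof -
  have "frechet_derivative (\<lambda>y. f y + g y) (at x) = (\<lambda>z. frechet_derivative f (at x) z + frechet_derivative g (at x) z)"
    using assms by (intro frechet_derivative_at[symmetric] has_derivative_add)
      (simp_all add: frechet_derivative_works[symmetric])
  then show ?thesis by (simp add: levy_increment_def)
qed

lemma levy_increment_cmult: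
  fixes f :: "real^'n \<Rightarrow> real"
  assumes "f differentiable (at x)"
  shows "levy_increment (\<lambda>y. c * f y) x z = c * levy_increment f x z"
proof -
  have "frechet_derivative (\<lambda>y. c * f y) (at x) = (\<lambda>z. c * frechet_derivative f (at x) z)"
    using assms by (intro frechet_derivative_at[symmetric] has_derivative_mult_right)
      (simp_all add: frechet_derivative_works[symmetric])
  then show ?thesis by (simp add: levy_increment_def algebra_simps)
qed

lemma
  assumes f: "levy_integrable a f x" and g: "levy_integrable a g x"
  shows levy_integrable_add: "levy_integrable a (\<lambda>y. f y + g y) x"
    and levy_integral_add: "levy_integral a (\<lambda>y. f y + g y) x = levy_integral a f x + levy_integral a g x"
proof -
  have d: "f differentiable (at x)" "g differentiable (at x)" using f g by (auto simp: levy_integrable_def)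
  show i: "levy_integrable a (\<lambda>y. f y + g y) x"
    using f g by (simp add: levy_integrable_def levy_increment_add scaleR_add_right)
  show "levy_integral a (\<lambda>y. f y + g y) x = levy_integral a f x + levy_integral a g x"
    using f g by (simp add: levy_integral_eq i levy_increment_add d scaleR_add_right levy_integrable_def)
qed

lemma
  fixes f :: "real^'n \<Rightarrow> real"
  assumes f: "levy_integrable a f x"
  shows levy_integrable_cmult: "levy_integrable a (\<lambda>y. c * f y) x"
    and levy_integral_cmult: "levy_integral a (\<lambda>y. c * f y) x = c * levy_integral a f x"
proof -
  have d: "f differentiable (at x)" using f by (auto simp: levy_integrable_def)
  show i: "levy_integrable a (\<lambda>y. c * f y) x"
    using f by (simp add: levy_integrable_def levy_increment_cmult mult.left_commute[of _ c])
  show "levy_integral a (\<lambda>y. c * f y) x = c * levy_integral a f x"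
    using f by (simp add: levy_integral_eq i levy_increment_cmult d mult.left_commute[of _ c])
qed

text \<open>The gradient vanishes at a global maximum, so the increment is
  \<open>f (x + z) - f x\<close> for every \<open>z\<close>, which is nonpositive, while the kernel
  is nonnegative.\<close>

lemma levy_integral_nonpos_at_max:
  fixes f :: "real^'n \<Rightarrow> real"
  assumes f: "levy_integrable a f x" and max: "\<And>y. f y \<le> f x"
  shows "levy_integral a f x \<le> 0"
proof -
  have "(f has_derivative frechet_derivative f (at x)) (at x)"
    using f by (simp add: levy_integrable_def frechet_derivative_works[symmetric])
  then have "frechet_derivative f (at x) = (\<lambda>z. 0)"
    by (rule has_derivative_local_max) (simp add: max)
  then have "levy_increment f x z \<le> 0" for z
    using max[of "x + z"] by (simp add: levy_increment_def)
  then have "levy_kernel a z *\<^sub>R levy_increment f x z \<le> 0" for z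
    by (simp add: mult_nonneg_nonpos)
  then have "0 \<le> (LINT z|lborel. - (levy_kernel a z *\<^sub>R levy_increment f x z))"
    by (intro Bochner_Integration.integral_nonneg) simp
  then show ?thesis using levy_integral_eq[OF f] by simp
qed

text \<open>The mean value inequality is used twice: the bounded second derivative makes
  \<open>f'\<close> Lipschitz with constant \<open>D\<close>, and linearization along a segment
  turns this into a quadratic remainder. \<open>D\<close> serves the near part and
  \<open>2 * B\<close> the far part; their sum serves both.\<close>

lemma Cb2_levy_integrable:
  fixes f :: "real^'n \<Rightarrow> real"
  assumes f: "f \<in> Cb2" and a: "0 < a" "a < 2"
  shows "levy_integrable a f x"
proof -
  have "bounded (range f)" using f by (simp add: Cb2_def)
  then obtain B where B: "\<And>x. norm (f x) \<le> B" unfolding bounded_iff by blast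
  obtain f' :: "real^'n \<Rightarrow> (real^'n) \<Rightarrow>\<^sub>L real" and f'' :: "real^'n \<Rightarrow> (real^'n) \<Rightarrow>\<^sub>L (real^'n) \<Rightarrow>\<^sub>L real"
    where f': "\<And>x. (f has_derivative blinfun_apply (f' x)) (at x)"
      and f'': "\<And>x. (f' has_derivative blinfun_apply (f'' x)) (at x)" and "bounded (range f'')"
    using f unfolding Cb2_def mem_Collect_eq by blast
  then obtain D where D: "\<And>x. norm (f'' x) \<le> D" unfolding bounded_iff by blast
  have "f differentiable_on UNIV"
    using f' by (auto simp: differentiable_on_def differentiable_def)
  then have [measurable]: "f \<in> borel_measurable borel"
    by (intro borel_measurable_continuous_onI differentiable_imp_continuous_on)
  have lip: "norm (f' y - f' x) \<le> D * norm (y - x)" for y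
    by (rule differentiable_bound[where S=UNIV and f'="\<lambda>x. blinfun_apply (f'' x)"])
       (auto simp: norm_blinfun.rep_eq[symmetric] D intro: f'')
  have D0: "0 \<le> D" using D[of x] norm_ge_zero order_trans by blast
  have near: "norm (f (x + z) - f x - f' x z) \<le> D * (norm z)\<^sup>2" for z
  proof -
    have "norm (f (x + z) - f x - f' x (x + z - x)) \<le> norm (x + z - x) * (D * norm z)"
    proof (rule differentiable_bound_linearization[where S="closed_segment x (x + z)" and f'="\<lambda>x. blinfun_apply (f' x)"])
      fix t :: real assume "t \<in> {0..1}"
      then show "x + t *\<^sub>R (x + z - x) \<in> closed_segment x (x + z)"
        by (auto simp: closed_segment_def algebra_simps intro!: exI[of _ t])
    next
      fix y show "(f has_derivative blinfun_apply (f' y)) (at y within closed_segment x (x + z))"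
        by (rule has_derivative_at_withinI[OF f'])
    next
      fix y assume "y \<in> closed_segment x (x + z)"
      then have "norm (y - x) \<le> norm z" using segment_bound(1)[of y x "x + z"] by (simp add: norm_minus_commute)
      then have "norm (f' y - f' x) \<le> D * norm z" using lip[of y] D0 by (meson mult_left_mono order_trans)
      then show "onorm ((blinfun_apply (f' y)) - (blinfun_apply (f' x))) \<le> D * norm z"
        by (simp add: norm_blinfun.rep_eq minus_blinfun.rep_eq fun_diff_def)
    qed simp
    then show ?thesis by (simp add: power2_eq_square mult_ac)
  qed
  show ?thesis
  proof (rule levy_integrableI[where b=0 and C="D + 2 * B", OF a order_refl a(1) _ f'])
    fix z :: "real^'n"
    have "0 \<le> B" using B[of x] norm_ge_zero order_trans by blast
    then show "norm (f (x + z) - f x - f' x z) \<le> (D + 2 * B) * (norm z)\<^sup>2"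
      using near[of z] by (auto simp: algebra_simps intro: order_trans)
    assume "1 \<le> norm z"
    then have "z \<noteq> 0" by auto
    then show "norm (f (x + z) - f x) \<le> (D + 2 * B) * norm z powr 0"
      using norm_triangle_ineq4[of "f (x + z)" "f x"] B[of "x + z"] B[of x] D0 by auto
  qed measurable
qed

section \<open>Plane waves, the symbol and the normalizing constant\<close>

lemma has_derivative_cis_inner:
  "((\<lambda>y. cis (\<xi> \<bullet> y)) has_derivative (\<lambda>z. \<i> * of_real (\<xi> \<bullet> z) * cis (\<xi> \<bullet> x))) (at x)"
proof -
  have "((\<lambda>y. of_real (cos (\<xi> \<bullet> y)) + \<i> * of_real (sin (\<xi> \<bullet> y))) has_derivative
      (\<lambda>z. of_real (- sin (\<xi> \<bullet> x) * (\<xi> \<bullet> z)) + \<i> * of_real (cos (\<xi> \<bullet> x) * (\<xi> \<bullet> z)))) (at x)"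
    by (auto intro!: derivative_eq_intros)
  also have "(\<lambda>z. of_real (- sin (\<xi> \<bullet> x) * (\<xi> \<bullet> z)) + \<i> * of_real (cos (\<xi> \<bullet> x) * (\<xi> \<bullet> z)))
     = (\<lambda>z. \<i> * of_real (\<xi> \<bullet> z) * cis (\<xi> \<bullet> x))"
    by (auto simp: complex_eq_iff)
  also have "(\<lambda>y. of_real (cos (\<xi> \<bullet> y)) + \<i> * of_real (sin (\<xi> \<bullet> y))) = (\<lambda>y. cis (\<xi> \<bullet> y))"
    by (auto simp: complex_eq_iff)
  finally show ?thesis .
qed

lemma norm_cis_minus_linear_le: "norm (cis t - 1 - \<i> * of_real t) \<le> t\<^sup>2 / 2"
  using iexp_approx1[of t 1] by (simp add: cis_conv_exp power2_eq_square numeral_2_eq_2 algebra_simps)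

lemma levy_increment_cis:
  "levy_increment (\<lambda>y. cis (\<xi> \<bullet> y)) x z =
     cis (\<xi> \<bullet> x) * (cis (\<xi> \<bullet> z) - 1 - (if norm z < 1 then \<i> * of_real (\<xi> \<bullet> z) else 0))"
  unfolding levy_increment_def frechet_derivative_at[OF has_derivative_cis_inner, symmetric]
  by (simp add: cis_mult[symmetric] inner_add_right algebra_simps)

lemma levy_integrable_cis:
  fixes \<xi> :: "real^'n"
  assumes a: "0 < a" "a < 2"
  shows "levy_integrable a (\<lambda>y. cis (\<xi> \<bullet> y)) x"
proof (rule levy_integrableI[where b=0 and C="2 + (norm \<xi>)\<^sup>2", OF a order_refl a(1) _ has_derivative_cis_inner])
  fix z :: "real^'n"
  have "cis (\<xi> \<bullet> (x + z)) - cis (\<xi> \<bullet> x) - \<i> * of_real (\<xi> \<bullet> z) * cis (\<xi> \<bullet> x)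
     = cis (\<xi> \<bullet> x) * (cis (\<xi> \<bullet> z) - 1 - \<i> * of_real (\<xi> \<bullet> z))"
    by (simp add: cis_mult[symmetric] inner_add_right algebra_simps)
  then have "norm (cis (\<xi> \<bullet> (x + z)) - cis (\<xi> \<bullet> x) - \<i> * of_real (\<xi> \<bullet> z) * cis (\<xi> \<bullet> x)) \<le> (\<xi> \<bullet> z)\<^sup>2 / 2"
    using norm_cis_minus_linear_le[of "\<xi> \<bullet> z"] by (simp add: norm_mult)
  also have "\<dots> \<le> (2 + (norm \<xi>)\<^sup>2) * (norm z)\<^sup>2"
    using inner_power2_le[of \<xi> z] zero_le_power2[of "norm z"] zero_le_power2[of "\<xi> \<bullet> z"]
    unfolding distrib_right by linarith
  finally show "norm (cis (\<xi> \<bullet> (x + z)) - cis (\<xi> \<bullet> x) - \<i> * of_real (\<xi> \<bullet> z) * cis (\<xi> \<bullet> x)) \<le> (2 + (norm \<xi>)\<^sup>2) * (norm z)\<^sup>2"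
    by simp
  assume "1 \<le> norm z"
  then have "z \<noteq> 0" by auto
  then show "norm (cis (\<xi> \<bullet> (x + z)) - cis (\<xi> \<bullet> x)) \<le> (2 + (norm \<xi>)\<^sup>2) * norm z powr 0"
    using norm_triangle_ineq4[of "cis (\<xi> \<bullet> (x + z))" "cis (\<xi> \<bullet> x)"]
    by (simp add: add_increasing2)
qed (measurable, simp add: cis_conv_exp)

text \<open>The Levy-Khintchine exponent of the kernel before normalization. The compensator of
  \<open>levy_increment\<close> is absent because it contributes only to the imaginary part.\<close>

definition levy_exponent :: "real \<Rightarrow> real^'n \<Rightarrow> real" where
  "levy_exponent a \<xi> = (LINT z|lborel. levy_kernel a z * (1 - cos (\<xi> \<bullet> z)))"

lemma integrable_levy_exponent:
  fixes \<xi> :: "real^'n"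
  assumes a: "0 < a" "a < 2"
  shows "integrable lborel (\<lambda>z. levy_kernel a z * (1 - cos (\<xi> \<bullet> z)))"
proof -
  have "integrable lborel (\<lambda>z. - Re (levy_kernel a z *\<^sub>R levy_increment (\<lambda>y. cis (\<xi> \<bullet> y)) 0 z))"
    using levy_integrable_cis[OF a, of \<xi> 0] by (intro integrable_minus integrable_Re) (simp add: levy_integrable_def)
  moreover have "- Re (levy_kernel a z *\<^sub>R levy_increment (\<lambda>y. cis (\<xi> \<bullet> y)) 0 z) = levy_kernel a z * (1 - cos (\<xi> \<bullet> z))" for z
    by (simp add: levy_increment_cis algebra_simps)
  ultimately show ?thesis by (simp only:)
qed

lemma levy_exponent_orthogonal:
  fixes T :: "real^'n \<Rightarrow> real^'n"
  assumes T: "orthogonal_transformation T"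
  shows "levy_exponent a (T \<xi>) = levy_exponent a \<xi>"
proof -
  note [measurable] = borel_measurable_orthogonal_transformation[OF T]
  have "levy_exponent a (T \<xi>) = (LINT z|distr lborel borel T. levy_kernel a z * (1 - cos (T \<xi> \<bullet> z)))"
    by (simp add: distr_lborel_orthogonal[OF T] levy_exponent_def)
  also have "\<dots> = (LINT z|lborel. levy_kernel a (T z) * (1 - cos (T \<xi> \<bullet> T z)))"
    by (rule integral_distr) measurable
  also have "\<dots> = levy_exponent a \<xi>"
    using T by (simp add: levy_exponent_def levy_kernel_def orthogonal_transformation_norm)
      (simp add: orthogonal_transformation_def)
  finally show ?thesis .
qed

lemma levy_exponent_scaleR:
  fixes \<xi> :: "real^'n"
  assumes r: "0 < r"
  shows "levy_exponent a (r *\<^sub>R \<xi>) = r powr a * levy_exponent a \<xi>"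
proof -
  let ?d = "real CARD('n)"
  have k: "levy_kernel a ((1 / r) *\<^sub>R z) = r powr (?d + a) * levy_kernel a z" for z :: "real^'n"
    using r by (simp add: levy_kernel_def powr_divide)
  have "levy_exponent a (r *\<^sub>R \<xi>) = (1 / r) ^ CARD('n) * (LINT z|lborel. levy_kernel a ((1 / r) *\<^sub>R z) * (1 - cos (\<xi> \<bullet> z)))"
    unfolding levy_exponent_def
    by (subst integral_lborel_affine[where c="1 / r" and t=0]) (use r in auto)
  also have "\<dots> = ((1 / r) ^ CARD('n) * r powr (?d + a)) * levy_exponent a \<xi>"
    by (simp add: k levy_exponent_def mult.assoc)
  also have "(1 / r) ^ CARD('n) * r powr (?d + a) = r powr a"
    using r by (simp add: powr_add powr_realpow power_divide)
  finally show ?thesis .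
qed

lemma levy_exponent_0 [simp]: "levy_exponent a 0 = 0"
  by (simp add: levy_exponent_def)

text \<open>Orthogonal invariance and homogeneity of degree \<open>a\<close> determine the exponent
  from its value at one unit vector.\<close>

lemma levy_exponent_eq:
  fixes \<xi> e :: "real^'n"
  assumes e: "norm e = 1"
  shows "levy_exponent a \<xi> = norm \<xi> powr a * levy_exponent a e"
proof (cases "\<xi> = 0")
  case False
  define \<eta> where "\<eta> = (1 / norm \<xi>) *\<^sub>R \<xi>"
  have "norm \<eta> = 1" using False by (simp add: \<eta>_def)
  then obtain T where T: "orthogonal_transformation T" "T e = \<eta>"
    using orthogonal_transformation_exists_1[of e \<eta>] e by auto
  have "levy_exponent a \<xi> = levy_exponent a (norm \<xi> *\<^sub>R \<eta>)"
    using False by (simp add: \<eta>_def)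
  also have "\<dots> = norm \<xi> powr a * levy_exponent a \<eta>"
    using False by (simp add: levy_exponent_scaleR)
  also have "levy_exponent a \<eta> = levy_exponent a e"
    using levy_exponent_orthogonal[OF T(1), of a e] T(2) by simp
  finally show ?thesis .
qed simp

text \<open>The integrand is nonnegative, and nonzero on the open slab where
  \<open>e \<bullet> z\<close> lies strictly between 0 and 1. If the integral vanished, this
  nonempty open set would be negligible.\<close>

lemma levy_exponent_pos:
  fixes e :: "real^'n"
  assumes a: "0 < a" "a < 2" and e: "norm e = 1"
  shows "0 < levy_exponent a e"
proof -
  let ?f = "\<lambda>z. levy_kernel a z * (1 - cos (e \<bullet> z))"
  have nn: "0 \<le> ?f z" for z by simp
  have "levy_exponent a e \<noteq> 0"
  proof
    assume "levy_exponent a e = 0"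
    then have "AE z in lborel. ?f z = 0"
      using integral_nonneg_eq_0_iff_AE[OF integrable_levy_exponent[OF a]] nn
      by (auto simp: levy_exponent_def)
    moreover have "?f z \<noteq> 0" if "z \<in> {z. 0 < e \<bullet> z \<and> e \<bullet> z < 1}" for z
    proof -
      have "z \<noteq> 0" using that by auto
      then have "levy_kernel a z \<noteq> 0" by (simp add: levy_kernel_def)
      moreover have "cos (e \<bullet> z) < cos 0"
        using that pi_gt3 by (intro cos_monotone_0_pi) auto
      ultimately show ?thesis by simp
    qed
    ultimately have "AE z in lborel. z \<notin> {z. 0 < e \<bullet> z \<and> e \<bullet> z < 1}"
      by (auto elim!: eventually_mono)
    moreover have o: "open {z. 0 < e \<bullet> z \<and> e \<bullet> z < 1}"
      by (intro open_Collect_conj open_Collect_less continuous_intros)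
    ultimately have "{z. 0 < e \<bullet> z \<and> e \<bullet> z < 1} \<in> null_sets lborel"
      by (subst (asm) AE_iff_null) (auto simp: borel_open)
    then have "negligible {z. 0 < e \<bullet> z \<and> e \<bullet> z < 1}"
      by (simp add: negligible_iff_null_sets null_sets_completionI)
    moreover have "(1/2) *\<^sub>R e \<in> {z. 0 < e \<bullet> z \<and> e \<bullet> z < 1}"
      using e by (simp add: dot_square_norm)
    ultimately show False using o open_not_negligible by blast
  qed
  moreover have "0 \<le> levy_exponent a e"
    unfolding levy_exponent_def using nn by (rule Bochner_Integration.integral_nonneg)
  ultimately show ?thesis by simp
qed

text \<open>A shift multiplies a plane wave by a phase, so \<open>cis (\<xi> \<bullet> x)\<close>
  factors out and leaves an integral independent of \<open>x\<close>. Its real part is minus the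
  exponent; its imaginary part has an odd integrand, compensator included, and vanishes under the
  reflection of \<open>z\<close>.\<close>

lemma levy_integral_cis:
  fixes \<xi> :: "real^'n"
  assumes a: "0 < a" "a < 2"
  shows "levy_integral a (\<lambda>y. cis (\<xi> \<bullet> y)) x = - of_real (levy_exponent a \<xi>) * cis (\<xi> \<bullet> x)"
proof -
  let ?G = "\<lambda>z. levy_kernel a z *\<^sub>R (cis (\<xi> \<bullet> z) - 1 - (if norm z < 1 then \<i> * of_real (\<xi> \<bullet> z) else 0))"
  have G: "integrable lborel ?G"
    using levy_integrable_cis[OF a, of \<xi> 0] by (simp add: levy_integrable_def levy_increment_cis)
  have "levy_integral a (\<lambda>y. cis (\<xi> \<bullet> y)) x = (LINT z|lborel. cis (\<xi> \<bullet> x) * ?G z)"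
    by (simp add: levy_integral_eq[OF levy_integrable_cis[OF a]] levy_increment_cis)
  also have "\<dots> = cis (\<xi> \<bullet> x) * (LINT z|lborel. ?G z)"
    by (rule integral_mult_right_zero)
  also have "(LINT z|lborel. ?G z) = - of_real (levy_exponent a \<xi>)"
  proof (rule complex_eqI)
    have "Re (LINT z|lborel. ?G z) = (LINT z|lborel. Re (?G z))"
      by (rule integral_Re[OF G, symmetric])
    also have "\<dots> = (LINT z|lborel. - (levy_kernel a z * (1 - cos (\<xi> \<bullet> z))))"
      by (rule Bochner_Integration.integral_cong) (simp_all add: algebra_simps)
    also have "\<dots> = - levy_exponent a \<xi>"
      by (simp only: Bochner_Integration.integral_minus levy_exponent_def)
    finally show "Re (LINT z|lborel. ?G z) = Re (- of_real (levy_exponent a \<xi>))"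
      by simp
    let ?I = "\<lambda>z. levy_kernel a z * (sin (\<xi> \<bullet> z) - (if norm z < 1 then \<xi> \<bullet> z else 0))"
    have "Im (LINT z|lborel. ?G z) = (LINT z|lborel. Im (?G z))"
      by (rule integral_Im[OF G, symmetric])
    also have "\<dots> = (LINT z|lborel. ?I z)"
      by (rule Bochner_Integration.integral_cong) simp_all
    also have "\<dots> = 0"
    proof -
      have "(LINT z|lborel. ?I z) = (LINT z|lborel. ?I (0 + (-1) *\<^sub>R z))"
        by (subst integral_lborel_affine[where c="-1" and t=0]) simp_all
      also have "\<dots> = (LINT z|lborel. - ?I z)"
        by (rule Bochner_Integration.integral_cong) (simp_all add: algebra_simps)
      also have "\<dots> = - (LINT z|lborel. ?I z)" 
        by (rule Bochner_Integration.integral_minus)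
      finally show ?thesis by linarith
    qed
    finally show "Im (LINT z|lborel. ?G z) = Im (- of_real (levy_exponent a \<xi>))" by simp
  qed
  finally show ?thesis by (simp only: mult.commute)
qed

text \<open>Existence in the definite description is the symbol formula; uniqueness follows from the
  single frequency \<open>e\<close> at the point 0, because the exponent of \<open>e\<close> is
  nonzero.\<close>

lemma frac_laplacian_const_eq:
  fixes e :: "real^'n"
  assumes a: "0 < a" "a < 2" and e: "norm e = 1"
  shows "frac_laplacian_const TYPE('n) a = 1 / levy_exponent a e"
  unfolding frac_laplacian_const_def
proof (rule the_equality)
  have pos: "0 < levy_exponent a e" by (rule levy_exponent_pos[OF a e])
  then show "1 / levy_exponent a e > 0 \<and> (\<forall>(\<xi>::real^'n) x.
      (1 / levy_exponent a e) *\<^sub>R levy_integral a (\<lambda>y. cis (\<xi> \<bullet> y)) x = - (norm \<xi> powr a) *\<^sub>R cis (\<xi> \<bullet> x))"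
  proof (intro conjI allI)
    fix \<xi> x :: "real^'n"
    have "(1 / levy_exponent a e) * levy_exponent a \<xi> = norm \<xi> powr a"
      using levy_exponent_eq[OF e, of a \<xi>] pos by simp
    then have "of_real (1 / levy_exponent a e) * complex_of_real (levy_exponent a \<xi>) = of_real (norm \<xi> powr a)"
      by (simp only: of_real_mult[symmetric])
    then show "(1 / levy_exponent a e) *\<^sub>R levy_integral a (\<lambda>y. cis (\<xi> \<bullet> y)) x = - (norm \<xi> powr a) *\<^sub>R cis (\<xi> \<bullet> x)"
      by (simp only: levy_integral_cis[OF a] scaleR_conv_of_real mult_minus_left mult_minus_right mult.assoc[symmetric] of_real_minus)
  qed simp
  fix c assume "c > 0 \<and> (\<forall>(\<xi>::real^'n) x.
      c *\<^sub>R levy_integral a (\<lambda>y. cis (\<xi> \<bullet> y)) x = - (norm \<xi> powr a) *\<^sub>R cis (\<xi> \<bullet> x))"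
  then have "c *\<^sub>R levy_integral a (\<lambda>y. cis (e \<bullet> y)) 0 = - (norm e powr a) *\<^sub>R cis (e \<bullet> 0)" by blast
  then have "complex_of_real (c * levy_exponent a e) = of_real 1"
    by (simp add: levy_integral_cis[OF a] e scaleR_conv_of_real)
  then have "c * levy_exponent a e = 1" by (simp only: of_real_eq_iff)
  then show "c = 1 / levy_exponent a e" using pos by (simp add: field_simps)
qed

lemma frac_laplacian_const_pos:
  assumes a: "0 < a" "a < 2"
  shows "0 < frac_laplacian_const TYPE('n::finite) a"
proof -
  obtain e :: "real^'n" where e: "norm e = 1" using vector_choose_size[of 1] by auto
  then show ?thesis using frac_laplacian_const_eq[OF a e] levy_exponent_pos[OF a e] by simp
qed

lemma frac_laplacian_const_levy_exponent:
  fixes \<xi> :: "real^'n"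
  assumes a: "0 < a" "a < 2"
  shows "frac_laplacian_const TYPE('n) a * levy_exponent a \<xi> = norm \<xi> powr a"
proof -
  obtain e :: "real^'n" where e: "norm e = 1" using vector_choose_size[of 1] by auto
  then show ?thesis
    using frac_laplacian_const_eq[OF a e] levy_exponent_pos[OF a e] levy_exponent_eq[OF e, of a \<xi>] by simp
qed

text \<open>The integrand is the increment of \<open>y \<mapsto> cos (\<xi> \<bullet> y - \<theta>)\<close>, with the gradient written out.\<close>

lemma integral_levy_cos:
  fixes \<xi> x :: "real^'n" and a \<theta> :: real
  assumes a: "0 < a" "a < 2"
  shows "frac_laplacian_const TYPE('n) a * (LINT z|lborel. levy_kernel a z *
      (cos (\<xi> \<bullet> (x + z) - \<theta>) - cos (\<xi> \<bullet> x - \<theta>) - (if norm z < 1 then - sin (\<xi> \<bullet> x - \<theta>) * (\<xi> \<bullet> z) else 0)))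
    = - (norm \<xi> powr a) * cos (\<xi> \<bullet> x - \<theta>)"
    (is "_ * (LINT z|lborel. _ * ?D z) = _")
proof -
  let ?G = "\<lambda>z. levy_kernel a z *\<^sub>R levy_increment (\<lambda>y. cis (\<xi> \<bullet> y)) x z"
  have G: "integrable lborel ?G"
    using levy_integrable_cis[OF a, of \<xi> x] by (simp add: levy_integrable_def)
  then have G': "integrable lborel (\<lambda>z. cis (- \<theta>) * ?G z)" by (rule integrable_mult_right)
  have eq: "levy_kernel a z * ?D z = Re (cis (- \<theta>) * ?G z)" for z
    by (simp add: levy_increment_cis cos_diff sin_diff cos_add sin_add inner_add_right algebra_simps)
  have "(LINT z|lborel. levy_kernel a z * ?D z) = Re (LINT z|lborel. cis (- \<theta>) * ?G z)"
    unfolding eq using G' by (rule integral_Re)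
  also have "(LINT z|lborel. cis (- \<theta>) * ?G z) = cis (- \<theta>) * levy_integral a (\<lambda>y. cis (\<xi> \<bullet> y)) x"
    by (simp only: integral_mult_right_zero levy_integral_eq[OF levy_integrable_cis[OF a]])
  also have "\<dots> = - of_real (levy_exponent a \<xi>) * cis (\<xi> \<bullet> x - \<theta>)"
    by (simp add: levy_integral_cis[OF a] cis_mult algebra_simps)
  also have "Re \<dots> = - levy_exponent a \<xi> * cos (\<xi> \<bullet> x - \<theta>)" by simp
  finally show ?thesis
    using frac_laplacian_const_levy_exponent[OF a, of \<xi>] by (simp add: mult.assoc[symmetric])
qed

section \<open>Superpositions of plane waves\<close>

lemma continuous_on_LINT:
  fixes F :: "'s::metric_space \<Rightarrow> 'm \<Rightarrow> 'b::{banach,second_countable_topology}"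
  assumes cont: "\<And>m. m \<in> space M \<Longrightarrow> continuous_on S (\<lambda>s. F s m)"
    and meas: "\<And>s. s \<in> S \<Longrightarrow> F s \<in> borel_measurable M"
    and bound: "\<And>s m. s \<in> S \<Longrightarrow> m \<in> space M \<Longrightarrow> norm (F s m) \<le> g m"
    and g: "integrable M g"
  shows "continuous_on S (\<lambda>s. LINT m|M. F s m)"
  unfolding continuous_on_sequentially
proof (intro allI ballI impI, elim conjE)
  fix X :: "nat \<Rightarrow> 's" and s assume s: "s \<in> S" and X: "\<forall>n. X n \<in> S" "X \<longlonglongrightarrow> s"
  show "((\<lambda>s. LINT m|M. F s m) \<circ> X) \<longlonglongrightarrow> (LINT m|M. F s m)"
    unfolding comp_def
  proof (rule integral_dominated_convergence[where w=g])
    show "AE m in M. (\<lambda>n. F (X n) m) \<longlonglongrightarrow> F s m"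
      using cont s X unfolding continuous_on_sequentially comp_def by (intro AE_I2) blast
  qed (use meas bound g s X in auto)
qed

text \<open>Differentiation under the integral sign takes this form for superpositions, both in
  space and in time: an explicit quadratic remainder is integrated instead of difference
  quotients.\<close>

lemma has_derivative_quadratic_remainder:
  fixes f :: "'a::real_normed_vector \<Rightarrow> 'b::real_normed_vector"
  assumes "bounded_linear f'" and "0 < r"
    and rem: "\<And>z. norm z < r \<Longrightarrow> norm (f (x + z) - f x - f' z) \<le> C * (norm z)\<^sup>2"
  shows "(f has_derivative f') (at x)"
  unfolding has_derivative_at
proof
  show "(\<lambda>h. norm (f (x + h) - f x - f' h) / norm h) \<midarrow>0\<rightarrow> 0"
  proof (rule tendsto_sandwich[where f="\<lambda>_. 0" and h="\<lambda>h. C * norm h"])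
    show "(\<lambda>h::'a. C * norm h) \<midarrow>0\<rightarrow> 0"
      by (auto intro!: tendsto_eq_intros)
    show "\<forall>\<^sub>F h in at 0. norm (f (x + h) - f x - f' h) / norm h \<le> C * norm h"
      using rem \<open>0 < r\<close> unfolding eventually_at
      by (auto intro!: exI[of _ r] simp: divide_le_eq power2_eq_square mult_ac)
  qed auto
qed fact

lemma cos_quadratic_remainder:
  "\<bar>cos (s + h) - cos s + sin s * h\<bar> \<le> h\<^sup>2 / (2::real)"
proof -
  have "cos (s + h) - cos s + sin s * h = Re (cis s * (cis h - 1 - \<i> * of_real h))"
    by (simp add: cos_add algebra_simps)
  also have "\<bar>\<dots>\<bar> \<le> norm (cis s * (cis h - 1 - \<i> * of_real h))"
    by (rule abs_Re_le_cmod)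
  also have "\<dots> \<le> h\<^sup>2 / 2" using norm_cis_minus_linear_le[of h] by (simp add: norm_mult)
  finally show ?thesis .
qed

text \<open>The factor \<open>exp (b * c)\<close> is the price for uniformity over all
  \<open>h\<close> of modulus at most \<open>b\<close>. For the damped waves \<open>b\<close> is
  half the time, so half of the damping absorbs it.\<close>

lemma exp_quadratic_remainder:
  assumes c: "0 \<le> (c::real)" and h: "\<bar>h\<bar> \<le> b"
  shows "\<bar>exp (- h * c) - 1 + h * c\<bar> \<le> h\<^sup>2 * c\<^sup>2 * exp (b * c)"
proof -
  let ?y = "- h * c"
  have hc: "\<bar>?y\<bar> \<le> b * c" using c h by (simp add: abs_mult mult_right_mono)
  have le: "1 + ?y \<le> exp ?y" by (rule exp_ge_add_one_self)
  have "exp ?y * (1 - ?y) \<le> exp ?y * exp (- ?y)"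
    by (rule mult_left_mono) (use exp_ge_add_one_self[of "- ?y"] in auto)
  then have up: "exp ?y - 1 \<le> ?y * exp ?y" by (simp add: exp_minus algebra_simps)
  have "exp ?y - 1 - ?y \<le> ?y * (exp ?y - 1)" using up by (simp add: algebra_simps)
  also have "\<dots> \<le> \<bar>?y\<bar> * \<bar>exp ?y - 1\<bar>" by (metis abs_ge_self abs_mult)
  also have "\<bar>exp ?y - 1\<bar> \<le> \<bar>?y\<bar> * exp (b * c)"
  proof (cases "0 \<le> ?y")
    case True
    then have "\<bar>exp ?y - 1\<bar> = exp ?y - 1" by simp
    also have "\<dots> \<le> \<bar>?y\<bar> * exp ?y" using up True by simp
    also have "\<dots> \<le> \<bar>?y\<bar> * exp (b * c)" using hc by (intro mult_left_mono) auto
    finally show ?thesis .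
  next
    case False
    then have "exp ?y \<le> 1" by simp
    then have "\<bar>exp ?y - 1\<bar> \<le> \<bar>?y\<bar>" using le False by linarith
    also have "\<dots> \<le> \<bar>?y\<bar> * exp (b * c)"
    proof -
      have "0 \<le> b * c" using hc by linarith
      then have "1 \<le> exp (b * c)" by simp
      then show ?thesis using mult_left_mono[of 1 "exp (b * c)" "\<bar>?y\<bar>"] by simp
    qed
    finally show ?thesis .
  qed
  then have "\<bar>?y\<bar> * \<bar>exp ?y - 1\<bar> \<le> \<bar>?y\<bar> * (\<bar>?y\<bar> * exp (b * c))" by (rule mult_left_mono) simp
  also have "\<dots> = h\<^sup>2 * c\<^sup>2 * exp (b * c)"
    by (simp add: abs_mult power2_eq_square c)
  finally show ?thesis using le by simp
qed

text \<open>The parameter \<open>m\<close> labels a wave with amplitude \<open>W m\<close>,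
  frequency \<open>Z m\<close> and phase \<open>\<theta> m\<close>, damped at the rate of its
  symbol. In the application \<open>m\<close> is a pair of a point of the initial datum and a
  frequency. \<open>moments\<close> provides dominating functions for the superposition and its
  derivatives at every positive time.\<close>

locale wave_superposition = sigma_finite_measure M
  for M :: "'m measure" +
  fixes a :: real and W :: "'m \<Rightarrow> real" and Z :: "'m \<Rightarrow> real^'n" and \<theta> :: "'m \<Rightarrow> real"
  assumes a: "0 < a" "a < 2"
    and W [measurable]: "W \<in> borel_measurable M"
    and Z [measurable]: "Z \<in> borel_measurable M"
    and \<theta> [measurable]: "\<theta> \<in> borel_measurable M"
    and moments: "\<And>p N. 0 < p \<Longrightarrow> integrable M (\<lambda>m. W m * (norm (Z m) ^ N * exp (- p * norm (Z m) powr a)))"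
begin

abbreviation w :: "real \<Rightarrow> 'm \<Rightarrow> real" where
  "w r m \<equiv> W m * exp (- r * norm (Z m) powr a)"

definition V :: "real \<Rightarrow> real^'n \<Rightarrow> real" where
  "V p x = (LINT m|M. w p m * cos (Z m \<bullet> x - \<theta> m))"

text \<open>The common dominating function. It decreases in \<open>p\<close>, so \<open>E p0\<close>
  controls all times from \<open>p0\<close> on, and it is integrable for positive
  \<open>p0\<close>.\<close>

definition E :: "real \<Rightarrow> 'm \<Rightarrow> real" where
  "E p m = \<bar>W m\<bar> * exp (- p * norm (Z m) powr a)"

lemma E_nonneg [simp]: "0 \<le> E p m" by (simp add: E_def)

lemma E_measurable [measurable]: "E p \<in> borel_measurable M"
  unfolding E_def by measurable

lemma integrable_E:
  assumes p: "0 < p"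
  shows "integrable M (\<lambda>m. E p m * norm (Z m) ^ N)"
  using integrable_abs[OF moments[OF p, of N]] by (simp add: E_def abs_mult mult_ac)

lemma integrable_E_0: "0 < p \<Longrightarrow> integrable M (E p)"
  using integrable_E[of p 0] by simp

lemma E_mono: "p \<le> p' \<Longrightarrow> E p' m \<le> E p m"
  by (simp add: E_def mult_left_mono mult_right_mono)

lemma integrable_V:
  assumes p: "0 < p"
  shows "integrable M (\<lambda>m. w p m * cos (Z m \<bullet> x - \<theta> m))"
  by (rule Bochner_Integration.integrable_bound[OF integrable_E_0[OF p]])
     (auto simp: E_def abs_mult mult_left_le intro!: AE_I2 mult_left_le)

lemma V_bound:
  assumes p: "0 < p0" "p0 \<le> p"
  shows "\<bar>V p x\<bar> \<le> (LINT m|M. E p0 m)"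
proof -
  have "norm (V p x) \<le> (LINT m|M. norm (w p m * cos (Z m \<bullet> x - \<theta> m)))"
    unfolding V_def by (rule integral_norm_bound)
  also have "\<dots> \<le> (LINT m|M. E p0 m)"
  proof (rule integral_mono[OF integrable_norm[OF integrable_V] integrable_E_0])
    fix m
    have "norm (w p m * cos (Z m \<bullet> x - \<theta> m)) \<le> E p m"
      by (auto simp: E_def abs_mult intro!: mult_left_le)
    then show "norm (w p m * cos (Z m \<bullet> x - \<theta> m)) \<le> E p0 m"
      using E_mono[OF p(2)] order_trans by blast
  qed (use p in auto)
  finally show ?thesis by simp
qed

lemma continuous_on_V:
  assumes p: "0 < p0"
  shows "continuous_on ({p0..} \<times> UNIV) (\<lambda>(p, x). V p x)"
  unfolding V_def case_prod_unfold
proof (rule continuous_on_LINT[where g="E p0"])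
  fix s :: "real \<times> (real^'n)" and m assume s: "s \<in> {p0..} \<times> UNIV"
  have "norm (w (fst s) m * cos (Z m \<bullet> snd s - \<theta> m)) \<le> E (fst s) m"
    by (auto simp: E_def abs_mult intro!: mult_left_le)
  also have "\<dots> \<le> E p0 m" using s by (intro E_mono) (simp add: mem_Times_iff)
  finally show "norm (w (fst s) m * cos (Z m \<bullet> snd s - \<theta> m)) \<le> E p0 m" .
next
  fix m
  show "continuous_on ({p0..} \<times> UNIV) (\<lambda>s. w (fst s) m * cos (Z m \<bullet> snd s - \<theta> m))"
    by (intro continuous_intros)
next
  fix s :: "real \<times> (real^'n)"
  show "(\<lambda>m. w (fst s) m * cos (Z m \<bullet> snd s - \<theta> m)) \<in> borel_measurable M"
    by measurable
qed (rule integrable_E_0[OF p])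

lemma continuous_on_V_space:
  assumes p: "0 < p"
  shows "continuous_on UNIV (V p)"
proof -
  have "continuous_on UNIV (\<lambda>x. (\<lambda>(p, x). V p x) (p, x))"
    by (rule continuous_on_compose2[OF continuous_on_V[OF p]]) (auto intro!: continuous_intros)
  then show ?thesis by simp
qed

definition V' :: "real \<Rightarrow> real^'n \<Rightarrow> real^'n \<Rightarrow> real" where
  "V' p x z = (LINT m|M. w p m * (- sin (Z m \<bullet> x - \<theta> m) * (Z m \<bullet> z)))"

lemma integrable_V':
  assumes p: "0 < p"
  shows "integrable M (\<lambda>m. w p m * (- sin (Z m \<bullet> x - \<theta> m) * (Z m \<bullet> z)))"
proof (rule Bochner_Integration.integrable_bound[OF integrable_mult_right[OF integrable_E[OF p, of 1], of "norm z"]])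
  show "AE m in M. norm (w p m * (- sin (Z m \<bullet> x - \<theta> m) * (Z m \<bullet> z)))
      \<le> norm (norm z * (E p m * norm (Z m) ^ 1))"
  proof (rule AE_I2)
    fix m
    have "\<bar>sin (Z m \<bullet> x - \<theta> m)\<bar> * \<bar>Z m \<bullet> z\<bar> \<le> 1 * (norm (Z m) * norm z)"
      by (intro mult_mono Cauchy_Schwarz_ineq2) auto
    then have "E p m * (\<bar>sin (Z m \<bullet> x - \<theta> m)\<bar> * \<bar>Z m \<bullet> z\<bar>) \<le> E p m * (norm (Z m) * norm z)"
      by (intro mult_left_mono) auto
    then show "norm (w p m * (- sin (Z m \<bullet> x - \<theta> m) * (Z m \<bullet> z)))
      \<le> norm (norm z * (E p m * norm (Z m) ^ 1))"
      by (simp add: abs_mult E_def mult_ac)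
  qed
qed measurable

text \<open>The flag \<open>b\<close> covers two uses: \<open>True\<close> gives the first-order
  Taylor remainder, and \<open>norm z < 1\<close> gives \<open>levy_increment\<close>.\<close>

lemma V_increment:
  assumes p: "0 < p"
  shows "V p (x + z) - V p x - (if b then V' p x z else 0) = (LINT m|M. w p m *
    (cos (Z m \<bullet> (x + z) - \<theta> m) - cos (Z m \<bullet> x - \<theta> m) - (if b then - sin (Z m \<bullet> x - \<theta> m) * (Z m \<bullet> z) else 0)))"
proof -
  define F where "F y m = w p m * cos (Z m \<bullet> y - \<theta> m)" for y m
  define F' where "F' m = w p m * (- sin (Z m \<bullet> x - \<theta> m) * (Z m \<bullet> z))" for m
  have F: "integrable M (F y)" "V p y = (LINT m|M. F y m)" for y
    unfolding F_def V_def by (rule integrable_V[OF p]) simp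
  have F': "integrable M F'" "V' p x z = (LINT m|M. F' m)"
    unfolding F'_def V'_def by (rule integrable_V'[OF p]) simp
  have "V p (x + z) - V p x - (if b then V' p x z else 0) = (LINT m|M. F (x + z) m - F x m - (if b then F' m else 0))"
    by (simp add: F F')
  also have "\<dots> = (LINT m|M. w p m *
    (cos (Z m \<bullet> (x + z) - \<theta> m) - cos (Z m \<bullet> x - \<theta> m) - (if b then - sin (Z m \<bullet> x - \<theta> m) * (Z m \<bullet> z) else 0)))"
    by (rule Bochner_Integration.integral_cong) (simp_all add: F_def F'_def right_diff_distrib)
  finally show ?thesis .
qed

lemma V_remainder:
  assumes p: "0 < p"
  shows "\<bar>V p (x + z) - V p x - V' p x z\<bar> \<le> (LINT m|M. E p m * norm (Z m) ^ 2) * (norm z)\<^sup>2"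
proof -
  let ?R = "\<lambda>m. cos (Z m \<bullet> (x + z) - \<theta> m) - cos (Z m \<bullet> x - \<theta> m) - (- sin (Z m \<bullet> x - \<theta> m) * (Z m \<bullet> z))"
  have eq: "V p (x + z) - V p x - V' p x z = (LINT m|M. w p m * ?R m)"
    using V_increment[OF p, of x z True] by (simp only: if_True)
  have "norm (V p (x + z) - V p x - V' p x z) \<le> (LINT m|M. norm (w p m * ?R m))"
    unfolding eq by (rule integral_norm_bound)
  also have "\<dots> \<le> (LINT m|M. (E p m * norm (Z m) ^ 2) * (norm z)\<^sup>2)"
  proof (rule integral_mono_AE')
    show "integrable M (\<lambda>m. E p m * (norm (Z m))\<^sup>2 * (norm z)\<^sup>2)"
      by (rule integrable_mult_left[OF integrable_E[OF p]])
    show "AE m in M. norm (w p m * ?R m) \<le> E p m * (norm (Z m))\<^sup>2 * (norm z)\<^sup>2"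
    proof (rule AE_I2)
      fix m
      have "Z m \<bullet> (x + z) - \<theta> m = (Z m \<bullet> x - \<theta> m) + Z m \<bullet> z" by (simp add: inner_add_right)
      then have "\<bar>?R m\<bar> \<le> (Z m \<bullet> z)\<^sup>2 / 2"
        using cos_quadratic_remainder[of "Z m \<bullet> x - \<theta> m" "Z m \<bullet> z"]
        by (simp only: mult_minus_left diff_minus_eq_add)
      also have "\<dots> \<le> (norm (Z m))\<^sup>2 * (norm z)\<^sup>2"
        using inner_power2_le[of "Z m" z] zero_le_power2[of "Z m \<bullet> z"] by linarith
      finally have "\<bar>?R m\<bar> \<le> (norm (Z m))\<^sup>2 * (norm z)\<^sup>2" .
      from mult_left_mono[OF this E_nonneg[of p m]]
      have "E p m * \<bar>?R m\<bar> \<le> E p m * ((norm (Z m))\<^sup>2 * (norm z)\<^sup>2)" .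
      then show "norm (w p m * ?R m) \<le> E p m * (norm (Z m))\<^sup>2 * (norm z)\<^sup>2"
        by (simp only: E_def real_norm_def abs_mult abs_exp_cancel mult.assoc)
    qed
  qed simp
  also have "\<dots> = (LINT m|M. E p m * norm (Z m) ^ 2) * (norm z)\<^sup>2"
    by (rule integral_mult_left_zero)
  finally show ?thesis by (simp only: real_norm_def)
qed

lemma bounded_linear_V':
  assumes p: "0 < p"
  shows "bounded_linear (V' p x)"
  unfolding linear_conv_bounded_linear[symmetric]
proof (rule linearI)
  fix y z :: "real^'n" and c :: real
  show "V' p x (y + z) = V' p x y + V' p x z"
    unfolding V'_def inner_add_right distrib_left
    by (rule Bochner_Integration.integral_add[OF integrable_V'[OF p] integrable_V'[OF p]])
  have "V' p x (c *\<^sub>R z) = (LINT m|M. c * (w p m * (- sin (Z m \<bullet> x - \<theta> m) * (Z m \<bullet> z))))"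
    unfolding V'_def by (intro Bochner_Integration.integral_cong) auto
  also have "\<dots> = c * V' p x z" unfolding V'_def by (rule integral_mult_right_zero)
  finally show "V' p x (c *\<^sub>R z) = c *\<^sub>R V' p x z" by simp
qed

lemma has_derivative_V:
  assumes p: "0 < p"
  shows "(V p has_derivative V' p x) (at x)"
  by (rule has_derivative_quadratic_remainder[OF bounded_linear_V'[OF p] zero_less_one, where C="LINT m|M. E p m * norm (Z m) ^ 2"])
     (simp add: V_remainder[OF p])

lemma levy_integrable_V:
  assumes p: "0 < p"
  shows "levy_integrable a (V p) x"
proof -
  define A where "A = (LINT m|M. E p m * norm (Z m) ^ 2)"
  define B where "B = (LINT m|M. E p m)"
  have nn: "0 \<le> A" "0 \<le> B"
    unfolding A_def B_def by (auto intro!: Bochner_Integration.integral_nonneg)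
  show ?thesis
  proof (rule levy_integrableI[where b=0 and C="A + 2 * B", OF a order_refl a(1) _ has_derivative_V[OF p]])
    fix z :: "real^'n"
    have "\<bar>V p (x + z) - V p x - V' p x z\<bar> \<le> A * (norm z)\<^sup>2"
      using V_remainder[OF p, of x z] by (simp only: A_def)
    also have "\<dots> \<le> (A + 2 * B) * (norm z)\<^sup>2" using nn by (intro mult_right_mono) auto
    finally show "norm (V p (x + z) - V p x - V' p x z) \<le> (A + 2 * B) * (norm z)\<^sup>2"
      by simp
    assume "1 \<le> norm z"
    then have "z \<noteq> 0" by auto
    moreover have "\<bar>V p y\<bar> \<le> B" for y unfolding B_def by (rule V_bound[OF p order_refl])
    then have "\<bar>V p (x + z)\<bar> \<le> B" "\<bar>V p x\<bar> \<le> B" by blast+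
    ultimately show "norm (V p (x + z) - V p x) \<le> (A + 2 * B) * norm z powr 0"
      using nn by simp
  qed (use continuous_on_V_space[OF p] in \<open>auto intro: borel_measurable_continuous_onI\<close>)
qed

text \<open>Every wave is multiplied by its symbol. This is both the time derivative of
  \<open>V\<close> and its fractional Laplacian, so \<open>V\<close> solves the linear
  equation.\<close>

definition DV :: "real \<Rightarrow> real^'n \<Rightarrow> real" where
  "DV p x = (LINT m|M. w p m * (- (norm (Z m) powr a) * cos (Z m \<bullet> x - \<theta> m)))"

text \<open>\<open>moments\<close> speaks of integer powers of the frequency; this bound replaces
  the real power in the symbol by such powers.\<close>

lemma powr_a_le: "norm (Z m) powr a \<le> 1 + (norm (Z m))\<^sup>2"
proof (cases "norm (Z m) \<le> 1")
  case True
  then have "norm (Z m) powr a \<le> 1" using a by (simp add: powr_le1)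
  then show ?thesis by (simp add: add_increasing2)
next
  case False
  then have "norm (Z m) powr a \<le> norm (Z m) powr 2" using a by (intro powr_mono) auto
  also have "\<dots> = (norm (Z m))\<^sup>2" using False by (simp add: powr_numeral)
  finally show ?thesis by simp
qed

lemma integrable_E_1p: "0 < p \<Longrightarrow> integrable M (\<lambda>m. E p m * (1 + (norm (Z m))\<^sup>2))"
  using Bochner_Integration.integrable_add[OF integrable_E_0 integrable_E[of p 2]] by (simp add: distrib_left)

lemma integrable_DV:
  assumes p: "0 < p"
  shows "integrable M (\<lambda>m. w p m * (- (norm (Z m) powr a) * cos (Z m \<bullet> x - \<theta> m)))"
proof (rule Bochner_Integration.integrable_bound[OF integrable_E_1p[OF p]])
  show "AE m in M. norm (w p m * (- (norm (Z m) powr a) * cos (Z m \<bullet> x - \<theta> m)))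
      \<le> norm (E p m * (1 + (norm (Z m))\<^sup>2))"
  proof (rule AE_I2)
    fix m
    have "norm (Z m) powr a * \<bar>cos (Z m \<bullet> x - \<theta> m)\<bar> \<le> norm (Z m) powr a"
      by (rule mult_left_le) auto
    then have "E p m * (norm (Z m) powr a * \<bar>cos (Z m \<bullet> x - \<theta> m)\<bar>) \<le> E p m * (1 + (norm (Z m))\<^sup>2)"
      using powr_a_le[of m] by (intro mult_left_mono) auto
    then show "norm (w p m * (- (norm (Z m) powr a) * cos (Z m \<bullet> x - \<theta> m)))
      \<le> norm (E p m * (1 + (norm (Z m))\<^sup>2))"
      by (simp add: abs_mult E_def mult_ac)
  qed
qed measurable

lemma has_derivative_V_time:
  assumes p: "0 < p"
  shows "((\<lambda>p. V p x) has_real_derivative DV p x) (at p)"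
  unfolding has_field_derivative_def
\<comment> \<open>The radius \<open>p/2\<close> leaves half of the damping:
  \<open>E p m * exp (p / 2 * norm (Z m) powr a)\<close> is \<open>E (p/2) m\<close>, whose moments
  are integrable.\<close>
proof (rule has_derivative_quadratic_remainder[where r="p/2" and C="LINT m|M. E (p/2) m * (1 + (norm (Z m))\<^sup>2)\<^sup>2"])
  fix h :: real assume h: "norm h < p/2"
  let ?c = "\<lambda>m. norm (Z m) powr a"
  let ?R = "\<lambda>m. W m * exp (- (p + h) * ?c m) * cos (Z m \<bullet> x - \<theta> m) - W m * exp (- p * ?c m) * cos (Z m \<bullet> x - \<theta> m)
     - h * (W m * exp (- p * ?c m) * (- ?c m * cos (Z m \<bullet> x - \<theta> m)))"
  have ph: "0 < p + h" using h by auto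
  have p2: "0 < p/2" using p by simp
  define F where "F q m = W m * exp (- q * ?c m) * cos (Z m \<bullet> x - \<theta> m)" for q m
  define F' where "F' m = W m * exp (- p * ?c m) * (- ?c m * cos (Z m \<bullet> x - \<theta> m))" for m
  have F: "integrable M (F q)" "V q x = (LINT m|M. F q m)" if "0 < q" for q
    unfolding F_def V_def by (rule integrable_V[OF that]) simp
  have F': "integrable M F'" "DV p x = (LINT m|M. F' m)"
    unfolding F'_def DV_def by (rule integrable_DV[OF p]) simp
  have "V (p + h) x - V p x - DV p x * h = (LINT m|M. F (p + h) m - F p m - h * F' m)"
    by (simp add: F[OF p] F[OF ph] F')
  also have "\<dots> = (LINT m|M. ?R m)"
    by (simp only: F_def F'_def)
  finally have eq: "V (p + h) x - V p x - DV p x * h = (LINT m|M. ?R m)" .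
  have "norm (V (p + h) x - V p x - DV p x * h) \<le> (LINT m|M. norm (?R m))"
    unfolding eq by (rule integral_norm_bound)
  also have "\<dots> \<le> (LINT m|M. (E (p/2) m * (1 + (norm (Z m))\<^sup>2)\<^sup>2) * (norm h)\<^sup>2)"
  proof (rule integral_mono_AE')
    have "integrable M (\<lambda>m. E (p/2) m * (1 + (norm (Z m))\<^sup>2)\<^sup>2)"
      using Bochner_Integration.integrable_add[OF Bochner_Integration.integrable_add[OF integrable_E_0[OF p2] integrable_mult_right[OF integrable_E[OF p2, of 2], of 2]] integrable_E[OF p2, of 4]]
      by (simp add: power2_eq_square power4_eq_xxxx algebra_simps)
    then show "integrable M (\<lambda>m. E (p/2) m * (1 + (norm (Z m))\<^sup>2)\<^sup>2 * (norm h)\<^sup>2)" by (rule integrable_mult_left)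
    show "AE m in M. norm (?R m) \<le> E (p/2) m * (1 + (norm (Z m))\<^sup>2)\<^sup>2 * (norm h)\<^sup>2"
    proof (rule AE_I2)
      fix m
      have "?R m = W m * exp (- p * ?c m) * cos (Z m \<bullet> x - \<theta> m) * (exp (- h * ?c m) - 1 + h * ?c m)"
        by (simp add: algebra_simps exp_add[symmetric])
      then have "norm (?R m) = E p m * \<bar>cos (Z m \<bullet> x - \<theta> m)\<bar> * \<bar>exp (- h * ?c m) - 1 + h * ?c m\<bar>"
        by (simp add: E_def abs_mult)
      also have "\<dots> \<le> E p m * 1 * (h\<^sup>2 * (?c m)\<^sup>2 * exp (p / 2 * ?c m))"
        using h by (intro mult_mono exp_quadratic_remainder) auto
      also have "\<dots> = (E p m * exp (p / 2 * ?c m)) * (?c m)\<^sup>2 * (norm h)\<^sup>2" by (simp add: mult_ac)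
      also have "E p m * exp (p / 2 * ?c m) = E (p/2) m"
        by (simp add: E_def mult.assoc exp_add[symmetric])
      also have "E (p/2) m * (?c m)\<^sup>2 * (norm h)\<^sup>2 \<le> E (p/2) m * (1 + (norm (Z m))\<^sup>2)\<^sup>2 * (norm h)\<^sup>2"
        by (intro mult_left_mono mult_right_mono power_mono powr_a_le) auto
      finally show "norm (?R m) \<le> E (p/2) m * (1 + (norm (Z m))\<^sup>2)\<^sup>2 * (norm h)\<^sup>2" .
    qed
  qed simp
  also have "\<dots> = (LINT m|M. E (p/2) m * (1 + (norm (Z m))\<^sup>2)\<^sup>2) * (norm h)\<^sup>2"
    by (rule integral_mult_left_zero)
  finally show "norm (V (p + h) x - V p x - DV p x * h) \<le> (LINT m|M. E (p/2) m * (1 + (norm (Z m))\<^sup>2)\<^sup>2) * (norm h)\<^sup>2" .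
qed (use p in \<open>auto intro: bounded_linear_mult_right\<close>)

text \<open>Fubini exchanges the Levy integral with the integral over the waves, after which the
  symbol acts on each wave. The dominating function is a product: the increment of a wave is
  quadratic in \<open>z\<close> near 0 and bounded far away, which matches the integrability of the
  kernel.\<close>

lemma frac_laplacian_V:
  assumes p: "0 < p"
  shows "frac_laplacian a (V p) x = DV p x"
proof -
  interpret P: pair_sigma_finite M "lborel :: (real^'n) measure" ..
  let ?D = "\<lambda>m z. cos (Z m \<bullet> (x + z) - \<theta> m) - cos (Z m \<bullet> x - \<theta> m) - (if norm z < 1 then - sin (Z m \<bullet> x - \<theta> m) * (Z m \<bullet> z) else 0)"
  let ?J = "\<lambda>m z. levy_kernel a z * (w p m * ?D m z)"
  let ?g = "\<lambda>m. E p m * (2 + (norm (Z m))\<^sup>2)" and ?h = "\<lambda>z::real^'n. min ((norm z)\<^sup>2) 1 * levy_kernel a z"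
  have g: "integrable M ?g"
    using Bochner_Integration.integrable_add[OF integrable_mult_right[OF integrable_E_0[OF p], of 2] integrable_E[OF p, of 2]]
    by (simp add: algebra_simps)
  have h: "integrable lborel ?h" by (rule integrable_min_levy_kernel[OF a])
  have bound: "norm (?J m z) \<le> ?g m * ?h z" for m z
  proof -
    have "\<bar>?D m z\<bar> \<le> (2 + (norm (Z m))\<^sup>2) * min ((norm z)\<^sup>2) 1"
    proof (cases "norm z < 1")
      case True
      have "Z m \<bullet> (x + z) - \<theta> m = (Z m \<bullet> x - \<theta> m) + Z m \<bullet> z" by (simp add: inner_add_right)
      then have "\<bar>?D m z\<bar> \<le> (Z m \<bullet> z)\<^sup>2 / 2"
        using cos_quadratic_remainder[of "Z m \<bullet> x - \<theta> m" "Z m \<bullet> z"] True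
        by (simp only: if_True mult_minus_left diff_minus_eq_add)
      also have "\<dots> \<le> (2 + (norm (Z m))\<^sup>2) * (norm z)\<^sup>2"
        using inner_power2_le[of "Z m" z] zero_le_power2[of "norm z"] zero_le_power2[of "Z m \<bullet> z"]
        unfolding distrib_right by linarith
      also have "(norm z)\<^sup>2 = min ((norm z)\<^sup>2) 1" using True by (simp add: min_def power_le_one)
      finally show ?thesis .
    next
      case False
      then have "min ((norm z)\<^sup>2) 1 = 1" by (simp add: one_le_power)
      moreover have "\<bar>cos (Z m \<bullet> (x + z) - \<theta> m) - cos (Z m \<bullet> x - \<theta> m)\<bar> \<le> 2 + (norm (Z m))\<^sup>2"
        using abs_cos_le_one[of "Z m \<bullet> (x + z) - \<theta> m"] abs_cos_le_one[of "Z m \<bullet> x - \<theta> m"]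
          zero_le_power2[of "norm (Z m)"] by linarith
      ultimately show ?thesis using False by simp
    qed
    then have "E p m * (levy_kernel a z * \<bar>?D m z\<bar>) \<le> E p m * (levy_kernel a z * ((2 + (norm (Z m))\<^sup>2) * min ((norm z)\<^sup>2) 1))"
      by (intro mult_left_mono) auto
    then show ?thesis by (simp add: E_def abs_mult mult_ac)
  qed
  have [measurable]: "(\<lambda>(m, z). ?J m z) \<in> borel_measurable (M \<Otimes>\<^sub>M lborel)"
    by measurable
  have int: "integrable (M \<Otimes>\<^sub>M lborel) (\<lambda>(m, z). ?J m z)"
  proof (rule Bochner_Integration.integrable_bound)
    show "integrable (M \<Otimes>\<^sub>M lborel) (\<lambda>(m, z). ?g m * ?h z)"
    proof (rule P.Fubini_integrable)
      show "integrable M (\<lambda>m. LINT z|lborel. norm ((\<lambda>(m, z). ?g m * ?h z) (m, z)))"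
        using g by (simp add: abs_mult)
      show "AE m in M. integrable lborel (\<lambda>z. (\<lambda>(m, z). ?g m * ?h z) (m, z))"
        using h by (simp add: AE_I2)
    qed measurable
    show "AE q in M \<Otimes>\<^sub>M lborel. norm ((\<lambda>(m, z). ?J m z) q) \<le> norm ((\<lambda>(m, z). ?g m * ?h z) q)"
      using bound by (intro AE_I2) (auto simp: case_prod_unfold intro: order_trans[OF _ abs_ge_self])
  qed measurable
  have "levy_integral a (V p) x = (LINT z|lborel. levy_kernel a z * levy_increment (V p) x z)"
    by (simp add: levy_integral_eq[OF levy_integrable_V[OF p]])
  also have "\<dots> = (LINT z|lborel. (LINT m|M. ?J m z))"
  proof (rule Bochner_Integration.integral_cong[OF refl])
    fix z
    have "levy_increment (V p) x z = (LINT m|M. w p m * ?D m z)"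
      unfolding levy_increment_def frechet_derivative_at[OF has_derivative_V[OF p], symmetric]
      by (rule V_increment[OF p])
    then show "levy_kernel a z * levy_increment (V p) x z = (LINT m|M. ?J m z)"
      by (simp only: integral_mult_right_zero)
  qed
  also have "\<dots> = (LINT m|M. (LINT z|lborel. ?J m z))"
    using P.Fubini_integral[OF int] by simp
  also have "\<dots> = (LINT m|M. w p m * (LINT z|lborel. levy_kernel a z * ?D m z))"
    by (simp only: mult.left_commute[of "levy_kernel _ _"] integral_mult_right_zero)
  finally have "frac_laplacian a (V p) x = frac_laplacian_const TYPE('n) a * (LINT m|M. w p m * (LINT z|lborel. levy_kernel a z * ?D m z))"
    by (simp add: frac_laplacian_def)
  also have "\<dots> = (LINT m|M. w p m * (frac_laplacian_const TYPE('n) a * (LINT z|lborel. levy_kernel a z * ?D m z)))"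
    by (simp only: integral_mult_right_zero[symmetric] mult.left_commute)
  also have "\<dots> = DV p x"
    by (simp only: integral_levy_cos[OF a] DV_def)
  finally show ?thesis .
qed

end

section \<open>A barrier and the maximum principle\<close>

text \<open>The barrier has to grow at infinity and still have a bounded fractional Laplacian for
  every order between 0 and 2. A logarithm grows slower than every positive power, and the summand 1
  keeps the function smooth and nonnegative at the origin.\<close>

definition log_barrier :: "'a::real_inner \<Rightarrow> real" where
  "log_barrier x = ln (1 + (norm x)\<^sup>2)"

lemma log_barrier_nonneg [simp]: "0 \<le> log_barrier x"
  by (simp add: log_barrier_def)

lemma one_plus_norm_sq_pos: "0 < 1 + (norm x)\<^sup>2"
  by (rule add_pos_nonneg) auto

lemma continuous_on_log_barrier: "continuous_on S log_barrier"
  unfolding log_barrier_def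
  by (intro continuous_intros) (use one_plus_norm_sq_pos less_imp_neq in \<open>metis not_sym\<close>)

lemma norm_le_log_barrier: "(norm x)\<^sup>2 \<le> exp (log_barrier x)"
  using one_plus_norm_sq_pos[of x] by (simp add: log_barrier_def)

lemma has_derivative_log_barrier:
  "(log_barrier has_derivative (\<lambda>z. 2 * (x \<bullet> z) / (1 + (norm x)\<^sup>2))) (at x)"
proof -
  have "((\<lambda>y. ln (1 + y \<bullet> y)) has_derivative (\<lambda>z. 2 * (x \<bullet> z) / (1 + x \<bullet> x))) (at x)"
    using one_plus_norm_sq_pos[of x]
    by (auto intro!: derivative_eq_intros simp: power2_norm_eq_inner inner_commute divide_inverse)
  then show ?thesis by (simp add: log_barrier_def[abs_def] power2_norm_eq_inner)
qed

text \<open>The inequality \<open>ln t \<le> t - 1\<close> at \<open>B / A\<close> gives one side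
  and at \<open>A / B\<close> the other. The latter leaves
  \<open>2 * (x \<bullet> z) * (1 / A - 1 / B)\<close>, where \<open>2 * norm x \<le> A\<close> and
  \<open>\<bar>A - B\<bar> \<le> norm z * (3 * B)\<close> cancel the denominators; hence a constant
  that does not depend on \<open>x\<close>.\<close>

lemma log_barrier_near:
  assumes z: "norm z < 1"
  shows "\<bar>log_barrier (x + z) - log_barrier x - 2 * (x \<bullet> z) / (1 + (norm x)\<^sup>2)\<bar> \<le> 3 * (norm z)\<^sup>2"
proof -
  define A where "A = 1 + (norm x)\<^sup>2"
  define B where "B = 1 + (norm (x + z))\<^sup>2"
  have A: "1 \<le> A" and B: "1 \<le> B" by (simp_all add: A_def B_def)
  have BA: "B - A = 2 * (x \<bullet> z) + (norm z)\<^sup>2"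
    by (simp add: A_def B_def power2_norm_eq_inner inner_simps inner_commute)
  have d: "log_barrier (x + z) - log_barrier x = ln (B / A)"
    using A B by (simp add: log_barrier_def A_def[symmetric] B_def[symmetric] ln_div)
  have "ln (B / A) \<le> B / A - 1" using A B by (intro ln_le_minus_one) auto
  also have "\<dots> = 2 * (x \<bullet> z) / A + (norm z)\<^sup>2 / A" using A BA by (simp add: field_simps)
  also have "(norm z)\<^sup>2 / A \<le> (norm z)\<^sup>2" using A by (simp add: divide_le_eq mult_le_cancel_left1)
  finally have up: "ln (B / A) - 2 * (x \<bullet> z) / A \<le> (norm z)\<^sup>2" by simp
  have x: "2 * norm x \<le> A" using sum_squares_bound[of 1 "norm x"] by (simp add: A_def)
  have xz: "2 * norm (x + z) \<le> B" using sum_squares_bound[of 1 "norm (x + z)"] by (simp add: B_def)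
  have nx: "norm x \<le> norm (x + z) + norm z" by (metis add_diff_cancel norm_triangle_ineq4)
  have "\<bar>2 * (x \<bullet> z)\<bar> \<le> 2 * norm x * norm z" using Cauchy_Schwarz_ineq2[of x z] by simp
  also have "\<dots> \<le> A * norm z" using x by (rule mult_right_mono) simp
  finally have 1: "\<bar>2 * (x \<bullet> z)\<bar> \<le> A * norm z" .
  have "A - B = (norm x - norm (x + z)) * (norm x + norm (x + z))"
    by (simp add: A_def B_def power2_eq_square algebra_simps)
  then have "\<bar>A - B\<bar> = \<bar>norm x - norm (x + z)\<bar> * (norm x + norm (x + z))" by (simp add: abs_mult)
  also have "\<dots> \<le> norm z * (3 * B)"
  proof (rule mult_mono)
    show "\<bar>norm x - norm (x + z)\<bar> \<le> norm z" using norm_triangle_ineq3[of x "x + z"] by simp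
    show "norm x + norm (x + z) \<le> 3 * B" using nx xz z B by linarith
  qed auto
  finally have 2: "\<bar>A - B\<bar> \<le> norm z * (3 * B)" .
  have "- ln (B / A) = ln (A / B)" using A B by (simp add: ln_div)
  also have "\<dots> \<le> A / B - 1" using A B by (intro ln_le_minus_one) auto
  also have "\<dots> = (A - B) / B" using B by (simp add: diff_divide_distrib)
  also have "A - B = - (2 * (x \<bullet> z)) - (norm z)\<^sup>2" using BA by simp
  also have "(- (2 * (x \<bullet> z)) - (norm z)\<^sup>2) / B = - (2 * (x \<bullet> z)) / B - (norm z)\<^sup>2 / B"
    by (rule diff_divide_distrib)
  also have "\<dots> \<le> - (2 * (x \<bullet> z)) / B" using B by simp
  finally have "2 * (x \<bullet> z) / A - ln (B / A) \<le> 2 * (x \<bullet> z) / A - 2 * (x \<bullet> z) / B" by simp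
  also have "\<dots> = - (2 * (x \<bullet> z) * (A - B)) / (A * B)"
    using A B by (simp add: divide_simps) (simp add: algebra_simps)
  also have "\<dots> \<le> \<bar>2 * (x \<bullet> z) * (A - B)\<bar> / (A * B)"
    using A B by (intro divide_right_mono) auto
  also have "\<bar>2 * (x \<bullet> z) * (A - B)\<bar> = \<bar>2 * (x \<bullet> z)\<bar> * \<bar>A - B\<bar>" by (rule abs_mult)
  also have "\<bar>2 * (x \<bullet> z)\<bar> * \<bar>A - B\<bar> / (A * B) \<le> (A * norm z) * (norm z * (3 * B)) / (A * B)"
    using A B by (intro divide_right_mono mult_mono 1 2) auto
  also have "\<dots> = 3 * (norm z)\<^sup>2" using A B by (simp add: power2_eq_square)
  finally have "2 * (x \<bullet> z) / A - ln (B / A) \<le> 3 * (norm z)\<^sup>2" .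
  moreover have "(norm z)\<^sup>2 \<le> 3 * (norm z)\<^sup>2" by simp
  ultimately show ?thesis using up unfolding d A_def[symmetric] by linarith
qed

lemma log_barrier_add_le: "log_barrier (x + z) \<le> log_barrier x + (ln 2 + ln (1 + (norm z)\<^sup>2))"
proof -
  have "(norm (x + z))\<^sup>2 \<le> (norm x + norm z)\<^sup>2" by (intro power_mono norm_triangle_ineq) simp
  also have "\<dots> \<le> 2 * (norm x)\<^sup>2 + 2 * (norm z)\<^sup>2"
    using sum_squares_bound[of "norm x" "norm z"] by (simp add: power2_sum)
  also have "\<dots> \<le> 2 * ((1 + (norm x)\<^sup>2) * (1 + (norm z)\<^sup>2)) - 1"
  proof -
    have "2 * ((1 + (norm x)\<^sup>2) * (1 + (norm z)\<^sup>2)) = 2 + 2 * (norm x)\<^sup>2 + 2 * (norm z)\<^sup>2 + 2 * ((norm x)\<^sup>2 * (norm z)\<^sup>2)"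
      by (simp add: algebra_simps)
    moreover have "0 \<le> (norm x)\<^sup>2 * (norm z)\<^sup>2" by simp
    ultimately show ?thesis by linarith
  qed
  finally have "1 + (norm (x + z))\<^sup>2 \<le> 2 * ((1 + (norm x)\<^sup>2) * (1 + (norm z)\<^sup>2))" by simp
  then have "log_barrier (x + z) \<le> ln (2 * ((1 + (norm x)\<^sup>2) * (1 + (norm z)\<^sup>2)))"
    using one_plus_norm_sq_pos[of "x + z"] unfolding log_barrier_def by (subst ln_le_cancel_iff) auto
  also have "\<dots> = ln 2 + (ln (1 + (norm x)\<^sup>2) + ln (1 + (norm z)\<^sup>2))"
    using one_plus_norm_sq_pos[of x] one_plus_norm_sq_pos[of z] by (simp add: ln_mult)
  finally show ?thesis by (simp add: log_barrier_def)
qed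

text \<open>The subadditive estimate is used for the step \<open>z\<close> from \<open>x\<close> and
  for the step \<open>- z\<close> back, which bounds the absolute value. The 3 covers
  \<open>ln 4\<close>, and \<open>2 / b\<close> comes from
  \<open>ln r \<le> r powr b / b\<close>.\<close>

lemma log_barrier_far:
  assumes z: "1 \<le> norm z" and b: "0 < b"
  shows "\<bar>log_barrier (x + z) - log_barrier x\<bar> \<le> (3 + 2 / b) * norm z powr b"
proof -
  have pb: "1 \<le> norm z powr b" using z b by (simp add: ge_one_powr_ge_zero)
  have "\<bar>log_barrier (x + z) - log_barrier x\<bar> \<le> ln 2 + ln (1 + (norm z)\<^sup>2)"
    using log_barrier_add_le[of x z] log_barrier_add_le[of "x + z" "- z"] by (simp add: abs_le_iff)
  also have "\<dots> \<le> ln 2 + ln (2 * (norm z)\<^sup>2)"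
    using one_le_power[OF z, of 2] one_plus_norm_sq_pos[of z]
    by (intro add_left_mono) (subst ln_le_cancel_iff; linarith)
  also have "\<dots> = ln 4 + 2 * ln (norm z)"
  proof -
    have "z \<noteq> 0" using z by auto
    then show ?thesis using ln_mult[of 2 2] by (simp add: ln_mult ln_realpow)
  qed
  also have "\<dots> \<le> 3 * norm z powr b + 2 * (norm z powr b / b)"
    using ln_le_minus_one[of 4] ln_powr_bound[OF z b] pb by linarith
  finally show ?thesis by (simp add: algebra_simps)
qed

lemma
  assumes a: "0 < a" "a < 2"
  shows levy_integrable_log_barrier: "levy_integrable a (log_barrier :: real^'n \<Rightarrow> real) x"
    and frac_laplacian_log_barrier_bounded:
      "\<exists>L\<ge>0. \<forall>x::real^'n. frac_laplacian a log_barrier x \<le> L"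
proof -
  \<comment> \<open>Any \<open>b\<close> strictly between 0 and \<open>a\<close> would do: positive
    to dominate the logarithm, below \<open>a\<close> to stay integrable against the kernel.\<close>
  define b C where "b = a / 2" and "C = 3 + 2 / b"
  have b: "0 \<le> b" "b < a" "0 < b" and C: "3 \<le> C" using a by (auto simp: b_def C_def)
  have near: "norm (log_barrier (x + z) - log_barrier x - 2 * (x \<bullet> z) / (1 + (norm x)\<^sup>2)) \<le> C * (norm z)\<^sup>2"
    if "norm z < 1" for x z :: "real^'n"
  proof -
    have "norm (log_barrier (x + z) - log_barrier x - 2 * (x \<bullet> z) / (1 + (norm x)\<^sup>2)) \<le> 3 * (norm z)\<^sup>2"
      using log_barrier_near[OF that, of x] by simp
    also have "\<dots> \<le> C * (norm z)\<^sup>2" using C by (rule mult_right_mono) simp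
    finally show ?thesis .
  qed
  have far: "norm (log_barrier (x + z) - log_barrier x) \<le> C * norm z powr b"
    if "1 \<le> norm z" for x z :: "real^'n"
    using log_barrier_far[OF that b(3), of x] by (simp add: C_def)
  have meas: "(log_barrier :: real^'n \<Rightarrow> real) \<in> borel_measurable borel"
    by (intro borel_measurable_continuous_onI continuous_on_log_barrier)
  show "levy_integrable a (log_barrier :: real^'n \<Rightarrow> real) x"
    by (rule levy_integrableI[OF a b(1,2) meas has_derivative_log_barrier near far])
  have le: "\<bar>levy_integral a log_barrier x\<bar> \<le> C * levy_bound TYPE('n) a b" for x :: "real^'n"
    using norm_levy_integral_le[OF a b(1,2) meas has_derivative_log_barrier near far, of x] by simp
  let ?c = "frac_laplacian_const TYPE('n) a"
  have c: "0 < ?c" by (rule frac_laplacian_const_pos[OF a])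
  show "\<exists>L\<ge>0. \<forall>x::real^'n. frac_laplacian a log_barrier x \<le> L"
  proof (intro exI[of _ "?c * (C * levy_bound TYPE('n) a b)"] conjI allI)
    show "0 \<le> ?c * (C * levy_bound TYPE('n) a b)"
      using c order_trans[OF abs_ge_zero le[of 0]] by (intro mult_nonneg_nonneg[of ?c]) auto
    fix x :: "real^'n"
    show "frac_laplacian a log_barrier x \<le> ?c * (C * levy_bound TYPE('n) a b)"
      unfolding frac_laplacian_def using c le[of x] by (intro mult_left_mono) auto
  qed
qed

text \<open>The barrier grows at infinity, so a positive maximum of \<open>y\<close> minus the barrier is attained;
  the drift \<open>\<kappa> L + 1\<close> in time makes the equation fail there.\<close>

lemma nonlocal_maximum_principle:
  fixes y y' :: "real \<Rightarrow> real^'n \<Rightarrow> real"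
  assumes a: "0 < a" "a < 2" and \<delta>: "0 < \<delta>"
    and L: "\<And>x::real^'n. frac_laplacian a log_barrier x \<le> L" "0 \<le> L"
    and cont: "continuous_on ({s..T} \<times> UNIV) (\<lambda>(t, x). y t x)"
    and bdd: "\<And>t x. s \<le> t \<Longrightarrow> t \<le> T \<Longrightarrow> y t x \<le> B"
    and k: "\<And>t. s < t \<Longrightarrow> t \<le> T \<Longrightarrow> 0 \<le> k t" "\<And>t. s < t \<Longrightarrow> t \<le> T \<Longrightarrow> k t \<le> \<kappa>"
    and init: "\<And>x. y s x \<le> \<delta> * (log_barrier x + 1)"
    and levy: "\<And>t x. s < t \<Longrightarrow> t \<le> T \<Longrightarrow> levy_integrable a (y t) x"
    and deriv: "\<And>t x. s < t \<Longrightarrow> t \<le> T \<Longrightarrow> ((\<lambda>r. y r x) has_real_derivative y' t x) (at t)"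
    and sub: "\<And>t x. s < t \<Longrightarrow> t \<le> T \<Longrightarrow> 0 < y t x \<Longrightarrow> y' t x \<le> k t * frac_laplacian a (y t) x"
    and t: "s \<le> t" "t \<le> T"
  shows "y t x \<le> \<delta> * (log_barrier x + 1 + (\<kappa> * L + 1) * (t - s))"
proof (cases "t = s")
  case True
  then show ?thesis using init[of x] by simp
next
  case False
  with t have st: "s < t" by simp
  have kappa: "0 \<le> \<kappa>" using k[of t] st t by linarith
  define C where "C = \<kappa> * L + 1"
  have C: "0 < C" using kappa L by (simp add: C_def add_nonneg_pos)
  define w where "w t x = y t x - \<delta> * (log_barrier x + 1 + C * (t - s))" for t x
  show ?thesis
  proof (rule ccontr)
    assume "\<not> ?thesis"
    then have pos: "0 < w t x" by (simp add: w_def C_def)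
    \<comment> \<open>Beyond this radius the barrier alone exceeds
      \<open>\<bar>B\<bar> / \<delta>\<close>, so \<open>w\<close> is nonpositive there; the maximum
      with \<open>norm x\<close> keeps the assumed counterexample inside the compact set.\<close>
    define R where "R = max (norm x) (sqrt (exp (\<bar>B\<bar> / \<delta>)))"
    have out: "w r z \<le> 0" if r: "s \<le> r" "r \<le> T" and z: "R < norm z" for r z
    proof -
      have "sqrt (exp (\<bar>B\<bar> / \<delta>)) < norm z" using z by (simp add: R_def)
      then have "exp (\<bar>B\<bar> / \<delta>) < (norm z)\<^sup>2"
        by (metis norm_ge_zero real_less_lsqrt real_sqrt_less_iff real_sqrt_unique)
      also have "\<dots> \<le> exp (log_barrier z)" by (rule norm_le_log_barrier)
      finally have "\<bar>B\<bar> / \<delta> < log_barrier z" by simp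
      then have "\<bar>B\<bar> < \<delta> * log_barrier z" using \<delta> by (simp add: field_simps)
      moreover have "\<delta> * log_barrier z \<le> \<delta> * (log_barrier z + 1 + C * (r - s))"
        using \<delta> C r by (intro mult_left_mono) auto
      ultimately show ?thesis using bdd[OF r, of z] by (simp add: w_def)
    qed
    let ?S = "{s..T} \<times> cball (0::real^'n) R"
    have "continuous_on ?S (\<lambda>(t, x). w t x)"
      unfolding w_def case_prod_unfold
    proof (intro continuous_intros)
      show "continuous_on ?S (\<lambda>p. y (fst p) (snd p))"
        using cont unfolding case_prod_unfold by (rule continuous_on_subset) auto
      show "continuous_on ?S (\<lambda>p. log_barrier (snd p))"
        by (rule continuous_on_compose2[OF continuous_on_log_barrier]) (auto intro!: continuous_intros)
    qed
    moreover have "compact ?S" by (intro compact_Times) auto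
    moreover have tx: "(t, x) \<in> ?S" using t by (simp add: R_def)
    ultimately obtain q where q: "q \<in> ?S" "\<forall>q'\<in>?S. (\<lambda>(t, x). w t x) q' \<le> (\<lambda>(t, x). w t x) q"
      using continuous_attains_sup[of ?S "\<lambda>(t, x). w t x"] by blast
    obtain t1 x1 where q_eq: "q = (t1, x1)" by (cases q)
    have t1: "s \<le> t1" "t1 \<le> T" using q q_eq by auto
    have max0: "w r z \<le> w t1 x1" if "(r, z) \<in> ?S" for r z using q that q_eq by fastforce
    have pos1: "0 < w t1 x1" using max0[OF tx] pos by linarith
    have max: "w r z \<le> w t1 x1" if "s \<le> r" "r \<le> T" for r z
    proof (cases "norm z \<le> R")
      case True then show ?thesis using that by (intro max0) auto
    next
      case False then show ?thesis using out[OF that, of z] pos1 by linarith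
    qed
    have "t1 \<noteq> s" using pos1 init[of x1] by (auto simp: w_def)
    then have st1: "s < t1" using t1 by simp
    \<comment> \<open>The differential inequality \<open>sub\<close> is available only where
      \<open>y\<close> is positive.\<close>
    have ypos: "0 < y t1 x1"
    proof -
      have "0 \<le> \<delta> * (log_barrier x1 + 1 + C * (t1 - s))"
        using \<delta> C t1 by (intro mult_nonneg_nonneg add_nonneg_nonneg) auto
      then show ?thesis using pos1 by (simp add: w_def)
    qed
    let ?g = "\<lambda>z. y t1 z + (- \<delta>) * log_barrier z"
    have lb: "levy_integrable a (\<lambda>z. (- \<delta>) * log_barrier z) x1"
      by (rule levy_integrable_cmult[OF levy_integrable_log_barrier[OF a]])
    have ly: "levy_integrable a (y t1) x1" by (rule levy[OF st1 t1(2)])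
    have "?g z \<le> ?g x1" for z using max[OF t1, of z] by (simp add: w_def algebra_simps)
    then have "levy_integral a ?g x1 \<le> 0"
      by (intro levy_integral_nonpos_at_max levy_integrable_add ly lb)
    then have "levy_integral a (y t1) x1 \<le> \<delta> * levy_integral a log_barrier x1"
      by (simp only: levy_integral_add[OF ly lb] levy_integral_cmult[OF levy_integrable_log_barrier[OF a]])
    then have "frac_laplacian_const TYPE('n) a * levy_integral a (y t1) x1
        \<le> frac_laplacian_const TYPE('n) a * (\<delta> * levy_integral a log_barrier x1)"
      using frac_laplacian_const_pos[OF a] by (intro mult_left_mono) (auto intro: less_imp_le)
    then have "frac_laplacian a (y t1) x1 \<le> \<delta> * frac_laplacian a log_barrier x1"
      by (simp add: frac_laplacian_def mult.left_commute)
    also have "\<dots> \<le> \<delta> * L" using \<delta> L by (intro mult_left_mono) auto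
    finally have "k t1 * frac_laplacian a (y t1) x1 \<le> k t1 * (\<delta> * L)"
      using k(1)[OF st1 t1(2)] by (rule mult_left_mono)
    also have "\<dots> \<le> \<kappa> * (\<delta> * L)"
      using k(2)[OF st1 t1(2)] \<delta> L by (intro mult_right_mono) auto
    finally have "y' t1 x1 \<le> \<kappa> * (\<delta> * L)" using sub[OF st1 t1(2) ypos] by linarith
    then have neg: "y' t1 x1 - \<delta> * C < 0" using \<delta> by (simp add: C_def algebra_simps)
    have "((\<lambda>r. w r x1) has_real_derivative y' t1 x1 - \<delta> * C) (at t1)"
      unfolding w_def by (auto intro!: derivative_eq_intros deriv[OF st1 t1(2)])
    \<comment> \<open>A negative time derivative makes \<open>w\<close> larger at slightly earlier
      times. Only the past is compared, so a maximum at \<open>t1 = T\<close> is included.\<close>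
    from has_real_derivative_neg_dec_left[OF this neg]
    obtain d where d: "d > 0" "\<And>h. h > 0 \<Longrightarrow> h < d \<Longrightarrow> w t1 x1 < w (t1 - h) x1" by auto
    define h where "h = min (d / 2) (t1 - s)"
    have h: "0 < h" "h < d" "s \<le> t1 - h" using d(1) st1 by (auto simp: h_def)
    then show False using d(2)[OF h(1,2)] max[of "t1 - h" x1] t1 by linarith
  qed
qed

section \<open>Gaussian mollification and Fourier inversion\<close>

lemma integral_lborel_prod:
  fixes f :: "'a::euclidean_space \<Rightarrow> real \<Rightarrow> 'b::{real_normed_field,banach,second_countable_topology}"
  assumes f: "\<And>b. b \<in> Basis \<Longrightarrow> integrable lborel (f b)"
  shows "(LINT x|lborel. (\<Prod>b\<in>Basis. f b (x \<bullet> b))) = (\<Prod>b\<in>Basis. LINT x|lborel. f b x)"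
proof -
  interpret product_sigma_finite "\<lambda>_::'a. lborel :: real measure" ..
  have [measurable]: "f b \<in> borel_measurable borel" if "b \<in> Basis" for b
    using f[OF that] by (simp add: borel_measurable_integrable)
  have "(LINT x|lborel. (\<Prod>b\<in>Basis. f b (x \<bullet> b)))
      = (LINT g|(\<Pi>\<^sub>M b\<in>Basis. lborel). (\<Prod>b\<in>Basis. f b ((\<Sum>b'\<in>Basis. g b' *\<^sub>R b') \<bullet> b)))"
    by (subst lborel_eq, rule integral_distr) measurable
  also have "\<dots> = (LINT g|(\<Pi>\<^sub>M b\<in>Basis. lborel). (\<Prod>b\<in>Basis. f b (g b)))"
    by (intro Bochner_Integration.integral_cong prod.cong refl arg_cong2[where f=f])
       (simp add: inner_sum_left inner_Basis if_distrib cong: if_cong)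
  also have "\<dots> = (\<Prod>b\<in>Basis. LINT x|lborel. f b x)"
    by (rule product_integral_prod[OF finite_Basis f])
  finally show ?thesis .
qed

text \<open>The product form reduces the Fourier transform to the characteristic function of the
  one-dimensional normal distribution; \<open>gauss_eq\<close> recovers the radial form.\<close>

definition gauss :: "'a::euclidean_space \<Rightarrow> real" where
  "gauss x = (\<Prod>b\<in>Basis. std_normal_density (x \<bullet> b))"

lemma integrable_lborel_pair_mult:
  fixes f :: "'a::euclidean_space \<Rightarrow> real" and g :: "'b::euclidean_space \<Rightarrow> real"
  assumes f: "integrable lborel f" and g: "integrable lborel g"
  shows "integrable (lborel \<Otimes>\<^sub>M lborel) (\<lambda>(y, z). f y * g z)"
proof -
  have [measurable]: "f \<in> borel_measurable borel" "g \<in> borel_measurable borel"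
    using f g by (simp_all add: borel_measurable_integrable)
  show ?thesis
    using f g by (intro lborel_pair.Fubini_integrable) (auto simp: abs_mult)
qed

lemma norm_sq_eq_sum: "(norm (x::'a::euclidean_space))\<^sup>2 = (\<Sum>b\<in>Basis. (x \<bullet> b)\<^sup>2)"
  by (subst power2_norm_eq_inner, subst euclidean_inner) (simp add: power2_eq_square)

lemma gauss_eq:
  "gauss (x::'a::euclidean_space) = exp (- (norm x)\<^sup>2 / 2) / sqrt (2 * pi) ^ DIM('a)"
proof -
  show ?thesis
    by (simp add: gauss_def std_normal_density_def prod_dividef exp_sum[symmetric] norm_sq_eq_sum sum_negf sum_divide_distrib)
qed

lemma gauss_pos: "0 < gauss x" by (simp add: gauss_eq)

lemma gauss_nonneg [simp]: "0 \<le> gauss x" using gauss_pos[of x] by simp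

lemma gauss_le: "gauss (x::'a::euclidean_space) \<le> gauss (0::'a)"
  by (simp add: gauss_eq divide_right_mono)

lemma continuous_on_gauss [continuous_intros]: "continuous_on S f \<Longrightarrow> continuous_on S (\<lambda>x. gauss (f x))"
  unfolding gauss_eq by (intro continuous_intros) auto

lemma borel_measurable_gauss [measurable]: "gauss \<in> borel_measurable borel"
  by (intro borel_measurable_continuous_onI continuous_on_gauss continuous_intros)

lemma integrable_gauss: "integrable lborel (gauss :: 'a::euclidean_space \<Rightarrow> real)"
proof (rule integrableI_nonneg)
  have "(\<integral>\<^sup>+x. ennreal (gauss (x::'a)) \<partial>lborel) = (\<integral>\<^sup>+x. (\<Prod>b\<in>Basis. ennreal (std_normal_density ((x::'a) \<bullet> b))) \<partial>lborel)"
    by (simp add: gauss_def prod_ennreal)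
  also have "\<dots> = (\<Prod>b\<in>(Basis::'a set). (\<integral>\<^sup>+x. ennreal (std_normal_density x) \<partial>lborel))"
    by (rule nn_integral_lborel_prod) auto
  also have "(\<integral>\<^sup>+x. ennreal (std_normal_density x) \<partial>lborel) = 1"
    by (simp add: nn_integral_eq_integral)
  finally show "(\<integral>\<^sup>+x. ennreal (gauss (x::'a)) \<partial>lborel) < \<infinity>" by simp
qed auto

lemma integral_cis_gauss:
  "(LINT x|lborel. cis (z \<bullet> x) * of_real (gauss (x::'a::euclidean_space))) = of_real (exp (- (norm z)\<^sup>2 / 2))"
proof -
  have int: "integrable lborel (\<lambda>x. iexp (t * x) * of_real (std_normal_density x))" for t
    by (rule Bochner_Integration.integrable_bound[of lborel std_normal_density]) (auto simp: norm_mult)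
  have char: "(LINT x|lborel. iexp (t * x) * of_real (std_normal_density x)) = of_real (exp (- t\<^sup>2 / 2))" for t
  proof -
    have "of_real (exp (- t\<^sup>2 / 2)) = char std_normal_distribution t"
      by (simp add: char_std_normal_distribution)
    also have "\<dots> = (LINT x|lborel. std_normal_density x *\<^sub>R iexp (t * x))"
      unfolding char_def by (rule integral_density) auto
    finally show ?thesis by (simp add: scaleR_conv_of_real mult.commute)
  qed
  have "cis (z \<bullet> x) * of_real (gauss x) = (\<Prod>b\<in>Basis. iexp ((z \<bullet> b) * (x \<bullet> b)) * of_real (std_normal_density (x \<bullet> b)))" for x :: 'a
    by (simp add: prod.distrib gauss_def exp_sum[symmetric] sum_distrib_left[symmetric] cis_conv_exp)
      (simp add: euclidean_inner[of z x])
  then have "(LINT x|lborel. cis (z \<bullet> x) * of_real (gauss (x::'a)))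
     = (LINT x|lborel. (\<Prod>b\<in>(Basis::'a set). iexp ((z \<bullet> b) * (x \<bullet> b)) * of_real (std_normal_density (x \<bullet> b))))"
    by simp
  also have "\<dots> = (\<Prod>b\<in>(Basis::'a set). (LINT x|lborel. iexp ((z \<bullet> b) * x) * of_real (std_normal_density x)))"
    by (rule integral_lborel_prod[where f="\<lambda>b x. iexp ((z \<bullet> b) * x) * of_real (std_normal_density x)"]) (rule int)
  also have "\<dots> = of_real (\<Prod>b\<in>(Basis::'a set). exp (- (z \<bullet> b)\<^sup>2 / 2))"
    by (simp only: char of_real_prod)
  also have "(\<Prod>b\<in>(Basis::'a set). exp (- (z \<bullet> b)\<^sup>2 / 2)) = exp (- (norm z)\<^sup>2 / 2)"
    by (simp add: exp_sum[symmetric] norm_sq_eq_sum sum_negf sum_divide_distrib)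
  finally show ?thesis .
qed

lemma integral_gauss_cos:
  "(LINT x|lborel. gauss x * cos (z \<bullet> x)) = exp (- (norm (z::'a::euclidean_space))\<^sup>2 / 2)"
proof -
  have i: "integrable lborel (\<lambda>x::'a. cis (z \<bullet> x) * of_real (gauss x))"
    by (rule Bochner_Integration.integrable_bound[OF integrable_gauss]) (auto simp: norm_mult cis_conv_exp)
  have "exp (- (norm z)\<^sup>2 / 2) = Re (LINT x|lborel. cis (z \<bullet> x) * of_real (gauss (x::'a)))"
    by (simp add: integral_cis_gauss)
  also have "\<dots> = (LINT x|lborel. Re (cis (z \<bullet> x) * of_real (gauss (x::'a))))"
    by (rule integral_Re[OF i, symmetric])
  also have "\<dots> = (LINT x|lborel. gauss x * cos (z \<bullet> x))"
    by (simp add: mult.commute)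
  finally show ?thesis by simp
qed

lemma integral_gauss: "(LINT x|lborel. gauss (x::'a::euclidean_space)) = 1"
  using integral_gauss_cos[of "0::'a"] by simp

text \<open>This is \<open>2 * pi\<close> to the power \<open>d / 2\<close>; its inverse square is
  the factor of the Fourier inversion formula.\<close>

definition gauss_norm :: "'a::euclidean_space itself \<Rightarrow> real" where
  "gauss_norm (T :: 'a itself) = sqrt (2 * pi) ^ DIM('a)"

lemma gauss_norm_pos: "0 < gauss_norm T" by (simp add: gauss_norm_def)

lemma gauss_0: "gauss (0::'a::euclidean_space) = 1 / gauss_norm TYPE('a)"
  by (simp add: gauss_eq gauss_norm_def)

lemma integral_gauss_scaled_cos:
  fixes w :: "'a::euclidean_space"
  assumes c: "0 < c"
  shows "(LINT z|lborel. gauss (c *\<^sub>R z) * cos (z \<bullet> w)) = gauss_norm TYPE('a) * (1 / c) ^ DIM('a) * gauss ((1 / c) *\<^sub>R w)"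
proof -
  have "(LINT z|lborel. gauss (c *\<^sub>R z) * cos (z \<bullet> w))
    = (1 / c) ^ DIM('a) * (LINT z|lborel. gauss z * cos (((1 / c) *\<^sub>R w) \<bullet> z))"
    by (subst integral_lborel_affine[where c="1 / c" and t=0]) (use c in \<open>auto simp: inner_commute\<close>)
  also have "\<dots> = (1 / c) ^ DIM('a) * (gauss_norm TYPE('a) * gauss ((1 / c) *\<^sub>R w))"
    unfolding integral_gauss_cos by (simp add: gauss_eq gauss_norm_def)
  finally show ?thesis by simp
qed

text \<open>Fourier inversion for an integrable transform: both sides are tested against Gaussian mollifiers
  of width \<open>c \<rightarrow> 0\<close> and integrated over boxes.\<close>

locale real_fourier_pair =
  fixes f F :: "'a::euclidean_space \<Rightarrow> real"
  assumes f: "integrable lborel f"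
    and cos_transform: "\<And>z. (LINT y|lborel. f y * cos (z \<bullet> y)) = F z"
    and sin_transform: "\<And>z. (LINT y|lborel. f y * sin (z \<bullet> y)) = 0"
    and F: "integrable lborel F"
begin

definition inv_F :: "'a \<Rightarrow> real" where
  "inv_F x = (1 / gauss_norm TYPE('a))\<^sup>2 * (LINT z|lborel. F z * cos (z \<bullet> x))"

definition mollified :: "real \<Rightarrow> 'a \<Rightarrow> real" where
  "mollified c x = (LINT w|lborel. f (x + c *\<^sub>R w) * gauss w)"

lemma f_measurable [measurable]: "f \<in> borel_measurable borel"
  using f by (simp add: borel_measurable_integrable)

lemma F_measurable [measurable]: "F \<in> borel_measurable borel"
  using F by (simp add: borel_measurable_integrable)

lemma shifted_transform: "(LINT y|lborel. f y * cos (z \<bullet> (y - x))) = F z * cos (z \<bullet> x)"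
proof -
  have c: "integrable lborel (\<lambda>y. f y * cos (z \<bullet> y))" and s: "integrable lborel (\<lambda>y. f y * sin (z \<bullet> y))"
    by (rule Bochner_Integration.integrable_bound[OF f]; auto simp: abs_mult intro!: mult_left_le)+
  have "(LINT y|lborel. f y * cos (z \<bullet> (y - x)))
     = (LINT y|lborel. cos (z \<bullet> x) * (f y * cos (z \<bullet> y)) + sin (z \<bullet> x) * (f y * sin (z \<bullet> y)))"
    by (simp add: inner_diff_right cos_diff algebra_simps)
  also have "\<dots> = cos (z \<bullet> x) * F z"
    using c s by (simp add: cos_transform sin_transform)
  finally show ?thesis by simp
qed

text \<open>Up to scaling the Gaussian is its own transform, so Fubini converts a Gaussian average
  of \<open>f\<close> at width \<open>c\<close> into the inversion integral of \<open>F\<close> with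
  the damping \<open>gauss (c *\<^sub>R z)\<close>.\<close>

lemma mollified_eq:
  assumes c: "0 < c"
  shows "mollified c x = (1 / gauss_norm TYPE('a)) * (LINT z|lborel. gauss (c *\<^sub>R z) * (F z * cos (z \<bullet> x)))"
proof -
  let ?N = "gauss_norm TYPE('a)"
  have gc: "integrable lborel (\<lambda>z::'a. gauss (c *\<^sub>R z))"
    using integrable_lborel_affine[OF integrable_gauss, of c 0] c by simp
  have int: "integrable (lborel \<Otimes>\<^sub>M lborel) (\<lambda>(y, z). f y * (gauss (c *\<^sub>R z) * cos (z \<bullet> (y - x))))"
  proof (rule Bochner_Integration.integrable_bound)
    show "integrable (lborel \<Otimes>\<^sub>M lborel) (\<lambda>(y, z). f y * gauss (c *\<^sub>R (z::'a)))"
      by (rule integrable_lborel_pair_mult[OF f gc])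
  qed (auto simp: abs_mult intro!: AE_I2 mult_left_le mult_left_mono)
  have "(LINT y|lborel. f y * gauss ((1 / c) *\<^sub>R (y - x)))
     = \<bar>c\<bar> ^ DIM('a) *\<^sub>R (LINT w|lborel. f (x + c *\<^sub>R w) * gauss ((1 / c) *\<^sub>R (x + c *\<^sub>R w - x)))"
    using c by (intro integral_lborel_affine) auto
  also have "\<dots> = c ^ DIM('a) * mollified c x" using c by (simp add: mollified_def)
  finally have 1: "(LINT y|lborel. f y * gauss ((1 / c) *\<^sub>R (y - x))) = c ^ DIM('a) * mollified c x" .
  have "(LINT z|lborel. gauss (c *\<^sub>R z) * (F z * cos (z \<bullet> x)))
     = (LINT z|lborel. gauss (c *\<^sub>R z) * (LINT y|lborel. f y * cos (z \<bullet> (y - x))))"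
    by (simp only: shifted_transform)
  also have "\<dots> = (LINT z|lborel. (LINT y|lborel. f y * (gauss (c *\<^sub>R z) * cos (z \<bullet> (y - x)))))"
    by (simp only: integral_mult_right_zero[symmetric] mult.left_commute)
  also have "\<dots> = (LINT y|lborel. (LINT z|lborel. f y * (gauss (c *\<^sub>R z) * cos (z \<bullet> (y - x)))))"
    by (rule lborel_pair.Fubini_integral[OF int])
  also have "\<dots> = (LINT y|lborel. f y * (?N * (1 / c) ^ DIM('a) * gauss ((1 / c) *\<^sub>R (y - x))))"
    by (simp only: integral_mult_right_zero integral_gauss_scaled_cos[OF c])
  also have "\<dots> = (?N * (1 / c) ^ DIM('a)) * (LINT y|lborel. f y * gauss ((1 / c) *\<^sub>R (y - x)))"
    by (simp only: integral_mult_right_zero[symmetric] mult.left_commute)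
  also have "\<dots> = ?N * mollified c x" using c by (simp add: 1 power_divide)
  finally show ?thesis using gauss_norm_pos[of "TYPE('a)"] by simp
qed

lemma integrand_bound:
  "norm (gauss (c *\<^sub>R z) * (F z * cos (z \<bullet> x))) \<le> 1 / gauss_norm TYPE('a) * \<bar>F z\<bar>"
  using gauss_le[of "c *\<^sub>R z"] gauss_norm_pos[of "TYPE('a)"]
  by (auto simp: abs_mult gauss_0[symmetric] intro!: mult_mono mult_left_le)

lemma mollified_bound:
  assumes c: "0 < c"
  shows "\<bar>mollified c x\<bar> \<le> (1 / gauss_norm TYPE('a))\<^sup>2 * (LINT z|lborel. \<bar>F z\<bar>)"
proof -
  let ?N = "gauss_norm TYPE('a)"
  have "norm (LINT z|lborel. gauss (c *\<^sub>R z) * (F z * cos (z \<bullet> x))) \<le> (LINT z|lborel. 1 / ?N * \<bar>F z\<bar>)"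
  proof (rule order_trans[OF integral_norm_bound], rule integral_mono_AE')
    show "AE z in lborel. norm (gauss (c *\<^sub>R z) * (F z * cos (z \<bullet> x))) \<le> 1 / ?N * \<bar>F z\<bar>"
      by (intro AE_I2 integrand_bound)
  qed (use F gauss_norm_pos[of "TYPE('a)"] in \<open>auto intro: less_imp_le\<close>)
  then have "(1 / ?N) * \<bar>LINT z|lborel. gauss (c *\<^sub>R z) * (F z * cos (z \<bullet> x))\<bar> \<le> (1 / ?N) * (LINT z|lborel. 1 / ?N * \<bar>F z\<bar>)"
    using gauss_norm_pos[of "TYPE('a)"] by (intro mult_left_mono) auto
  then show ?thesis
    using gauss_norm_pos[of "TYPE('a)"] by (simp add: mollified_eq[OF c] abs_mult power2_eq_square)
qed

lemma mollified_tendsto: "(\<lambda>n. mollified (1 / real (Suc n)) x) \<longlonglongrightarrow> inv_F x"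
proof -
  let ?N = "gauss_norm TYPE('a)"
  let ?c = "\<lambda>n. 1 / real (Suc n)"
  have c: "?c \<longlonglongrightarrow> 0" by (rule LIMSEQ_Suc[OF lim_1_over_n])
  have "(\<lambda>n. LINT z|lborel. gauss (?c n *\<^sub>R z) * (F z * cos (z \<bullet> x))) \<longlonglongrightarrow> (LINT z|lborel. gauss (0::'a) * (F z * cos (z \<bullet> x)))"
  proof (rule integral_dominated_convergence[where w="\<lambda>z. 1 / ?N * \<bar>F z\<bar>"])
    show "AE z in lborel. (\<lambda>n. gauss (?c n *\<^sub>R z) * (F z * cos (z \<bullet> x))) \<longlonglongrightarrow> gauss (0::'a) * (F z * cos (z \<bullet> x))"
    proof (rule AE_I2)
      fix z :: 'a
      have "isCont (\<lambda>r. gauss (r *\<^sub>R z)) 0"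
        using continuous_on_gauss[of UNIV "\<lambda>r. r *\<^sub>R z"]
        by (auto simp: continuous_on_eq_continuous_at intro!: continuous_intros)
      then have "(\<lambda>n. gauss (?c n *\<^sub>R z)) \<longlonglongrightarrow> gauss (0 *\<^sub>R z)"
        using c by (rule isCont_tendsto_compose)
      then show "(\<lambda>n. gauss (?c n *\<^sub>R z) * (F z * cos (z \<bullet> x))) \<longlonglongrightarrow> gauss (0::'a) * (F z * cos (z \<bullet> x))"
        by (intro tendsto_mult_right) simp
    qed
    show "AE z in lborel. norm (gauss (?c n *\<^sub>R z) * (F z * cos (z \<bullet> x))) \<le> 1 / ?N * \<bar>F z\<bar>" for n
      by (intro AE_I2 integrand_bound)
  qed (use F in auto)
  from tendsto_mult_left[OF this, of "1 / ?N"]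
  show ?thesis by (simp add: mollified_eq inv_F_def gauss_0 power2_eq_square)
qed

lemma inv_F_bound: "\<bar>inv_F x\<bar> \<le> (1 / gauss_norm TYPE('a))\<^sup>2 * (LINT z|lborel. \<bar>F z\<bar>)"
  by (rule LIMSEQ_le_const2[OF tendsto_rabs[OF mollified_tendsto]])
     (intro exI allI impI mollified_bound, simp)

lemma inv_F_measurable [measurable]: "inv_F \<in> borel_measurable borel"
  unfolding inv_F_def by measurable

text \<open>The mollified functions converge to \<open>inv_F\<close> pointwise and boundedly. For
  the other limit Fubini moves the mollifier from \<open>f\<close>, about which only integrability
  is known, onto the indicator, which is then approximated off the frontier of the box, a null
  set.\<close>

lemma integral_box_eq:
  fixes l u :: 'a
  shows "(LINT x|lborel. indicator (box l u) x * f x) = (LINT x|lborel. indicator (box l u) x * inv_F x)"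
proof -
  let ?B = "box l u" and ?c = "\<lambda>n. 1 / real (Suc n)"
  let ?C = "(1 / gauss_norm TYPE('a))\<^sup>2 * (LINT z|lborel. \<bar>F z\<bar>)"
  have C: "0 \<le> ?C" by simp
  have c: "?c \<longlonglongrightarrow> 0" by (rule LIMSEQ_Suc[OF lim_1_over_n])
  have B: "integrable lborel (\<lambda>x. indicat_real ?B x)"
    by (rule integrable_real_indicator) (auto simp: emeasure_lborel_box_eq)
  have "(\<lambda>n. LINT x|lborel. indicator ?B x * mollified (?c n) x) \<longlonglongrightarrow> (LINT x|lborel. indicator ?B x * inv_F x)"
  proof (rule integral_dominated_convergence[where w="\<lambda>x. ?C * indicator ?B x"])
    show "integrable lborel (\<lambda>x. ?C * indicat_real ?B x)" by (rule integrable_mult_right[OF B])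
    show "AE x in lborel. (\<lambda>n. indicator ?B x * mollified (?c n) x) \<longlonglongrightarrow> indicator ?B x * inv_F x"
      by (intro AE_I2 tendsto_mult_left mollified_tendsto)
    show "AE x in lborel. norm (indicator ?B x * mollified (?c n) x) \<le> ?C * indicator ?B x" for n
      using mollified_bound[of "?c n"] by (intro AE_I2) (auto simp: indicator_def)
    show "(\<lambda>x. indicator ?B x * mollified (?c n) x) \<in> borel_measurable lborel" for n
      unfolding mollified_def by measurable
  qed measurable
  moreover have "(\<lambda>n. LINT x|lborel. indicator ?B x * mollified (?c n) x) \<longlonglongrightarrow> (LINT x|lborel. indicator ?B x * f x)"
  proof -
    let ?G = "\<lambda>n y. LINT w|lborel. indicat_real ?B (y - ?c n *\<^sub>R w) * gauss w"
    have eq: "(LINT x|lborel. indicator ?B x * mollified (?c n) x) = (LINT y|lborel. ?G n y * f y)" for n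
    proof -
      define r where "r = real (Suc n)"
      have r: "0 < r" "?c n = 1 / r" by (simp_all add: r_def)
      let ?H = "\<lambda>x y. indicat_real ?B x * (f y * (r ^ DIM('a) * gauss (r *\<^sub>R (y - x))))"
      have int: "integrable (lborel \<Otimes>\<^sub>M lborel) (\<lambda>(x, y). ?H x y)"
      proof (rule Bochner_Integration.integrable_bound)
        show "integrable (lborel \<Otimes>\<^sub>M lborel) (\<lambda>(x, y). indicat_real ?B x * (f y * (r ^ DIM('a) * gauss (0::'a))))"
          by (rule integrable_lborel_pair_mult[OF B integrable_mult_left[OF f]])
        show "AE m in lborel \<Otimes>\<^sub>M lborel. norm (case m of (x, y) \<Rightarrow> ?H x y)
            \<le> norm (case m of (x, y) \<Rightarrow> indicat_real ?B x * (f y * (r ^ DIM('a) * gauss (0::'a))))"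
          using r gauss_le by (intro AE_I2) (auto simp: abs_mult intro!: mult_left_mono)
      qed measurable
      have "(LINT y|lborel. f y * (r ^ DIM('a) * gauss (r *\<^sub>R (y - x))))
          = (1 / r) ^ DIM('a) * (LINT w|lborel. r ^ DIM('a) * (f (x + (1 / r) *\<^sub>R w) * gauss w))" for x
        by (subst integral_lborel_affine[where c="1 / r" and t=x]) (use r(1) in \<open>auto simp: mult_ac\<close>)
      then have "mollified (?c n) x = (LINT y|lborel. f y * (r ^ DIM('a) * gauss (r *\<^sub>R (y - x))))" for x
        using r(1) unfolding mollified_def r(2) by (simp add: power_divide)
      then have "(LINT x|lborel. indicator ?B x * mollified (?c n) x) = (LINT x|lborel. (LINT y|lborel. ?H x y))"
        by simp
      also have "\<dots> = (LINT y|lborel. (LINT x|lborel. ?H x y))"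
        by (rule lborel_pair.Fubini_integral[OF int, symmetric])
      also have "\<dots> = (LINT y|lborel. ?G n y * f y)"
      proof (rule Bochner_Integration.integral_cong[OF refl])
        fix y
        have "(LINT x|lborel. ?H x y)
            = (1 / r) ^ DIM('a) * (LINT w|lborel. (f y * r ^ DIM('a)) * (indicat_real ?B (y - ?c n *\<^sub>R w) * gauss w))"
          unfolding r(2) by (subst integral_lborel_affine[where c="- (1 / r)" and t=y]) (use r(1) in \<open>auto simp: mult_ac\<close>)
        also have "\<dots> = ((1 / r) ^ DIM('a) * r ^ DIM('a)) * (?G n y * f y)"
          by (subst integral_mult_right_zero) (simp only: mult_ac)
        finally show "(LINT x|lborel. ?H x y) = ?G n y * f y" using r(1) by (simp add: power_divide)
      qed
      finally show ?thesis .
    qed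
    have G: "\<bar>?G n y\<bar> \<le> 1" for n y
    proof -
      have "norm (?G n y) \<le> (LINT w|lborel. gauss (w::'a))"
        by (rule order_trans[OF integral_norm_bound], rule integral_mono_AE'[OF integrable_gauss]) (auto simp: indicator_def)
      then show ?thesis by (simp add: integral_gauss)
    qed
    have lim: "(\<lambda>n. ?G n y) \<longlonglongrightarrow> indicat_real ?B y" if y: "y \<notin> frontier ?B" for y
    proof -
      have "(\<lambda>n. ?G n y) \<longlonglongrightarrow> (LINT w|lborel. indicat_real ?B y * gauss (w::'a))"
      proof (rule integral_dominated_convergence[OF _ _ integrable_gauss])
        show "AE w in lborel. (\<lambda>n. indicat_real ?B (y - ?c n *\<^sub>R w) * gauss w) \<longlonglongrightarrow> indicat_real ?B y * gauss w"
        proof (rule AE_I2)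
          fix w :: 'a
          have "isCont (indicat_real ?B) y" using y by (simp add: isCont_indicator)
          moreover have "(\<lambda>n. y - ?c n *\<^sub>R w) \<longlonglongrightarrow> y"
            using tendsto_diff[OF tendsto_const tendsto_scaleR[OF c tendsto_const], of y w] by simp
          ultimately have "(\<lambda>n. indicat_real ?B (y - ?c n *\<^sub>R w)) \<longlonglongrightarrow> indicat_real ?B y"
            by (rule isCont_tendsto_compose)
          then show "(\<lambda>n. indicat_real ?B (y - ?c n *\<^sub>R w) * gauss w) \<longlonglongrightarrow> indicat_real ?B y * gauss w"
            by (rule tendsto_mult_right)
        qed
      qed (auto simp: indicator_def intro!: AE_I2)
      then show ?thesis by (simp only: integral_mult_right_zero integral_gauss mult_1_right)
    qed
    have "(\<lambda>n. LINT y|lborel. ?G n y * f y) \<longlonglongrightarrow> (LINT y|lborel. indicator ?B y * f y)"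
    proof (rule integral_dominated_convergence[where w="\<lambda>y. \<bar>f y\<bar>"])
      have "frontier ?B \<in> null_sets lborel"
        using negligible_convex_frontier[OF convex_box(2), of l u]
        by (simp add: negligible_iff_null_sets null_sets_completion_iff)
      from AE_not_in[OF this]
      show "AE y in lborel. (\<lambda>n. ?G n y * f y) \<longlonglongrightarrow> indicator ?B y * f y"
        by eventually_elim (intro tendsto_mult_right lim)
      show "AE y in lborel. norm (?G n y * f y) \<le> \<bar>f y\<bar>" for n
        using mult_right_mono[OF G abs_ge_zero] by (intro AE_I2) (simp add: abs_mult)
      show "(\<lambda>y. ?G n y * f y) \<in> borel_measurable lborel" for n by measurable
    qed (use f in auto)
    then show ?thesis by (simp only: eq)
  qed
  ultimately show ?thesis by (rule LIMSEQ_unique[symmetric])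
qed

text \<open>Nonnegativity turns \<open>f\<close> and \<open>inv_F\<close> into densities of
  measures. These agree on boxes, which are stable under intersection and generate the Borel sets,
  and densities are unique almost everywhere. \<open>inv_F\<close> inherits its sign from the
  mollifications.\<close>

lemma AE_eq_inv_F:
  assumes nn: "\<And>x. 0 \<le> f x"
  shows "AE x in lborel. f x = inv_F x" and "\<And>x. 0 \<le> inv_F x"
proof -
  show inv_nn: "0 \<le> inv_F x" for x
    by (rule LIMSEQ_le_const[OF mollified_tendsto])
       (auto simp: mollified_def nn intro!: Bochner_Integration.integral_nonneg)
  let ?C = "(1 / gauss_norm TYPE('a))\<^sup>2 * (LINT z|lborel. \<bar>F z\<bar>)"
  have em: "emeasure (density lborel (\<lambda>x. ennreal (g x))) (box l u) = ennreal (LINT x|lborel. indicator (box l u) x * g x)"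
    if [measurable]: "g \<in> borel_measurable borel" and "\<And>x. 0 \<le> g x" "integrable lborel (\<lambda>x. indicator (box l u) x * g x)"
    for g and l u :: 'a
  proof -
    have "emeasure (density lborel (\<lambda>x. ennreal (g x))) (box l u) = (\<integral>\<^sup>+x. ennreal (indicator (box l u) x * g x) \<partial>lborel)"
      by (subst emeasure_density) (auto intro!: nn_integral_cong simp: indicator_def)
    also have "\<dots> = ennreal (LINT x|lborel. indicator (box l u) x * g x)"
      by (rule nn_integral_eq_integral[OF that(3)]) (use that in auto)
    finally show ?thesis .
  qed
  have fi: "integrable lborel (\<lambda>x. indicator (box l u) x * f x)" for l u
    by (rule Bochner_Integration.integrable_bound[OF f]) (auto simp: indicator_def)
  have ii: "integrable lborel (\<lambda>x. indicator (box l u) x * inv_F x)" for l u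
  proof (rule Bochner_Integration.integrable_bound)
    show "integrable lborel (\<lambda>x. ?C * indicat_real (box l u) x)"
      by (intro integrable_mult_right integrable_real_indicator) (auto simp: emeasure_lborel_box_eq)
    show "AE x in lborel. norm (indicator (box l u) x * inv_F x) \<le> norm (?C * indicat_real (box l u) x)"
      using inv_F_bound by (intro AE_I2) (auto simp: indicator_def intro: order_trans[OF _ abs_ge_self])
  qed measurable
  have "density lborel (\<lambda>x. ennreal (f x)) = density lborel (\<lambda>x. ennreal (inv_F x))"
  proof (rule measure_eqI_generator_eq)
    let ?E = "range (\<lambda>(a, b). box a b::'a set)"
    show "Int_stable ?E" by (auto simp: Int_stable_def box_Int_box)
    show "?E \<subseteq> Pow UNIV" "sets (density lborel (\<lambda>x. ennreal (f x))) = sigma_sets UNIV ?E"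
      "sets (density lborel (\<lambda>x. ennreal (inv_F x))) = sigma_sets UNIV ?E"
      by (simp_all add: borel_eq_box)
    let ?A = "\<lambda>n::nat. box (- (real n *\<^sub>R One)) (real n *\<^sub>R One) :: 'a set"
    show "range ?A \<subseteq> ?E" "(\<Union>i. ?A i) = UNIV" unfolding UN_box_eq_UNIV by auto
    show "emeasure (density lborel (\<lambda>x. ennreal (f x))) (?A i) \<noteq> \<infinity>" for i
      by (subst em) (auto simp: nn fi)
    show "emeasure (density lborel (\<lambda>x. ennreal (f x))) X = emeasure (density lborel (\<lambda>x. ennreal (inv_F x))) X"
      if "X \<in> ?E" for X
      using that by (auto simp: em nn inv_nn fi ii integral_box_eq)
  qed
  then have "AE x in lborel. ennreal (f x) = ennreal (inv_F x)"
    by (subst (asm) sigma_finite_measure.density_unique_iff[OF lborel.sigma_finite_measure_axioms]) auto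
  then show "AE x in lborel. f x = inv_F x"
    by eventually_elim (simp add: nn inv_nn)
qed

end

section \<open>The stable semigroup\<close>

text \<open>With \<open>s = r powr a\<close>, the exponential of \<open>p * s\<close> dominates
  \<open>(1 + p * s / k) ^ k\<close>, and a choice of \<open>k\<close> above \<open>m / a\<close>
  makes \<open>s ^ k\<close> dominate \<open>r ^ m\<close>.\<close>

lemma power_mult_exp_powr_le:
  fixes a p r :: real
  assumes a: "0 < a" and p: "0 < p"
  shows "\<exists>C\<ge>0. \<forall>r\<ge>1. r ^ m * exp (- p * r powr a) \<le> C"
proof -
  obtain k :: nat where k: "real m / a < real k" using reals_Archimedean2 by blast
  then have k0: "0 < k" using a by (cases k) (auto simp: divide_less_0_iff)
  have bound: "r ^ m * exp (- p * r powr a) \<le> (real k / p) ^ k" if r: "1 \<le> r" for r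
  proof -
    define s where "s = r powr a"
    have s: "0 < s" using r by (simp add: s_def)
    have "r ^ m = r powr real m" using r by (simp add: powr_realpow)
    also have "\<dots> \<le> r powr (a * real k)" using r k a by (intro powr_mono) (auto simp: field_simps)
    also have "\<dots> = s ^ k" using r by (simp add: s_def powr_powr[symmetric] powr_realpow)
    finally have 1: "r ^ m \<le> s ^ k" .
    have "(p * s / real k) ^ k \<le> (1 + p * s / real k) ^ k" using p s by (intro power_mono) auto
    also have "\<dots> \<le> exp (p * s)" using p s k0 by (intro exp_ge_one_plus_x_over_n_power_n) (auto intro: order_trans[of _ 0])
    finally have "(real k / p) ^ k * (p * s / real k) ^ k \<le> (real k / p) ^ k * exp (p * s)"
      using p by (intro mult_left_mono) auto
    moreover have "(real k / p) ^ k * (p * s / real k) ^ k = s ^ k"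
      using p k0 by (simp add: power_mult_distrib[symmetric])
    ultimately have "r ^ m \<le> (real k / p) ^ k * exp (p * s)" using 1 by linarith
    then have "r ^ m * exp (- (p * s)) \<le> (real k / p) ^ k * exp (p * s) * exp (- (p * s))"
      by (rule mult_right_mono) simp
    then show ?thesis by (simp add: s_def mult.assoc exp_add[symmetric])
  qed
  show ?thesis
    using bound p by (intro exI[of _ "(real k / p) ^ k"]) auto
qed

lemma integrable_power_exp_powr:
  fixes a p :: real
  assumes a: "0 < a" and p: "0 < p"
  shows "integrable lborel (\<lambda>z::real^'n. norm z ^ N * exp (- p * norm z powr a))"
proof -
  obtain C where C: "0 \<le> C" "\<And>r. 1 \<le> r \<Longrightarrow> r ^ (N + (CARD('n) + 1)) * exp (- p * r powr a) \<le> C"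
    using power_mult_exp_powr_le[OF a p] by blast
  \<comment> \<open>Away from the unit ball the kernel of order 1 is the inverse of
    \<open>norm z ^ (CARD('n) + 1)\<close>, an integrable tail; the exponent in the choice of
    \<open>C\<close> is raised by the same amount.\<close>
  let ?g = "\<lambda>z::real^'n. indicat_real (ball 0 1) z + C * (min ((norm z)\<^sup>2) 1 * levy_kernel 1 z)"
  show ?thesis
  proof (rule Bochner_Integration.integrable_bound)
    show "integrable lborel ?g"
      by (intro Bochner_Integration.integrable_add integrable_mult_right integrable_min_levy_kernel integrable_real_indicator)
         (auto simp: emeasure_ball)
    show "AE z in lborel. norm (norm z ^ N * exp (- p * norm z powr a)) \<le> norm (?g z)"
    proof (rule AE_I2)
      fix z :: "real^'n"
      have "norm z ^ N * exp (- p * norm z powr a) \<le> ?g z"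
      proof (cases "norm z < 1")
        case True
        have "norm z ^ N * exp (- p * norm z powr a) \<le> 1 * 1"
          using True p by (intro mult_mono) (auto simp: power_le_one)
        moreover have "0 \<le> C * (min ((norm z)\<^sup>2) 1 * levy_kernel 1 z)" using C(1) by simp
        ultimately show ?thesis using True by simp
      next
        case False
        then have z: "1 \<le> norm z" by simp
        then have "z \<noteq> 0" by auto
        have k: "levy_kernel 1 z = 1 / norm z ^ (CARD('n) + 1)"
          using \<open>z \<noteq> 0\<close> powr_realpow[of "norm z" "CARD('n) + 1"] by (simp add: levy_kernel_def add.commute)
        have m: "min ((norm z)\<^sup>2) 1 = 1" using one_le_power[OF z, of 2] by simp
        have "norm z ^ N * exp (- p * norm z powr a) * norm z ^ (CARD('n) + 1) \<le> C"
          using C(2)[OF z] by (simp only: power_add mult_ac)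
        then have "norm z ^ N * exp (- p * norm z powr a) \<le> C / norm z ^ (CARD('n) + 1)"
          using \<open>z \<noteq> 0\<close> by (subst pos_le_divide_eq) auto
        also have "\<dots> = C * (min ((norm z)\<^sup>2) 1 * levy_kernel 1 z)"
          by (simp only: m k mult_1_left times_divide_eq_right mult_1_right)
        also have "\<dots> \<le> ?g z" by simp
        finally show ?thesis .
      qed
      moreover have "0 \<le> norm z ^ N * exp (- p * norm z powr a)" by simp
      ultimately show "norm (norm z ^ N * exp (- p * norm z powr a)) \<le> norm (?g z)" by simp
    qed
  qed measurable
qed

text \<open>The continuous version of the density, written by Fourier inversion. The formula yields
  bounds, continuity and scaling; its sign and its mass are carried over from a given
  \<open>symmetric_stable_density\<close>.\<close>

definition stable_density :: "real \<Rightarrow> real \<Rightarrow> real^'n \<Rightarrow> real" where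
  "stable_density a t x =
     (1 / gauss_norm TYPE(real^'n))\<^sup>2 * (LINT z|lborel. exp (- t * norm z powr a) * cos (z \<bullet> x))"

lemma integrable_stable_symbol:
  assumes "0 < a" "0 < t"
  shows "integrable lborel (\<lambda>z::real^'n. exp (- t * norm z powr a))"
  using integrable_power_exp_powr[OF assms, of 0] by simp

lemma stable_density_bound:
  assumes a: "0 < a" and t: "0 < t"
  shows "\<exists>C\<ge>0. \<forall>x::real^'n. \<bar>stable_density a t x\<bar> \<le> C"
proof (intro exI conjI allI)
  let ?I = "LINT z|lborel. exp (- t * norm (z::real^'n) powr a)"
  show "0 \<le> (1 / gauss_norm TYPE(real^'n))\<^sup>2 * ?I" by simp
  fix x :: "real^'n"
  have "norm (LINT z|lborel. exp (- t * norm z powr a) * cos (z \<bullet> x)) \<le> ?I"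
    by (rule order_trans[OF integral_norm_bound], rule integral_mono_AE'[OF integrable_stable_symbol[OF a t]])
       (auto simp: abs_mult intro!: mult_left_le)
  then show "\<bar>stable_density a t x\<bar> \<le> (1 / gauss_norm TYPE(real^'n))\<^sup>2 * ?I"
    by (simp add: stable_density_def abs_mult mult_left_mono)
qed

lemma continuous_on_stable_density:
  assumes a: "0 < a" and t: "0 < t"
  shows "continuous_on UNIV (stable_density a t :: real^'n \<Rightarrow> real)"
proof -
  have "continuous_on UNIV (\<lambda>x::real^'n. LINT z|lborel. exp (- t * norm z powr a) * cos (z \<bullet> x))"
    by (rule continuous_on_LINT[OF _ _ _ integrable_stable_symbol[OF a t]])
       (auto simp: abs_mult intro!: mult_left_le continuous_intros)
  then show ?thesis unfolding stable_density_def by (intro continuous_intros)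
qed

lemma stable_density_scaling:
  fixes x :: "real^'n"
  assumes a: "0 < a" and e: "0 < e"
  shows "stable_density a (e powr a) x = (1 / e) ^ CARD('n) * stable_density a 1 ((1 / e) *\<^sub>R x)"
proof -
  have "(LINT z|lborel. exp (- (e powr a) * norm z powr a) * cos (z \<bullet> x))
     = (1 / e) ^ CARD('n) * (LINT z|lborel. exp (- 1 * norm z powr a) * cos (z \<bullet> ((1 / e) *\<^sub>R x)))"
    by (subst integral_lborel_affine[where c="1 / e" and t=0]) (use a e in \<open>auto simp: powr_divide\<close>)
  then show ?thesis by (simp add: stable_density_def mult_ac)
qed

lemma symmetric_stable_density_real_fourier_pair:
  fixes f :: "real^'n \<Rightarrow> real"
  assumes a: "0 < a" and t: "0 < t" and f: "symmetric_stable_density a t f"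
  shows "real_fourier_pair f (\<lambda>z. exp (- t * norm z powr a))"
proof
  show fi: "integrable lborel f" using f by (simp add: symmetric_stable_density_def)
  show "integrable lborel (\<lambda>z::real^'n. exp (- t * norm z powr a))" by (rule integrable_stable_symbol[OF a t])
  fix z :: "real^'n"
  have [measurable]: "f \<in> borel_measurable borel" using fi by (simp add: borel_measurable_integrable)
  have i: "integrable lborel (\<lambda>x. cis (z \<bullet> x) * complex_of_real (f x))"
    by (rule Bochner_Integration.integrable_bound[OF fi]) (auto simp: norm_mult cis_conv_exp)
  have eq: "(LINT x|lborel. cis (z \<bullet> x) * complex_of_real (f x)) = complex_of_real (exp (- t * norm z powr a))"
    using f by (simp add: symmetric_stable_density_def)
  have "(LINT x|lborel. Re (cis (z \<bullet> x) * complex_of_real (f x))) = exp (- t * norm z powr a)"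
    by (simp only: integral_Re[OF i] eq Re_complex_of_real)
  then show "(LINT y|lborel. f y * cos (z \<bullet> y)) = exp (- t * norm z powr a)" by (simp add: mult.commute)
  have "(LINT x|lborel. Im (cis (z \<bullet> x) * complex_of_real (f x))) = 0"
    by (simp only: integral_Im[OF i] eq Im_complex_of_real)
  then show "(LINT y|lborel. f y * sin (z \<bullet> y)) = 0" by (simp add: mult.commute)
qed

lemma
  fixes f :: "real^'n \<Rightarrow> real"
  assumes a: "0 < a" and t: "0 < t" and f: "symmetric_stable_density a t f"
  shows symmetric_stable_density_AE_eq: "AE x in lborel. f x = stable_density a t x"
    and stable_density_nonneg: "0 \<le> stable_density a t (x::real^'n)"
    and has_bochner_integral_stable_density: "has_bochner_integral lborel (stable_density a t :: real^'n \<Rightarrow> real) 1"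
proof -
  interpret real_fourier_pair f "\<lambda>z. exp (- t * norm z powr a)"
    by (rule symmetric_stable_density_real_fourier_pair[OF assms])
  have eq: "inv_F = stable_density a t"
    by (rule ext) (simp only: inv_F_def stable_density_def)
  have nn: "0 \<le> f x" for x using assms(3) by (simp add: symmetric_stable_density_def)
  show ae: "AE x in lborel. f x = stable_density a t x"
    using AE_eq_inv_F(1)[OF nn] by (simp only: eq)
  show "0 \<le> stable_density a t x" using AE_eq_inv_F(2)[OF nn, of x] by (simp only: eq)
  have [measurable]: "(stable_density a t :: real^'n \<Rightarrow> real) \<in> borel_measurable borel"
    using inv_F_measurable by (simp only: eq)
  have "has_bochner_integral lborel f 1"
    using real_fourier_pair.f[OF real_fourier_pair_axioms] cos_transform[of 0] by (simp add: has_bochner_integral_iff)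
  then show "has_bochner_integral lborel (stable_density a t :: real^'n \<Rightarrow> real) 1"
    using ae by (subst (asm) has_bochner_integral_cong_AE) auto
qed

text \<open>The density at time 1 supplies positivity and unit mass of \<open>q\<close>;
  \<open>stable_density_scaling\<close> expresses every other time by dilation.\<close>

locale stable_semigroup =
  fixes a :: real and p1 :: "real^'n \<Rightarrow> real"
  assumes a: "0 < a" "a < 2" and p1: "symmetric_stable_density a 1 p1"
begin

abbreviation q :: "real^'n \<Rightarrow> real" where "q \<equiv> stable_density a 1"

lemma q_nonneg [simp]: "0 \<le> q x"
  by (rule stable_density_nonneg[OF a(1) zero_less_one p1])

lemma integrable_q: "integrable lborel q" and integral_q: "(LINT x|lborel. q x) = 1"
  using has_bochner_integral_stable_density[OF a(1) zero_less_one p1] by (auto simp: has_bochner_integral_iff)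

lemma continuous_on_q: "continuous_on UNIV q"
  by (rule continuous_on_stable_density[OF a(1) zero_less_one])

lemma q_measurable [measurable]: "q \<in> borel_measurable borel"
  by (rule borel_measurable_continuous_onI[OF continuous_on_q])

lemma nn_integral_q: "(\<integral>\<^sup>+x. ennreal (q x) \<partial>lborel) = 1"
  by (subst nn_integral_eq_integral[OF integrable_q]) (auto simp: integral_q)

text \<open>\<open>Q f e\<close> is the action on \<open>f\<close> of the stable semigroup at time \<open>e powr a\<close>;
  the parametrization by \<open>e\<close> includes time \<open>0\<close>, where the density degenerates.\<close>

definition Q :: "(real^'n \<Rightarrow> real) \<Rightarrow> real \<Rightarrow> real^'n \<Rightarrow> real" where
  "Q f e x = (LINT w|lborel. f (x - e *\<^sub>R w) * q w)"

lemma Q_0: "Q f 0 x = f x"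
  by (simp add: Q_def integral_q)

lemma Q_eq_convolution:
  fixes f :: "real^'n \<Rightarrow> real"
  assumes [measurable]: "f \<in> borel_measurable borel" and e: "0 < e"
  shows "Q f e x = (LINT y|lborel. f y * ((1 / e) ^ CARD('n) * q ((1 / e) *\<^sub>R (x - y))))"
proof -
  have "(LINT y|lborel. f y * ((1 / e) ^ CARD('n) * q ((1 / e) *\<^sub>R (x - y))))
     = e ^ CARD('n) * (LINT w|lborel. (1 / e) ^ CARD('n) * (f (x - e *\<^sub>R w) * q w))"
    by (subst integral_lborel_affine[where c="- e" and t=x]) (use e in \<open>auto simp: mult_ac\<close>)
  also have "\<dots> = Q f e x"
    using e by (simp add: Q_def power_divide)
  finally show ?thesis by simp
qed

text \<open>The integration variable is scaled so that \<open>e\<close> enters only through the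
  argument of the bounded \<open>f\<close>: \<open>B * q w\<close> dominates for all
  \<open>e\<close> at once, and continuity reaches the degenerate value
  \<open>e = 0\<close>.\<close>

lemma continuous_on_Q:
  assumes f: "continuous_on UNIV f" and B: "\<And>x. \<bar>f x\<bar> \<le> B"
  shows "continuous_on UNIV (\<lambda>(e, x). Q f e x)"
  unfolding Q_def case_prod_unfold
proof (rule continuous_on_LINT[where g="\<lambda>w. B * q w"])
  have [measurable]: "f \<in> borel_measurable borel" by (rule borel_measurable_continuous_onI[OF f])
  fix s :: "real \<times> (real^'n)"
  show "(\<lambda>w. f (snd s - fst s *\<^sub>R w) * q w) \<in> borel_measurable lborel" by measurable
  fix w
  show "norm (f (snd s - fst s *\<^sub>R w) * q w) \<le> B * q w"
    using B by (simp add: abs_mult mult_right_mono)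
next
  fix w
  show "continuous_on UNIV (\<lambda>s. f (snd s - fst s *\<^sub>R w) * q w)"
    by (intro continuous_intros continuous_on_compose2[OF f]) auto
qed (rule integrable_mult_right[OF integrable_q])

lemma nn_integral_Q:
  assumes f: "continuous_on UNIV f" and B: "\<And>x. \<bar>f x\<bar> \<le> B" and nn: "\<And>x. 0 \<le> f x"
  shows "(\<integral>\<^sup>+x. ennreal (Q f e x) \<partial>lborel) = (\<integral>\<^sup>+x. ennreal (f x) \<partial>lborel)"
proof -
  have [measurable]: "f \<in> borel_measurable borel" by (rule borel_measurable_continuous_onI[OF f])
  have "ennreal (Q f e x) = (\<integral>\<^sup>+w. ennreal (f (x - e *\<^sub>R w) * q w) \<partial>lborel)" for x
    unfolding Q_def
  proof (rule nn_integral_eq_integral[symmetric])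
    show "integrable lborel (\<lambda>w. f (x - e *\<^sub>R w) * q w)"
      by (rule Bochner_Integration.integrable_bound[OF integrable_mult_right[OF integrable_q, of B]])
         (use B nn in \<open>auto simp: abs_mult intro!: AE_I2 mult_right_mono order_trans[OF _ abs_ge_self]\<close>)
  qed (simp add: nn)
  then have "(\<integral>\<^sup>+x. ennreal (Q f e x) \<partial>lborel) = (\<integral>\<^sup>+x. (\<integral>\<^sup>+w. ennreal (f (x - e *\<^sub>R w) * q w) \<partial>lborel) \<partial>lborel)"
    by simp
  also have "\<dots> = (\<integral>\<^sup>+w. (\<integral>\<^sup>+x. ennreal (f (x - e *\<^sub>R w) * q w) \<partial>lborel) \<partial>lborel)"
    by (rule lborel_pair.Fubini') measurable
  also have "\<dots> = (\<integral>\<^sup>+w. (\<integral>\<^sup>+x. ennreal (f x) \<partial>lborel) * ennreal (q w) \<partial>lborel)"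
  proof (rule nn_integral_cong)
    fix w
    have "(\<integral>\<^sup>+x. ennreal (f (x - e *\<^sub>R w) * q w) \<partial>lborel) = (\<integral>\<^sup>+x. ennreal (f (- (e *\<^sub>R w) + 1 *\<^sub>R x)) * ennreal (q w) \<partial>lborel)"
      by (simp add: ennreal_mult nn)
    also have "\<dots> = (\<integral>\<^sup>+x. ennreal (f (- (e *\<^sub>R w) + 1 *\<^sub>R x)) \<partial>lborel) * ennreal (q w)"
      by (rule nn_integral_multc) measurable
    also have "(\<integral>\<^sup>+x. ennreal (f (- (e *\<^sub>R w) + 1 *\<^sub>R x)) \<partial>lborel) = (\<integral>\<^sup>+x. ennreal (f x) \<partial>lborel)"
      by (subst (2) nn_integral_lborel_affine[where c=1 and t="- (e *\<^sub>R w)"]) simp_all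
    finally show "(\<integral>\<^sup>+x. ennreal (f (x - e *\<^sub>R w) * q w) \<partial>lborel) = (\<integral>\<^sup>+x. ennreal (f x) \<partial>lborel) * ennreal (q w)" .
  qed
  also have "\<dots> = (\<integral>\<^sup>+x. ennreal (f x) \<partial>lborel)"
    by (simp add: nn_integral_cmult nn_integral_q)
  finally show ?thesis .
qed

lemma Q_nonneg: "(\<And>x. 0 \<le> f x) \<Longrightarrow> 0 \<le> Q f e x"
  unfolding Q_def by (intro Bochner_Integration.integral_nonneg) simp

text \<open>The waves are indexed by pairs \<open>(y, z)\<close> with weight proportional to
  \<open>f y\<close> and phase \<open>z \<bullet> y\<close>. This produces
  \<open>cos (z \<bullet> (x - y))\<close>, and integrating out \<open>z\<close> leaves the
  convolution of \<open>f\<close> with the stable density.\<close>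

lemma
  assumes f: "integrable lborel f"
  defines "W \<equiv> \<lambda>m::(real^'n) \<times> (real^'n). (1 / gauss_norm TYPE(real^'n))\<^sup>2 * f (fst m)"
  shows wave_superposition_Q: "wave_superposition lborel a W snd (\<lambda>m. snd m \<bullet> fst m)"
    and V_eq_Q: "\<And>p x. 0 < p \<Longrightarrow>
      wave_superposition.V lborel a W snd (\<lambda>m. snd m \<bullet> fst m) p x = Q f (p powr (1 / a)) x"
proof -
  let ?\<kappa> = "(1 / gauss_norm TYPE(real^'n))\<^sup>2"
  have [measurable]: "f \<in> borel_measurable borel" using f by (simp add: borel_measurable_integrable)
  show ws: "wave_superposition lborel a W snd (\<lambda>m. snd m \<bullet> fst m)"
  proof
    show "0 < a" "a < 2" by (fact a)+
    show "W \<in> borel_measurable lborel" "snd \<in> borel_measurable lborel"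
      "(\<lambda>m::(real^'n) \<times> (real^'n). snd m \<bullet> fst m) \<in> borel_measurable lborel"
      unfolding W_def lborel_prod[symmetric] by measurable
    fix p :: real and N assume p: "0 < p"
    show "integrable lborel (\<lambda>m. W m * (norm (snd m) ^ N * exp (- p * norm (snd m) powr a)))"
      using integrable_lborel_pair_mult[OF integrable_mult_right[OF f, of ?\<kappa>] integrable_power_exp_powr[OF a(1) p, of N]]
      by (simp add: W_def case_prod_unfold lborel_prod)
  qed
  interpret wave_superposition lborel a W snd "\<lambda>m. snd m \<bullet> fst m" by (rule ws)
  fix p :: real and x :: "real^'n" assume p: "0 < p"
  define e where "e = p powr (1 / a)"
  have e: "0 < e" "p = e powr a" using p a by (auto simp: e_def powr_powr)
  let ?G = "\<lambda>y z. (?\<kappa> * f y) * exp (- p * norm z powr a) * cos (z \<bullet> x - z \<bullet> y)"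
  have int: "integrable (lborel \<Otimes>\<^sub>M lborel) (\<lambda>(y, z). ?G y z)"
    using integrable_V[OF p, of x] by (simp add: W_def case_prod_unfold lborel_prod)
  have "V p x = (LINT m|(lborel \<Otimes>\<^sub>M lborel). (case m of (y, z) \<Rightarrow> ?G y z))"
    unfolding V_def by (simp only: W_def case_prod_unfold lborel_prod)
  also have "\<dots> = (LINT y|lborel. (LINT z|lborel. ?G y z))"
    using lborel_pair.integral_fst'[OF int] by simp
  also have "\<dots> = (LINT y|lborel. f y * stable_density a p (x - y))"
  proof (rule Bochner_Integration.integral_cong[OF refl])
    fix y
    have "(LINT z|lborel. ?G y z) = (LINT z|lborel. (?\<kappa> * f y) * (exp (- p * norm z powr a) * cos (z \<bullet> (x - y))))"
      by (simp only: mult.assoc inner_diff_right)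
    also have "\<dots> = (?\<kappa> * f y) * (LINT z|lborel. exp (- p * norm z powr a) * cos (z \<bullet> (x - y)))"
      by (rule integral_mult_right_zero)
    finally show "(LINT z|lborel. ?G y z) = f y * stable_density a p (x - y)"
      by (simp only: stable_density_def mult_ac)
  qed
  also have "\<dots> = Q f e x"
    by (simp only: e(2) stable_density_scaling[OF a(1) e(1)] Q_eq_convolution[OF \<open>f \<in> borel_measurable borel\<close> e(1)])
  finally show "V p x = Q f (p powr (1 / a)) x" by (simp only: e_def)
qed

text \<open>Since \<open>f\<close> is merely bounded and continuous, \<open>Q f e\<close> is
  uniformly close to \<open>f\<close> only on a ball. Outside it
  \<open>\<delta> * log_barrier x\<close> exceeds \<open>2 * B\<close>, the largest possible gap;
  this fixes \<open>R\<close>.\<close>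

lemma le_Q_plus_barrier:
  assumes f: "continuous_on UNIV f" and B: "\<And>x. \<bar>f x\<bar> \<le> B" and \<delta>: "0 < \<delta>"
  shows "\<exists>\<eta>>0. \<forall>e x. 0 \<le> e \<and> e \<le> \<eta> \<longrightarrow> f x \<le> Q f e x + \<delta> * (log_barrier x + 1)"
proof -
  have [measurable]: "f \<in> borel_measurable borel" by (rule borel_measurable_continuous_onI[OF f])
  define R where "R = sqrt (exp (2 * B / \<delta>))"
  have QB: "\<bar>Q f e x\<bar> \<le> B" for e x
  proof -
    have "norm (Q f e x) \<le> (LINT w|lborel. B * q w)"
      unfolding Q_def
      by (rule order_trans[OF integral_norm_bound], rule integral_mono_AE'[OF integrable_mult_right[OF integrable_q]])
         (use B order_trans[OF abs_ge_zero B] in \<open>auto simp: abs_mult intro!: mult_right_mono AE_I2\<close>)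
    then show ?thesis by (simp add: integral_q)
  qed
  let ?S = "{0..1::real} \<times> cball (0::real^'n) R"
  have "uniformly_continuous_on ?S (\<lambda>(e, x). Q f e x)"
    by (intro compact_uniformly_continuous continuous_on_subset[OF continuous_on_Q[OF f B]] compact_Times) auto
  then obtain d where d: "0 < d" "\<And>s s'. s \<in> ?S \<Longrightarrow> s' \<in> ?S \<Longrightarrow> dist s' s < d \<Longrightarrow>
      dist ((\<lambda>(e, x). Q f e x) s') ((\<lambda>(e, x). Q f e x) s) < \<delta>"
    unfolding uniformly_continuous_on_def using \<delta> by metis
  show ?thesis
  proof (intro exI[of _ "min (d / 2) 1"] conjI allI impI)
    show "0 < min (d / 2) 1" using d by simp
    fix e x assume e: "0 \<le> e \<and> e \<le> min (d / 2) 1"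
    show "f x \<le> Q f e x + \<delta> * (log_barrier x + 1)"
    proof (cases "norm x \<le> R")
      case True
      have "dist (0, x) (e, x) < d" using e d(1) by (auto simp: dist_Pair_Pair dist_real_def)
      then have "dist (Q f 0 x) (Q f e x) < \<delta>"
        using d(2)[of "(e, x)" "(0, x)"] True e by auto
      then have "f x \<le> Q f e x + \<delta>" by (auto simp: Q_0 dist_real_def)
      also have "\<dots> \<le> Q f e x + \<delta> * (log_barrier x + 1)" using \<delta> by (simp add: distrib_left)
      finally show ?thesis .
    next
      case False
      then have "exp (2 * B / \<delta>) < (norm x)\<^sup>2"
        unfolding R_def by (metis linorder_not_le norm_ge_zero real_le_rsqrt real_sqrt_abs abs_norm_cancel real_sqrt_le_iff)
      also have "\<dots> \<le> exp (log_barrier x)" by (rule norm_le_log_barrier)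
      finally have "2 * B < \<delta> * log_barrier x" using \<delta> by (simp add: field_simps)
      moreover have "f x \<le> B" "- B \<le> Q f e x" using B[of x] QB[of e x] by linarith+
      ultimately show ?thesis using \<delta> by (simp add: distrib_left)
    qed
  qed
qed

end

section \<open>Comparison for the absorption equation\<close>

lemma frac_laplacian_add:
  assumes "levy_integrable a f x" "levy_integrable a g x"
  shows "frac_laplacian a (\<lambda>y. f y + g y) x = frac_laplacian a f x + frac_laplacian a g x"
  using assms by (simp add: frac_laplacian_def levy_integral_add distrib_left)

lemma frac_laplacian_cmult:
  assumes "levy_integrable a f x"
  shows "frac_laplacian a (\<lambda>y. c * f y) x = c * frac_laplacian a f x"
  using assms by (simp add: frac_laplacian_def levy_integral_cmult mult.left_commute)

locale absorption_problem = stable_semigroup a "p 1"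
  for a :: real and p :: "real \<Rightarrow> real^'n \<Rightarrow> real" +
  fixes \<phi> h k :: "real \<Rightarrow> real" and u0 :: "real^'n \<Rightarrow> real" and u :: "real \<Rightarrow> real^'n \<Rightarrow> real"
  assumes phi_convex: "convex_on UNIV \<phi>" and phi_nonneg: "\<And>x. 0 \<le> \<phi> x" and phi_0: "\<phi> 0 = 0"
    and h_cont: "continuous_on {0..} h" and h_nonneg: "\<And>t. 0 \<le> t \<Longrightarrow> 0 \<le> h t"
    and k_cont: "continuous_on {0..} k" and k_nonneg: "\<And>t. 0 \<le> t \<Longrightarrow> 0 \<le> k t"
    and k_int: "(\<integral>\<^sup>+s\<in>{1..}. ennreal (k s) \<partial>lborel) = \<infinity>"
    and u0_int: "integrable lborel u0" and u0_nonneg: "\<And>x. 0 \<le> u0 x"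
    and sol: "classical_solution a k h \<phi> u0 u"
    and p: "\<And>t. 0 < t \<Longrightarrow> symmetric_stable_density a t (p t)"
begin

section \<open>The time change\<close>

definition K :: "real \<Rightarrow> real" where "K t = (LINT s:{0..t}|lborel. k s)"

lemma K_eq_integral: "K t = integral {0..t} k"
  unfolding K_def
  by (rule set_borel_integral_eq_integral, rule borel_integrable_atLeastAtMost')
     (rule continuous_on_subset[OF k_cont], auto)

lemma k_integrable_on: "0 \<le> s \<Longrightarrow> k integrable_on {s..t}"
  by (rule integrable_continuous_real, rule continuous_on_subset[OF k_cont]) auto

lemma K_0 [simp]: "K 0 = 0" by (simp add: K_eq_integral)

lemma K_mono: "0 \<le> s \<Longrightarrow> s \<le> t \<Longrightarrow> K s \<le> K t"
  unfolding K_eq_integral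
  by (rule integral_subset_le) (auto intro: k_integrable_on k_nonneg)

lemma K_nonneg: "0 \<le> t \<Longrightarrow> 0 \<le> K t" using K_mono[of 0 t] by simp

lemma has_derivative_K_within:
  assumes "0 \<le> t" "t \<le> T"
  shows "(K has_real_derivative k t) (at t within {0..T})"
  unfolding K_eq_integral[abs_def]
  by (rule integral_has_real_derivative) (use assms in \<open>auto intro: continuous_on_subset[OF k_cont]\<close>)

lemma has_derivative_K:
  assumes "0 < t"
  shows "(K has_real_derivative k t) (at t)"
  using has_derivative_K_within[of t "t + 1"] assms by (simp add: at_within_Icc_at)

lemma continuous_on_K: "continuous_on {0..T} K"
  by (rule DERIV_continuous_on[OF has_derivative_K_within]) auto

lemma filterlim_K: "filterlim K at_top at_top"
proof -
  have "\<exists>t\<ge>0. B < K t" for B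
  proof (rule ccontr)
    assume "\<not> ?thesis"
    then have le: "K t \<le> B" if "0 \<le> t" for t using that by force
    have [measurable]: "(\<lambda>s. ennreal (k s) * indicator {0..real n} s) \<in> borel_measurable lborel" for n
    proof -
      have "(\<lambda>s. indicator {0..real n} s *\<^sub>R k s) \<in> borel_measurable borel"
        using k_cont by (intro borel_measurable_continuous_on_indicator) (auto intro: continuous_on_subset)
      then have "(\<lambda>s. ennreal (indicator {0..real n} s *\<^sub>R k s)) \<in> borel_measurable lborel" by measurable
      also have "(\<lambda>s. ennreal (indicator {0..real n} s *\<^sub>R k s)) = (\<lambda>s. ennreal (k s) * indicator {0..real n} s)"
        by (auto simp: indicator_def)
      finally show ?thesis .
    qed
    have eq: "(\<integral>\<^sup>+s. ennreal (k s) * indicator {0..real n} s \<partial>lborel) = ennreal (K (real n))" for n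
      unfolding K_eq_integral
      by (rule nn_integral_has_integral_lebesgue') (auto intro: k_nonneg integrable_integral k_integrable_on)
    have "(\<integral>\<^sup>+s\<in>{1..}. ennreal (k s) \<partial>lborel) \<le> (\<integral>\<^sup>+s. (SUP n. ennreal (k s) * indicator {0..real n} s) \<partial>lborel)"
    proof (rule nn_integral_mono)
      fix s :: real
      show "ennreal (k s) * indicator {1..} s \<le> (SUP n. ennreal (k s) * indicator {0..real n} s)"
      proof (cases "1 \<le> s")
        case True
        obtain n where "s \<le> real n" using real_arch_simple by blast
        then show ?thesis using True by (intro SUP_upper2[of n]) (auto simp: indicator_def)
      qed simp
    qed
    also have "\<dots> = (SUP n. (\<integral>\<^sup>+s. ennreal (k s) * indicator {0..real n} s \<partial>lborel))"
    proof (rule nn_integral_monotone_convergence_SUP)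
      show "incseq (\<lambda>n s. ennreal (k s) * indicator {0..real n} s)"
        by (auto simp: incseq_def le_fun_def indicator_def)
    qed measurable
    also have "\<dots> \<le> ennreal B"
      by (rule SUP_least) (simp add: eq le ennreal_leI)
    finally show False using k_int by (simp add: top_unique)
  qed
  then show ?thesis
    unfolding filterlim_at_top eventually_at_top_linorder
    by (metis K_mono less_imp_le order_trans)
qed

section \<open>Regularity, sign and upper bound of the solution\<close>

lemma u_cont: "continuous_on ({0..} \<times> UNIV) (\<lambda>(t, x). u t x)"
  using sol by (simp add: classical_solution_def Cb12_def)

lemma u_cont_space: "0 \<le> t \<Longrightarrow> continuous_on UNIV (u t)"
  using continuous_on_compose2[OF u_cont continuous_on_Pair[OF continuous_on_const continuous_on_id], of t UNIV]
  by auto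

lemma u_measurable: "0 \<le> t \<Longrightarrow> u t \<in> borel_measurable borel"
  by (rule borel_measurable_continuous_onI[OF u_cont_space])

lemma u_bounded: "\<exists>B>0. \<forall>t\<ge>0. \<forall>x. \<bar>u t x\<bar> \<le> B"
proof -
  have "bounded ((\<lambda>(t, x). u t x) ` ({0..} \<times> UNIV))"
    using sol by (simp add: classical_solution_def Cb12_def)
  then show ?thesis unfolding bounded_pos by (auto simp: image_iff)
qed

lemma u_0: "u 0 x = u0 x"
  using sol by (simp add: classical_solution_def)

lemma u_levy_integrable: "0 < t \<Longrightarrow> levy_integrable a (u t) x"
  using sol by (intro Cb2_levy_integrable a) (simp add: classical_solution_def Cb12_def)

lemma u_deriv:
  assumes "0 < t"
  shows "((\<lambda>s. u s x) has_real_derivative k t * frac_laplacian a (u t) x - h t * \<phi> (u t x)) (at t)"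
proof -
  have "(\<lambda>s. u s x) differentiable (at t)"
    using sol assms by (simp add: classical_solution_def Cb12_def)
  then have "((\<lambda>s. u s x) has_real_derivative deriv (\<lambda>s. u s x) t) (at t)"
    by (simp add: DERIV_deriv_iff_real_differentiable)
  then show ?thesis using sol assms by (simp add: classical_solution_def)
qed

lemma k_bounded: "0 \<le> T \<Longrightarrow> \<exists>\<kappa>. \<forall>t\<in>{0..T}. k t \<le> \<kappa>"
  using continuous_attains_sup[of "{0..T}" k] continuous_on_subset[OF k_cont, of "{0..T}"] by auto

lemma h_bounded: "0 \<le> T \<Longrightarrow> \<exists>\<eta>. \<forall>t\<in>{0..T}. h t \<le> \<eta>"
  using continuous_attains_sup[of "{0..T}" h] continuous_on_subset[OF h_cont, of "{0..T}"] by auto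

text \<open>The right-hand side is the chord of the convex function between \<open>- B\<close> and
  0, where the function vanishes.\<close>

lemma phi_le:
  assumes B: "0 < B" and x: "- B \<le> x" "x \<le> 0"
  shows "\<phi> x \<le> \<phi> (- B) / B * \<bar>x\<bar>"
proof -
  define l where "l = \<bar>x\<bar> / B"
  have "\<bar>x\<bar> \<le> B" using x by simp
  then have l: "0 \<le> l" "l \<le> 1" using B unfolding l_def by (simp_all only: divide_le_eq_1_pos) simp
  have "\<phi> ((1 - l) *\<^sub>R 0 + l *\<^sub>R (- B)) \<le> (1 - l) * \<phi> 0 + l * \<phi> (- B)"
    by (rule convex_onD[OF phi_convex l]) auto
  moreover have "(1 - l) *\<^sub>R 0 + l *\<^sub>R (- B) = x" using B x by (simp add: l_def)
  ultimately show ?thesis by (simp add: phi_0 l_def mult.commute)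
qed

text \<open>Convexity bounds the absorption of a negative value linearly, so \<open>exp (- \<lambda> t)\<close> with \<open>\<lambda>\<close> large turns
  \<open>- u\<close> into a subsolution where it is positive.\<close>

lemma u_nonneg:
  assumes T: "0 \<le> T"
  shows "0 \<le> u T x"
proof -
  obtain B where B: "0 < B" "\<And>t x. 0 \<le> t \<Longrightarrow> \<bar>u t x\<bar> \<le> B" using u_bounded by blast
  obtain L where L: "0 \<le> L" "\<And>x::real^'n. frac_laplacian a log_barrier x \<le> L"
    using frac_laplacian_log_barrier_bounded[OF a] by blast
  obtain \<kappa> where \<kappa>: "\<And>t. t \<in> {0..T} \<Longrightarrow> k t \<le> \<kappa>" using k_bounded[OF T] by blast
  obtain \<eta> where \<eta>: "\<And>t. t \<in> {0..T} \<Longrightarrow> h t \<le> \<eta>" using h_bounded[OF T] by blast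
  have eta0: "0 \<le> \<eta>" using \<eta>[of 0] h_nonneg[of 0] T by simp
  \<comment> \<open>By \<open>phi_le\<close>, \<open>l * \<bar>v\<bar>\<close> bounds
    \<open>h t * \<phi> v\<close> for times up to \<open>T\<close> and negative values
    \<open>v\<close> not below \<open>- B\<close>, so the damping outweighs the absorption.\<close>
  define l where "l = \<eta> * (\<phi> (- B) / B)"
  define y where "y t x = - exp (- l * t) * u t x" for t x
  define y' where "y' t x = - exp (- l * t) * (k t * frac_laplacian a (u t) x - h t * \<phi> (u t x)) + l * exp (- l * t) * u t x" for t x
  have l: "0 \<le> l" using eta0 B phi_nonneg by (simp add: l_def)
  have "y T x \<le> \<delta> * (log_barrier x + 1 + (\<kappa> * L + 1) * (T - 0))" if \<delta>: "0 < \<delta>" for \<delta>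
  proof (rule nonlocal_maximum_principle[where B=B and y'=y' and k=k, OF a \<delta> L(2,1)])
    show "continuous_on ({0..T} \<times> UNIV) (\<lambda>(t, x). y t x)"
    proof -
      have "continuous_on ({0..T} \<times> UNIV) (\<lambda>(t, x). u t x)"
        by (rule continuous_on_subset[OF u_cont]) auto
      then show ?thesis unfolding y_def case_prod_unfold by (intro continuous_intros)
    qed
    fix t x
    show "y t x \<le> B" if "0 \<le> t" "t \<le> T"
    proof -
      have "\<bar>y t x\<bar> \<le> 1 * B" unfolding y_def abs_mult using l that B by (intro mult_mono) auto
      then show ?thesis by simp
    qed
    show "y 0 x \<le> \<delta> * (log_barrier x + 1)"
    proof -
      have "y 0 x \<le> 0" by (simp add: y_def u_0 u0_nonneg)
      also have "0 \<le> \<delta> * (log_barrier x + 1)" using \<delta> by simp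
      finally show ?thesis .
    qed
    assume t: "0 < t" "t \<le> T"
    show "0 \<le> k t" "k t \<le> \<kappa>" using t k_nonneg \<kappa> by auto
    have ui: "levy_integrable a (u t) z" for z by (rule u_levy_integrable[OF t(1)])
    show "levy_integrable a (y t) x"
      unfolding y_def[abs_def] by (rule levy_integrable_cmult[OF ui])
    show "((\<lambda>r. y r x) has_real_derivative y' t x) (at t)"
      unfolding y_def y'_def by (auto intro!: derivative_eq_intros u_deriv[OF t(1)])
    assume pos: "0 < y t x"
    then have neg: "u t x < 0" by (simp add: y_def mult_less_0_iff)
    have "h t * \<phi> (u t x) \<le> \<eta> * (\<phi> (- B) / B * \<bar>u t x\<bar>)"
      using \<eta>[of t] t neg B phi_nonneg[of "u t x"] eta0 abs_le_D2[OF B(2)[of t x]]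
      by (intro mult_mono phi_le) auto
    then have "h t * \<phi> (u t x) + l * u t x \<le> 0" using neg by (simp add: l_def)
    then have "exp (- l * t) * (h t * \<phi> (u t x) + l * u t x) \<le> 0"
      by (simp add: mult_nonneg_nonpos)
    moreover have "frac_laplacian a (y t) x = - exp (- l * t) * frac_laplacian a (u t) x"
      unfolding y_def[abs_def] by (rule frac_laplacian_cmult[OF ui])
    ultimately show "y' t x \<le> k t * frac_laplacian a (y t) x"
      by (simp add: y'_def algebra_simps)
  qed (use T in auto)
  then have "y T x \<le> 0 + \<delta>" if "0 < \<delta>" for \<delta>
  proof -
    \<comment> \<open>The factor \<open>C\<close> does not depend on \<open>\<delta>\<close>, so the
      error from the barrier becomes arbitrarily small at the fixed point \<open>x\<close>.\<close>
    define C where "C = log_barrier x + 1 + (\<kappa> * L + 1) * (T - 0)"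
    have k0: "0 \<le> \<kappa>" using \<kappa>[of 0] k_nonneg[of 0] T by simp
    have C: "0 < C" unfolding C_def using L k0 T by (simp add: add_pos_nonneg add_nonneg_pos)
    have "y T x \<le> \<delta> / C * C"
      using \<open>\<And>\<delta>. 0 < \<delta> \<Longrightarrow> y T x \<le> \<delta> * (log_barrier x + 1 + (\<kappa> * L + 1) * (T - 0))\<close>[of "\<delta> / C"] C that
      by (simp only: C_def[symmetric]) simp
    then show ?thesis using C by simp
  qed
  then have "y T x \<le> 0" by (rule field_le_epsilon)
  then show ?thesis by (simp add: y_def zero_le_mult_iff)
qed

text \<open>The supersolution is the semigroup started from \<open>u s\<close> and run for the extra time \<open>\<epsilon>\<close>,
  which makes it smooth; the barrier absorbs the error at time \<open>s\<close>.\<close>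

lemma u_le_Q:
  assumes s: "0 \<le> s" "s \<le> T" and us: "integrable lborel (u s)"
  shows "u T x \<le> Q (u s) ((K T - K s) powr (1 / a)) x"
proof -
  define W where "W m = (1 / gauss_norm TYPE(real^'n))\<^sup>2 * u s (fst m)" for m :: "(real^'n) \<times> (real^'n)"
  interpret W: wave_superposition lborel a W snd "\<lambda>m. snd m \<bullet> fst m"
    unfolding W_def by (rule wave_superposition_Q[OF us])
  have V_eq: "W.V r z = Q (u s) (r powr (1 / a)) z" if "0 < r" for r z
    using V_eq_Q[OF us that] by (simp only: W_def[abs_def])
  have T: "0 \<le> T" using s by simp
  obtain B where B: "0 < B" "\<And>t x. 0 \<le> t \<Longrightarrow> \<bar>u t x\<bar> \<le> B" using u_bounded by blast
  obtain L where L: "0 \<le> L" "\<And>x::real^'n. frac_laplacian a log_barrier x \<le> L"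
    using frac_laplacian_log_barrier_bounded[OF a] by blast
  obtain \<kappa> where \<kappa>: "\<And>t. t \<in> {0..T} \<Longrightarrow> k t \<le> \<kappa>" using k_bounded[OF T] by blast
  define C where "C = log_barrier x + 1 + (\<kappa> * L + 1) * (T - s)"
  have approx: "\<exists>\<epsilon>>0. \<epsilon> \<le> \<delta> \<and> u T x \<le> Q (u s) ((K T - K s + \<epsilon>) powr (1 / a)) x + \<delta> * C" if \<delta>: "0 < \<delta>" for \<delta>
  proof -
    obtain \<eta> where \<eta>: "0 < \<eta>" "\<And>e z. 0 \<le> e \<Longrightarrow> e \<le> \<eta> \<Longrightarrow> u s z \<le> Q (u s) e z + \<delta> * (log_barrier z + 1)"
      using le_Q_plus_barrier[OF u_cont_space[OF s(1)] B(2)[OF s(1)] \<delta>] by blast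
    \<comment> \<open>\<open>Q\<close> is parametrized by the power \<open>1 / a\<close> of time, so
      the bound by \<open>\<eta> powr a\<close> is what the comparison at time \<open>s\<close>
      asks; the bound by \<open>\<delta>\<close> lets the extra time vanish together with
      \<open>\<delta>\<close>.\<close>
    define \<epsilon> where "\<epsilon> = min \<delta> (\<eta> powr a)"
    have \<epsilon>: "0 < \<epsilon>" "\<epsilon> \<le> \<delta>" using \<delta> \<eta> by (auto simp: \<epsilon>_def)
    have "\<epsilon> powr (1 / a) \<le> (\<eta> powr a) powr (1 / a)"
      using \<epsilon> a by (intro powr_mono2) (auto simp: \<epsilon>_def)
    also have "\<dots> = \<eta>" using \<eta> a by (simp add: powr_powr)
    finally have init: "u s z \<le> W.V \<epsilon> z + \<delta> * (log_barrier z + 1)" for z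
      using \<eta>(2)[of "\<epsilon> powr (1 / a)" z] V_eq[OF \<epsilon>(1)] by simp
    define r where "r t = K t - K s + \<epsilon>" for t
    have r: "\<epsilon> \<le> r t" if "s \<le> t" for t using K_mono[OF s(1) that] by (simp add: r_def)
    define y where "y t z = u t z + (- 1) * W.V (r t) z" for t z
    define y' where "y' t z = (k t * frac_laplacian a (u t) z - h t * \<phi> (u t z)) + (- 1) * (frac_laplacian a (W.V (r t)) z * k t)" for t z
    have "y T x \<le> \<delta> * (log_barrier x + 1 + (\<kappa> * L + 1) * (T - s))"
    proof (rule nonlocal_maximum_principle[where B="B + (LINT m|lborel. W.E \<epsilon> m)" and y'=y' and k=k, OF a \<delta> L(2,1)])
      show "continuous_on ({s..T} \<times> UNIV) (\<lambda>(t, z). y t z)"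
        unfolding y_def case_prod_unfold
      proof (intro continuous_intros)
        have "continuous_on ({s..T} \<times> UNIV) (\<lambda>(t, x). u t x)"
          by (rule continuous_on_subset[OF u_cont]) (use s in auto)
        then show "continuous_on ({s..T} \<times> UNIV) (\<lambda>q. u (fst q) (snd q))"
          by (simp only: case_prod_unfold)
        have "continuous_on ({s..T} \<times> UNIV) (\<lambda>q. K (fst q))"
          by (rule continuous_on_compose2[OF continuous_on_K[of T]]) (use s in \<open>auto intro!: continuous_intros\<close>)
        then have "continuous_on ({s..T} \<times> UNIV) (\<lambda>q::real \<times> (real^'n). (\<lambda>(r, z). W.V r z) (r (fst q), snd q))"
          using r unfolding r_def
          by (intro continuous_on_compose2[OF W.continuous_on_V[OF \<epsilon>(1)]] continuous_intros) auto
        then show "continuous_on ({s..T} \<times> UNIV) (\<lambda>q. W.V (r (fst q)) (snd q))" by simp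
      qed
      fix t z
      show "y t z \<le> B + (LINT m|lborel. W.E \<epsilon> m)" if "s \<le> t" "t \<le> T"
        using W.V_bound[OF \<epsilon>(1) r[OF that(1)], of z] B(2)[of t z] s that by (simp add: y_def abs_le_iff)
      show "y s z \<le> \<delta> * (log_barrier z + 1)"
        using init[of z] by (simp add: y_def r_def)
      assume t: "s < t" "t \<le> T"
      have t0: "0 < t" using t s by simp
      have rt: "0 < r t" using r[of t] t \<epsilon> by simp
      show "0 \<le> k t" "k t \<le> \<kappa>" using t t0 k_nonneg \<kappa> by auto
      have ui: "levy_integrable a (u t) z" by (rule u_levy_integrable[OF t0])
      have vi: "levy_integrable a (W.V (r t)) z" by (rule W.levy_integrable_V[OF rt])
      show "levy_integrable a (y t) z"
        unfolding y_def[abs_def] by (intro levy_integrable_add levy_integrable_cmult ui vi)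
      have "(r has_real_derivative k t) (at t)"
        unfolding r_def[abs_def] by (auto intro!: derivative_eq_intros has_derivative_K[OF t0])
      from DERIV_chain2[OF W.has_derivative_V_time[OF rt] this]
      have "((\<lambda>t. W.V (r t) z) has_real_derivative frac_laplacian a (W.V (r t)) z * k t) (at t)"
        by (simp add: W.frac_laplacian_V[OF rt])
      then show "((\<lambda>t. y t z) has_real_derivative y' t z) (at t)"
        unfolding y_def y'_def by (intro DERIV_add u_deriv[OF t0] DERIV_cmult)
      \<comment> \<open>The absorption has a favourable sign: \<open>u\<close> is a subsolution of
        the linear equation that the superposition solves.\<close>
      have "0 \<le> h t * \<phi> (u t z)" using h_nonneg[of t] t0 phi_nonneg by simp
      moreover have "frac_laplacian a (y t) z = frac_laplacian a (u t) z + (- 1) * frac_laplacian a (W.V (r t)) z"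
        unfolding y_def[abs_def]
        by (simp only: frac_laplacian_add[OF ui levy_integrable_cmult[OF vi]] frac_laplacian_cmult[OF vi])
      ultimately show "y' t z \<le> k t * frac_laplacian a (y t) z"
        by (simp only: y'_def) (simp add: algebra_simps)
    qed (use s in auto)
    then have "u T x \<le> Q (u s) ((K T - K s + \<epsilon>) powr (1 / a)) x + \<delta> * C"
      using V_eq[of "r T" x] r[OF s(2)] \<epsilon> by (simp add: y_def C_def r_def)
    then show ?thesis using \<epsilon> by blast
  qed
  have "\<forall>n. \<exists>\<epsilon>>0. \<epsilon> \<le> 1 / real (Suc n) \<and> u T x \<le> Q (u s) ((K T - K s + \<epsilon>) powr (1 / a)) x + 1 / real (Suc n) * C"
    by (intro allI approx) simp
  then obtain \<epsilon> where \<epsilon>: "\<And>n. 0 < \<epsilon> n" "\<And>n. \<epsilon> n \<le> 1 / real (Suc n)"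
    "\<And>n. u T x \<le> Q (u s) ((K T - K s + \<epsilon> n) powr (1 / a)) x + 1 / real (Suc n) * C" by metis
  have lim: "(\<lambda>n. 1 / real (Suc n)) \<longlonglongrightarrow> 0" by (rule LIMSEQ_Suc[OF lim_1_over_n])
  have eps: "\<epsilon> \<longlonglongrightarrow> 0"
    by (rule tendsto_sandwich[OF _ _ tendsto_const lim]) (use \<epsilon> in \<open>auto intro!: always_eventually less_imp_le\<close>)
  have "(\<lambda>n. K T - K s + \<epsilon> n) \<longlonglongrightarrow> K T - K s + 0" by (intro tendsto_intros eps)
  then have lim_K: "(\<lambda>n. K T - K s + \<epsilon> n) \<longlonglongrightarrow> K T - K s" by simp
  \<comment> \<open>\<open>K T = K s\<close> is possible where \<open>k\<close> vanishes, so both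
    the limit of the powers and the continuity of \<open>Q\<close> have to include 0.\<close>
  have "0 \<le> K T - K s + \<epsilon> n" for n using K_mono[OF s] \<epsilon>(1)[of n] by linarith
  then have e: "(\<lambda>n. (K T - K s + \<epsilon> n) powr (1 / a)) \<longlonglongrightarrow> (K T - K s) powr (1 / a)"
    using a by (intro tendsto_powr2[OF lim_K tendsto_const]) (simp_all add: always_eventually)
  have "continuous_on UNIV (\<lambda>e. (\<lambda>(e, x). Q (u s) e x) (e, x))"
    by (rule continuous_on_compose2[OF continuous_on_Q[OF u_cont_space[OF s(1)] B(2)[OF s(1)]]])
       (auto intro!: continuous_intros)
  then have "isCont (\<lambda>e. Q (u s) e x) ((K T - K s) powr (1 / a))" by (simp add: continuous_on_eq_continuous_at)
  from isCont_tendsto_compose[OF this e]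
  have "(\<lambda>n. Q (u s) ((K T - K s + \<epsilon> n) powr (1 / a)) x + 1 / real (Suc n) * C) \<longlonglongrightarrow> Q (u s) ((K T - K s) powr (1 / a)) x + 0 * C"
    by (intro tendsto_intros lim)
  then show ?thesis
    using \<epsilon>(3) by (intro LIMSEQ_le_const[of _ "Q (u s) ((K T - K s) powr (1 / a)) x"]) auto
qed

end

section \<open>Asymptotics\<close>

lemma ennreal_tendsto_0I:
  fixes f :: "'a \<Rightarrow> ennreal"
  assumes "\<And>\<epsilon>::real. 0 < \<epsilon> \<Longrightarrow> eventually (\<lambda>x. f x \<le> ennreal \<epsilon>) F"
  shows "(f \<longlongrightarrow> 0) F"
proof (rule order_tendstoI)
  fix b :: ennreal assume "0 < b"
  then obtain c where c: "0 < c" "c < b" using dense by blast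
  then obtain r where r: "c = ennreal r" "0 \<le> r" by (cases c) (auto simp: top_unique)
  then have "0 < r" using c by simp
  from assms[OF this] show "eventually (\<lambda>x. f x < b) F"
    by eventually_elim (use c r in \<open>auto intro: le_less_trans\<close>)
qed simp

context stable_semigroup
begin

lemma integrable_Q:
  assumes f: "continuous_on UNIV f" and B: "\<And>x. \<bar>f x\<bar> \<le> B" and nn: "\<And>x. 0 \<le> f x"
    and int: "integrable lborel f"
  shows "integrable lborel (Q f e)" and "(LINT x|lborel. Q f e x) = (LINT x|lborel. f x)"
proof -
  have "continuous_on UNIV (\<lambda>x. (\<lambda>(e, x). Q f e x) (e, x))"
    by (rule continuous_on_compose2[OF continuous_on_Q[OF f B]]) (auto intro!: continuous_intros)
  then have [measurable]: "Q f e \<in> borel_measurable borel"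
    by (intro borel_measurable_continuous_onI) simp
  have eq: "(\<integral>\<^sup>+x. ennreal (Q f e x) \<partial>lborel) = ennreal (LINT x|lborel. f x)"
    using nn_integral_Q[OF f B nn] nn_integral_eq_integral[OF int] nn by simp
  then show i: "integrable lborel (Q f e)"
    by (intro integrableI_nonneg) (auto intro!: AE_I2 Q_nonneg nn)
  have "ennreal (LINT x|lborel. Q f e x) = ennreal (LINT x|lborel. f x)"
    using eq nn_integral_eq_integral[OF i] Q_nonneg[OF nn] by simp
  then show "(LINT x|lborel. Q f e x) = (LINT x|lborel. f x)"
    by (subst (asm) ennreal_inj) (auto intro!: Bochner_Integration.integral_nonneg Q_nonneg nn)
qed

text \<open>This is the smoothing from L1 to the sup norm: with \<open>e\<close> the power
  \<open>1 / a\<close> of time, \<open>(1 / e) ^ CARD('n)\<close> is time to the power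
  \<open>- d / a\<close>.\<close>

lemma Q_le:
  assumes nn: "\<And>x. 0 \<le> f x" and int: "integrable lborel f" and C: "\<And>x. q x \<le> C" and e: "0 < e"
  shows "Q f e x \<le> (1 / e) ^ CARD('n) * C * (LINT y|lborel. f y)"
proof -
  have "Q f e x = (LINT y|lborel. f y * ((1 / e) ^ CARD('n) * q ((1 / e) *\<^sub>R (x - y))))"
    using int by (intro Q_eq_convolution e) (simp add: borel_measurable_integrable)
  also have "\<dots> \<le> (LINT y|lborel. f y * ((1 / e) ^ CARD('n) * C))"
    using int C e nn order_trans[OF q_nonneg C]
    by (intro integral_mono_AE' AE_I2 mult_left_mono mult_nonneg_nonneg) auto
  also have "\<dots> = (1 / e) ^ CARD('n) * C * (LINT y|lborel. f y)" by simp
  finally show ?thesis .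
qed

text \<open>In the variable \<open>x / e n\<close> the orbit converges pointwise to a multiple of \<open>q\<close> of the same
  mass, hence in \<open>L\<^sup>1\<close> by Scheffe's lemma.\<close>

lemma Q_asymptotics:
  fixes e e' :: "nat \<Rightarrow> real"
  assumes f: "continuous_on UNIV f" and B: "\<And>x. \<bar>f x\<bar> \<le> B" and nn: "\<And>x. 0 \<le> f x"
    and int: "integrable lborel f"
    and e: "\<And>n. 0 < e n" "\<And>n. 0 < e' n" and ratio: "(\<lambda>n. e n / e' n) \<longlonglongrightarrow> 1"
    and e_lim: "filterlim e at_top sequentially"
  shows "(\<lambda>n. \<integral>\<^sup>+x. ennreal \<bar>Q f (e' n) x - (LINT y|lborel. f y) * stable_density a (e n powr a) x\<bar> \<partial>lborel) \<longlonglongrightarrow> 0"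
proof -
  define M where "M = (LINT y|lborel. f y)"
  have M: "0 \<le> M" unfolding M_def by (rule Bochner_Integration.integral_nonneg[OF nn])
  have [measurable]: "f \<in> borel_measurable borel" by (rule borel_measurable_continuous_onI[OF f])
  have Qm [measurable]: "Q f r \<in> borel_measurable borel" for r
    using integrable_Q(1)[OF f B nn int] by (simp add: borel_measurable_integrable)
  let ?s = "\<lambda>n. stable_density a (e n powr a)"
  have sm [measurable]: "(?s n :: real^'n \<Rightarrow> real) \<in> borel_measurable borel" for n
    using e(1)[of n] by (intro borel_measurable_continuous_onI continuous_on_stable_density a) simp
  \<comment> \<open>The rescaling uses \<open>e n\<close>, the scale of the target density, although
    the flow has scale \<open>e' n\<close>; \<open>ratio\<close> makes the discrepancy vanish in the
    limit.\<close>
  define G where "G n x = e n ^ CARD('n) * Q f (e' n) (e n *\<^sub>R x)" for n x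
  have Gm [measurable]: "G n \<in> borel_measurable lborel" for n unfolding G_def by measurable
  have G_nn: "0 \<le> G n x" for n x
    unfolding G_def using e Q_nonneg[OF nn] by (intro mult_nonneg_nonneg) (auto intro: less_imp_le)
  have "(\<lambda>n. \<integral>\<^sup>+x. ennreal \<bar>Q f (e' n) x - M * ?s n x\<bar> \<partial>lborel)
      = (\<lambda>n. \<integral>\<^sup>+x. ennreal (norm (G n x - M * q x)) \<partial>lborel)"
  proof (rule ext)
    fix n
    have "(\<integral>\<^sup>+x. ennreal \<bar>Q f (e' n) x - M * ?s n x\<bar> \<partial>lborel)
       = ennreal (e n ^ CARD('n)) * (\<integral>\<^sup>+x. ennreal \<bar>Q f (e' n) (e n *\<^sub>R x) - M * ?s n (e n *\<^sub>R x)\<bar> \<partial>lborel)"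
      by (subst nn_integral_lborel_affine[where c="e n" and t=0]) (use e(1)[of n] in auto)
    also have "\<dots> = (\<integral>\<^sup>+x. ennreal (e n ^ CARD('n)) * ennreal \<bar>Q f (e' n) (e n *\<^sub>R x) - M * ?s n (e n *\<^sub>R x)\<bar> \<partial>lborel)"
      by (rule nn_integral_cmult[symmetric]) measurable
    also have "\<dots> = (\<integral>\<^sup>+x. ennreal (norm (G n x - M * q x)) \<partial>lborel)"
    proof (rule nn_integral_cong)
      fix x :: "real^'n"
      have "?s n (e n *\<^sub>R x) = (1 / e n) ^ CARD('n) * q x"
        using e(1)[of n] by (simp add: stable_density_scaling a)
      then have "e n ^ CARD('n) * \<bar>Q f (e' n) (e n *\<^sub>R x) - M * ?s n (e n *\<^sub>R x)\<bar>
         = \<bar>e n ^ CARD('n) * (Q f (e' n) (e n *\<^sub>R x) - M * ((1 / e n) ^ CARD('n) * q x))\<bar>"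
        using e(1)[of n] by (simp add: abs_mult)
      also have "\<dots> = norm (G n x - M * q x)"
        using e(1)[of n] by (simp add: G_def right_diff_distrib power_divide)
      finally show "ennreal (e n ^ CARD('n)) * ennreal \<bar>Q f (e' n) (e n *\<^sub>R x) - M * ?s n (e n *\<^sub>R x)\<bar>
         = ennreal (norm (G n x - M * q x))"
        using e(1)[of n] by (simp add: ennreal_mult[symmetric])
    qed
    finally show "(\<integral>\<^sup>+x. ennreal \<bar>Q f (e' n) x - M * ?s n x\<bar> \<partial>lborel)
       = (\<integral>\<^sup>+x. ennreal (norm (G n x - M * q x)) \<partial>lborel)" .
  qed
  also have "\<dots> \<longlonglongrightarrow> 0"
  \<comment> \<open>Besides pointwise convergence, the L1 norms of \<open>G n\<close> must not
    exceed that of the limit; both equal \<open>M\<close>, since rescaling and the semigroup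
    conserve mass.\<close>
  proof (rule Scheffe_lemma2)
    show "integrable lborel (\<lambda>x. M * q x)" by (rule integrable_mult_right[OF integrable_q])
    show "AE x in lborel. (\<lambda>n. G n x) \<longlonglongrightarrow> M * q x"
    proof (rule AE_I2)
      fix x :: "real^'n"
      obtain C where C: "0 \<le> C" "\<And>x::real^'n. \<bar>q x\<bar> \<le> C"
        using stable_density_bound[OF a(1) zero_less_one] by blast
      have rp: "(\<lambda>n. (e n / e' n) ^ CARD('n)) \<longlonglongrightarrow> 1 ^ CARD('n)" by (intro tendsto_power ratio)
      then have "Bseq (\<lambda>n. (e n / e' n) ^ CARD('n))" by (intro convergent_imp_Bseq convergentI)
      then obtain R where R: "\<And>n. norm ((e n / e' n) ^ CARD('n)) \<le> R" unfolding Bseq_def by blast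
      have inv: "(\<lambda>n. 1 / e' n) \<longlonglongrightarrow> 0"
      proof -
        have cancel: "e n / e' n * inverse (e n) = 1 / e' n" for n
        proof -
          have "e n \<noteq> 0" using e(1)[of n] by simp
          then show ?thesis by simp
        qed
        have "(\<lambda>n. e n / e' n * inverse (e n)) \<longlonglongrightarrow> 1 * 0"
          by (rule tendsto_mult[OF ratio tendsto_inverse_0_at_top[OF e_lim]])
        then show ?thesis by (simp only: cancel mult_zero_right)
      qed
      let ?k = "\<lambda>n y. (e n / e' n) ^ CARD('n) * q ((e n / e' n) *\<^sub>R x - (1 / e' n) *\<^sub>R y)"
      have G: "G n x = (LINT y|lborel. f y * (?k n y))" for n
        unfolding G_def
        by (subst Q_eq_convolution[OF _ e(2)], simp, subst integral_mult_right_zero[symmetric])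
           (simp add: scaleR_diff_right power_divide mult_ac)
      have "(\<lambda>n. LINT y|lborel. f y * (?k n y))
          \<longlonglongrightarrow> (LINT y|lborel. f y * q x)"
      proof (rule integral_dominated_convergence[where w="\<lambda>y. f y * (R * C)"])
        show "AE y in lborel. (\<lambda>n. f y * (?k n y)) \<longlonglongrightarrow> f y * q x"
        proof (rule AE_I2)
          fix y :: "real^'n"
          have "(\<lambda>n. (e n / e' n) *\<^sub>R x - (1 / e' n) *\<^sub>R y) \<longlonglongrightarrow> 1 *\<^sub>R x - 0 *\<^sub>R y"
            by (intro tendsto_intros ratio inv)
          moreover have "isCont q (1 *\<^sub>R x - 0 *\<^sub>R y)"
            using continuous_on_q by (simp add: continuous_on_eq_continuous_at)
          ultimately have "(\<lambda>n. q ((e n / e' n) *\<^sub>R x - (1 / e' n) *\<^sub>R y)) \<longlonglongrightarrow> q (1 *\<^sub>R x - 0 *\<^sub>R y)"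
            by (rule isCont_tendsto_compose[rotated])
          from tendsto_mult_left[OF tendsto_mult[OF rp this], of "f y"]
          show "(\<lambda>n. f y * (?k n y)) \<longlonglongrightarrow> f y * q x"
            by simp
        qed
        show "AE y in lborel. norm (f y * (?k n y)) \<le> f y * (R * C)" for n
        proof (rule AE_I2)
          fix y
          have "norm (?k n y) \<le> R * C"
            unfolding norm_mult using R[of n] C order_trans[OF norm_ge_zero R[of n]] by (intro mult_mono) auto
          then show "norm (f y * (?k n y)) \<le> f y * (R * C)"
            by (subst norm_mult) (simp add: nn mult_left_mono)
        qed
        show "integrable lborel (\<lambda>y. f y * (R * C))" by (rule integrable_mult_left[OF int])
      qed measurable
      then show "(\<lambda>n. G n x) \<longlonglongrightarrow> M * q x" by (simp add: G M_def)
    qed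
    fix n
    have "(\<integral>\<^sup>+x. ennreal (norm (G n x)) \<partial>lborel) = (\<integral>\<^sup>+x. ennreal (e n ^ CARD('n)) * ennreal (Q f (e' n) (e n *\<^sub>R x)) \<partial>lborel)"
      using e(1)[of n] Q_nonneg[OF nn] by (intro nn_integral_cong) (simp add: G_def abs_mult ennreal_mult)
    also have "\<dots> = ennreal (e n ^ CARD('n)) * (\<integral>\<^sup>+x. ennreal (Q f (e' n) (e n *\<^sub>R x)) \<partial>lborel)"
      by (rule nn_integral_cmult) measurable
    also have "\<dots> = (\<integral>\<^sup>+x. ennreal (Q f (e' n) x) \<partial>lborel)"
      by (subst (2) nn_integral_lborel_affine[where c="e n" and t=0]) (use e(1)[of n] in auto)
    also have "\<dots> = ennreal M"
      by (simp add: nn_integral_Q[OF f B nn] nn_integral_eq_integral[OF int] nn M_def)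
    also have "\<dots> = (\<integral>\<^sup>+x. ennreal (norm (M * q x)) \<partial>lborel)"
      using M by (simp add: abs_mult ennreal_mult nn_integral_cmult nn_integral_q)
    finally show "(\<integral>\<^sup>+x. ennreal (norm (G n x)) \<partial>lborel) \<le> (\<integral>\<^sup>+x. ennreal (norm (M * q x)) \<partial>lborel)" by simp
  qed measurable
  finally show ?thesis by (simp only: M_def)
qed

end

context absorption_problem
begin

abbreviation flow :: "real \<Rightarrow> real \<Rightarrow> real^'n \<Rightarrow> real" where
  "flow s t \<equiv> Q (u s) ((K t - K s) powr (1 / a))"

section \<open>The mass of the solution and its limit\<close>

definition mass :: "real \<Rightarrow> real" where "mass t = (LINT x|lborel. u t x)"

text \<open>An arbitrary integrable time slice is allowed as the start: \<open>s = 0\<close> yields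
  integrability at all later times, after which every \<open>s\<close> qualifies. The flow dominates
  \<open>u t\<close> and conserves mass, so the L1 distance is a difference of masses.\<close>

lemma integrable_u_step:
  assumes s: "0 \<le> s" "s \<le> t" and us: "integrable lborel (u s)"
  shows "integrable lborel (u t)" and "mass t \<le> mass s"
    and "(\<integral>\<^sup>+x. ennreal \<bar>u t x - flow s t x\<bar> \<partial>lborel) = ennreal (mass s - mass t)"
proof -
  obtain B where B: "0 < B" "\<And>t x. 0 \<le> t \<Longrightarrow> \<bar>u t x\<bar> \<le> B" using u_bounded by blast
  let ?Q = "flow s t"
  note Qi = integrable_Q[OF u_cont_space[OF s(1)] B(2)[OF s(1)] u_nonneg[OF s(1)] us, of "(K t - K s) powr (1 / a)"]
  have t: "0 \<le> t" using s by simp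
  have le: "u t x \<le> ?Q x" for x by (rule u_le_Q[OF s us])
  show ut: "integrable lborel (u t)"
    by (rule Bochner_Integration.integrable_bound[OF Qi(1)])
       (use u_measurable[OF t] le u_nonneg[OF t] in \<open>auto intro!: AE_I2 intro: order_trans[OF _ abs_ge_self]\<close>)
  show "mass t \<le> mass s"
    unfolding mass_def Qi(2)[symmetric] by (rule integral_mono[OF ut Qi(1) le])
  have "(\<integral>\<^sup>+x. ennreal \<bar>u t x - ?Q x\<bar> \<partial>lborel) = (\<integral>\<^sup>+x. ennreal (?Q x - u t x) \<partial>lborel)"
    using le by (intro nn_integral_cong) (simp add: abs_minus_commute[of "u t _"])
  also have "\<dots> = ennreal (LINT x|lborel. ?Q x - u t x)"
    using le by (intro nn_integral_eq_integral Bochner_Integration.integrable_diff Qi(1) ut) simp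
  also have "(LINT x|lborel. ?Q x - u t x) = mass s - mass t"
    by (simp add: Qi ut mass_def)
  finally show "(\<integral>\<^sup>+x. ennreal \<bar>u t x - ?Q x\<bar> \<partial>lborel) = ennreal (mass s - mass t)" .
qed

lemma integrable_u_0: "integrable lborel (u 0)"
proof -
  have "u 0 = u0" by (rule ext) (rule u_0)
  then show ?thesis using u0_int by simp
qed

lemma integrable_u: "0 \<le> t \<Longrightarrow> integrable lborel (u t)"
  by (rule integrable_u_step(1)[OF order_refl _ integrable_u_0])

lemma mass_antimono: "0 \<le> s \<Longrightarrow> s \<le> t \<Longrightarrow> mass t \<le> mass s"
  using integrable_u_step(2) integrable_u by blast

lemma mass_nonneg: "0 \<le> t \<Longrightarrow> 0 \<le> mass t"
  unfolding mass_def by (rule Bochner_Integration.integral_nonneg) (rule u_nonneg)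

text \<open>As an infimum the value is available before any convergence is proved; monotonicity
  identifies it with the limit in \<open>mass_tendsto\<close>.\<close>

definition mass_inf :: real where "mass_inf = Inf (mass ` {0..})"

lemma mass_bdd_below: "bdd_below (mass ` {0..})"
  using mass_nonneg by (intro bdd_belowI[of _ 0]) auto

lemma mass_inf_le: "0 \<le> t \<Longrightarrow> mass_inf \<le> mass t"
  unfolding mass_inf_def using mass_bdd_below by (intro cInf_lower) auto

lemma mass_inf_nonneg: "0 \<le> mass_inf"
  unfolding mass_inf_def using mass_nonneg by (intro cInf_greatest) auto

lemma mass_inf_approx: "0 < \<epsilon> \<Longrightarrow> \<exists>s\<ge>0. mass s < mass_inf + \<epsilon>"
  using cInf_lessD[of "mass ` {0..}" "mass_inf + \<epsilon>"] by (auto simp: mass_inf_def)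

lemma mass_tendsto: "(mass \<longlongrightarrow> mass_inf) at_top"
proof (rule order_tendstoI)
  fix b assume "b < mass_inf"
  then show "\<forall>\<^sub>F t in at_top. b < mass t"
    by (intro eventually_mono[OF eventually_ge_at_top[of 0]] less_le_trans[OF _ mass_inf_le])
next
  fix b assume "mass_inf < b"
  then obtain s where s: "0 \<le> s" "mass s < b" using mass_inf_approx[of "b - mass_inf"] by auto
  then show "\<forall>\<^sub>F t in at_top. mass t < b"
    by (intro eventually_mono[OF eventually_ge_at_top[of s]] le_less_trans[OF mass_antimono[OF s(1)] s(2)])
qed

text \<open>The flow has run for the time \<open>K t - K s\<close>, while the density is taken at
  \<open>K t\<close>. As \<open>K s\<close> is fixed and \<open>K t\<close> tends to infinity, the
  ratio of the two scales tends to 1.\<close>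

lemma Q_u_asymptotics:
  assumes s: "0 \<le> s"
  shows "((\<lambda>t. \<integral>\<^sup>+x. ennreal \<bar>flow s t x - mass s * stable_density a (K t) x\<bar> \<partial>lborel) \<longlongrightarrow> 0) at_top"
    (is "(?D \<longlongrightarrow> 0) at_top")
proof (rule tendsto_at_topI_sequentially)
  fix X :: "nat \<Rightarrow> real" assume X: "filterlim X at_top sequentially"
  obtain B where B: "0 < B" "\<And>t x. 0 \<le> t \<Longrightarrow> \<bar>u t x\<bar> \<le> B" using u_bounded by blast
  have KX: "filterlim (\<lambda>n. K (X n)) at_top sequentially"
    by (rule filterlim_compose[OF filterlim_K X])
  then have "eventually (\<lambda>n. K s < K (X n)) sequentially" by (simp add: filterlim_at_top_dense)
  \<comment> \<open>The scale of the flow is positive only once \<open>K (X n)\<close> exceeds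
    \<open>K s\<close>; a shift by \<open>N\<close> drops the earlier terms.\<close>
  then obtain N where N: "\<And>n. N \<le> n \<Longrightarrow> K s < K (X n)" by (auto simp: eventually_sequentially)
  define Y where "Y n = K (X (n + N))" for n
  have Y: "K s < Y n" "0 < Y n" for n using N[of "n + N"] K_nonneg[OF s] by (auto simp: Y_def)
  have Ylim: "filterlim Y at_top sequentially"
    unfolding Y_def using KX by (rule filterlim_compose) (rule filterlim_add_const_nat_at_top)
  have e_lim: "filterlim (\<lambda>n. Y n powr (1 / a)) at_top sequentially"
    using a by (intro filterlim_compose[OF _ Ylim] real_powr_at_top) simp
  have "(\<lambda>n. K s / Y n) \<longlonglongrightarrow> 0"
    by (rule tendsto_divide_0[OF tendsto_const filterlim_at_top_imp_at_infinity[OF Ylim]])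
  then have "(\<lambda>n. 1 - K s / Y n) \<longlonglongrightarrow> 1 - 0" by (intro tendsto_intros)
  then have "(\<lambda>n. 1 / (1 - K s / Y n)) \<longlonglongrightarrow> 1 / (1 - 0)" by (rule tendsto_divide[OF tendsto_const]) simp
  then have "(\<lambda>n. (1 / (1 - K s / Y n)) powr (1 / a)) \<longlonglongrightarrow> (1 / (1 - 0)) powr (1 / a)"
    by (intro tendsto_powr tendsto_const) auto
  moreover have "(1 / (1 - K s / Y n)) powr (1 / a) = Y n powr (1 / a) / (Y n - K s) powr (1 / a)" for n
  proof -
    have "1 / (1 - K s / Y n) = Y n / (Y n - K s)" using Y[of n] by (simp add: divide_simps)
    then show ?thesis using Y[of n] by (simp add: powr_divide)
  qed
  ultimately have ratio: "(\<lambda>n. Y n powr (1 / a) / (Y n - K s) powr (1 / a)) \<longlonglongrightarrow> 1" by simp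
  have pos: "0 < Y n powr (1 / a)" "0 < (Y n - K s) powr (1 / a)" for n using Y[of n] by simp_all
  have "(\<lambda>n. \<integral>\<^sup>+x. ennreal \<bar>Q (u s) ((Y n - K s) powr (1 / a)) x - (LINT y|lborel. u s y) * stable_density a ((Y n powr (1 / a)) powr a) x\<bar> \<partial>lborel) \<longlonglongrightarrow> 0"
    by (rule Q_asymptotics[where e="\<lambda>n. Y n powr (1 / a)" and e'="\<lambda>n. (Y n - K s) powr (1 / a)",
          OF u_cont_space[OF s] B(2)[OF s] u_nonneg[OF s] integrable_u[OF s] pos ratio e_lim])
  moreover have "(Y n powr (1 / a)) powr a = Y n" for n using Y[of n] a by (simp add: powr_powr)
  ultimately have "(\<lambda>n. ?D (X (n + N))) \<longlonglongrightarrow> 0" by (simp add: Y_def mass_def)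
  then show "(\<lambda>n. ?D (X n)) \<longlonglongrightarrow> 0" by (rule LIMSEQ_offset)
qed

lemma nn_integral_stable_density:
  assumes "0 < t"
  shows "(\<integral>\<^sup>+x. ennreal (stable_density a t (x::real^'n)) \<partial>lborel) = 1"
proof -
  note hb = has_bochner_integral_stable_density[OF a(1) assms p[OF assms]]
  show ?thesis
    using nn_integral_eq_integral[of lborel "stable_density a t :: real^'n \<Rightarrow> real"] hb
      stable_density_nonneg[OF a(1) assms p[OF assms]]
    by (simp add: has_bochner_integral_iff)
qed

lemma L1_asymptotics:
  "((\<lambda>t. \<integral>\<^sup>+x. ennreal \<bar>u t x - mass_inf * stable_density a (K t) x\<bar> \<partial>lborel) \<longlongrightarrow> 0) at_top"
proof (rule ennreal_tendsto_0I)
  fix \<epsilon> :: real assume \<epsilon>: "0 < \<epsilon>"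
  \<comment> \<open>This \<open>s\<close> is fixed before \<open>t\<close>: it keeps both
    \<open>mass s - mass t\<close> and \<open>mass s - mass_inf\<close> below
    \<open>\<epsilon> / 3\<close> for all \<open>t \<ge> s\<close>, and only the flow term asks for
    large \<open>t\<close>.\<close>
  then obtain s where s: "0 \<le> s" "mass s < mass_inf + \<epsilon> / 3" using mass_inf_approx[of "\<epsilon> / 3"] by auto
  let ?D = "\<lambda>t. \<integral>\<^sup>+x. ennreal \<bar>flow s t x - mass s * stable_density a (K t) x\<bar> \<partial>lborel"
  have "\<forall>\<^sub>F t in at_top. ?D t < ennreal (\<epsilon> / 3)"
    using order_tendstoD(2)[OF Q_u_asymptotics[OF s(1)], of "ennreal (\<epsilon> / 3)"] \<epsilon> by simp
  moreover have "\<forall>\<^sub>F t in at_top. 0 < K t" using filterlim_K by (simp add: filterlim_at_top_dense)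
  moreover have "\<forall>\<^sub>F t in at_top. s \<le> t" by (rule eventually_ge_at_top)
  ultimately show "\<forall>\<^sub>F t in at_top. (\<integral>\<^sup>+x. ennreal \<bar>u t x - mass_inf * stable_density a (K t) x\<bar> \<partial>lborel) \<le> ennreal \<epsilon>"
  proof eventually_elim
    case (elim t)
    have t: "0 \<le> t" using s elim by simp
    let ?Q = "flow s t" and ?q = "stable_density a (K t) :: real^'n \<Rightarrow> real"
    obtain B where B: "0 < B" "\<And>t x. 0 \<le> t \<Longrightarrow> \<bar>u t x\<bar> \<le> B" using u_bounded by blast
    have [measurable]: "u t \<in> borel_measurable borel" by (rule u_measurable[OF t])
    have [measurable]: "?q \<in> borel_measurable borel"
      by (rule borel_measurable_continuous_onI[OF continuous_on_stable_density[OF a(1) elim(2)]])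
    have [measurable]: "?Q \<in> borel_measurable borel"
      using integrable_Q(1)[OF u_cont_space[OF s(1)] B(2)[OF s(1)] u_nonneg[OF s(1)] integrable_u[OF s(1)]]
      by (simp add: borel_measurable_integrable)
    have q0: "0 \<le> ?q x" for x by (rule stable_density_nonneg[OF a(1) elim(2) p[OF elim(2)]])
    have ms: "0 \<le> mass s - mass_inf" using mass_inf_le[OF s(1)] by simp
    have "\<bar>u t x - mass_inf * ?q x\<bar> \<le> \<bar>u t x - ?Q x\<bar> + \<bar>?Q x - mass s * ?q x\<bar> + (mass s - mass_inf) * ?q x" for x
    proof -
      have "u t x - mass_inf * ?q x = (u t x - ?Q x) + (?Q x - mass s * ?q x) + (mass s - mass_inf) * ?q x"
        by (simp add: algebra_simps)
      moreover have "0 \<le> (mass s - mass_inf) * ?q x" using ms q0 by simp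
      ultimately show ?thesis by linarith
    qed
    then have "(\<integral>\<^sup>+x. ennreal \<bar>u t x - mass_inf * ?q x\<bar> \<partial>lborel)
       \<le> (\<integral>\<^sup>+x. ennreal \<bar>u t x - ?Q x\<bar> + ennreal \<bar>?Q x - mass s * ?q x\<bar> + ennreal (mass s - mass_inf) * ennreal (?q x) \<partial>lborel)"
      using ms q0 by (intro nn_integral_mono) (simp add: ennreal_mult[symmetric] ennreal_plus[symmetric] ennreal_leI del: ennreal_plus)
    also have "\<dots> = (\<integral>\<^sup>+x. ennreal \<bar>u t x - ?Q x\<bar> \<partial>lborel) + ?D t + ennreal (mass s - mass_inf) * (\<integral>\<^sup>+x. ennreal (?q x) \<partial>lborel)"
      by (simp add: nn_integral_add nn_integral_cmult)
    also have "\<dots> = ennreal (mass s - mass t) + ?D t + ennreal (mass s - mass_inf)"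
      by (simp add: integrable_u_step(3)[OF s(1) elim(3) integrable_u[OF s(1)]] nn_integral_stable_density[OF elim(2)])
    also have "\<dots> \<le> ennreal (\<epsilon> / 3) + ennreal (\<epsilon> / 3) + ennreal (\<epsilon> / 3)"
      using s(2) mass_inf_le[OF t] elim(1) by (intro add_mono ennreal_leI) auto
    also have "\<dots> = ennreal \<epsilon>" using \<epsilon> by (simp add: ennreal_plus[symmetric] del: ennreal_plus)
    finally show ?case .
  qed
qed

lemma sup_bound:
  "\<exists>A>0. \<forall>t x. 0 \<le> t \<and> 0 < K t \<longrightarrow>
     \<bar>u t x - mass_inf * stable_density a (K t) x\<bar> \<le> A * K t powr (- (real CARD('n) / a))"
proof -
  obtain C where C: "0 \<le> C" "\<And>x::real^'n. \<bar>q x\<bar> \<le> C"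
    using stable_density_bound[OF a(1) zero_less_one] by blast
  have qC: "q x \<le> C" for x by (rule order_trans[OF abs_ge_self C(2)])
  show ?thesis
  \<comment> \<open>Both terms lie between 0 and \<open>C * mass 0\<close> times the power of
    \<open>K t\<close>, so their difference obeys the same bound; the added 1 makes the constant
    positive.\<close>
  proof (intro exI[of _ "C * mass 0 + 1"] conjI allI impI)
    show "0 < C * mass 0 + 1"
      by (rule add_nonneg_pos[OF mult_nonneg_nonneg[OF C(1) mass_nonneg[OF order_refl]] zero_less_one])
    fix t x assume t: "0 \<le> t \<and> 0 < K t"
    define e where "e = K t powr (1 / a)"
    have e: "0 < e" "e powr a = K t" using t a by (auto simp: e_def powr_powr)
    have "(1 / e) ^ CARD('n) = inverse (e powr real CARD('n))"
      using powr_realpow[OF e(1), of "CARD('n)"] by (simp only: power_one_over inverse_eq_divide)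
    also have "\<dots> = e powr (- real CARD('n))" by (rule powr_minus[symmetric])
    also have "\<dots> = K t powr (1 / a * (- real CARD('n)))" unfolding e_def by (rule powr_powr)
    finally have ed: "(1 / e) ^ CARD('n) = K t powr (- (real CARD('n) / a))" by simp
    let ?E = "(1 / e) ^ CARD('n)"
    have E: "0 \<le> ?E" using e by simp
    have "u t x \<le> Q (u 0) ((K t - K 0) powr (1 / a)) x"
      using t by (intro u_le_Q integrable_u_0) auto
    also have "\<dots> = Q (u 0) e x" by (simp add: e_def)
    also have "\<dots> \<le> ?E * C * mass 0"
      unfolding mass_def by (rule Q_le[OF u_nonneg[OF order_refl] integrable_u_0 qC e(1)])
    finally have 1: "u t x \<le> ?E * (C * mass 0)" by (simp add: mult.assoc)
    have "stable_density a (K t) x = ?E * q ((1 / e) *\<^sub>R x)"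
      unfolding e(2)[symmetric] by (rule stable_density_scaling[OF a(1) e(1)])
    then have sd: "0 \<le> stable_density a (K t) x" "stable_density a (K t) x \<le> ?E * C"
      using E qC by (auto intro: mult_left_mono)
    have "mass_inf * stable_density a (K t) x \<le> mass 0 * (?E * C)"
      using sd mass_inf_le[of 0] mass_nonneg[of 0] by (intro mult_mono) auto
    then have 2: "mass_inf * stable_density a (K t) x \<le> ?E * (C * mass 0)" by (simp add: mult_ac)
    have "0 \<le> u t x" "0 \<le> mass_inf * stable_density a (K t) x"
      using t u_nonneg sd mass_inf_nonneg by auto
    with 1 2 have "\<bar>u t x - mass_inf * stable_density a (K t) x\<bar> \<le> ?E * (C * mass 0)" by linarith
    also have "\<dots> \<le> (C * mass 0 + 1) * ?E" using E by (simp add: algebra_simps)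
    finally show "\<bar>u t x - mass_inf * stable_density a (K t) x\<bar> \<le> (C * mass 0 + 1) * K t powr (- (real CARD('n) / a))"
      by (simp only: ed)
  qed
qed

end

text \<open>The pointwise inequality \<open>\<bar>f x\<bar> powr q \<le> A powr (q - 1) * \<bar>f
  x\<bar>\<close> is integrated; the finite bound also excludes the infinite branch of
  \<open>Lq_norm\<close>.\<close>

lemma Lq_norm_le_interpolation:
  fixes f :: "'a::euclidean_space \<Rightarrow> real"
  assumes q: "1 \<le> q" and A: "0 < A" and bound: "AE x in lborel. \<bar>f x\<bar> \<le> A"
    and I: "(\<integral>\<^sup>+x. ennreal \<bar>f x\<bar> \<partial>lborel) = ennreal j" and j: "0 \<le> j"
    and [measurable]: "f \<in> borel_measurable lborel"
  shows "Lq_norm q f \<le> ennreal (A powr (1 - 1 / q) * j powr (1 / q))"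
proof -
  let ?I = "\<integral>\<^sup>+x. ennreal (\<bar>f x\<bar> powr q) \<partial>lborel"
  have "?I \<le> (\<integral>\<^sup>+x. ennreal (A powr (q - 1)) * ennreal \<bar>f x\<bar> \<partial>lborel)"
  proof (rule nn_integral_mono_AE)
    show "AE x in lborel. ennreal (\<bar>f x\<bar> powr q) \<le> ennreal (A powr (q - 1)) * ennreal \<bar>f x\<bar>"
      using bound
    proof eventually_elim
      case (elim x)
      have "\<bar>f x\<bar> powr q = \<bar>f x\<bar> powr (q - 1) * \<bar>f x\<bar>"
        by (cases "f x = 0") (simp_all add: powr_diff)
      also have "\<dots> \<le> A powr (q - 1) * \<bar>f x\<bar>"
        using elim q by (intro mult_right_mono powr_mono2) auto
      finally show ?case by (simp add: ennreal_mult[symmetric] ennreal_leI)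
    qed
  qed
  also have "\<dots> = ennreal (A powr (q - 1)) * (\<integral>\<^sup>+x. ennreal \<bar>f x\<bar> \<partial>lborel)"
    by (rule nn_integral_cmult) measurable
  also have "\<dots> = ennreal (A powr (q - 1) * j)"
    by (simp add: I ennreal_mult j)
  finally have le: "?I \<le> ennreal (A powr (q - 1) * j)" .
  then have fin: "?I \<noteq> \<infinity>" by (auto simp: top_unique)
  have "enn2real ?I \<le> A powr (q - 1) * j"
    using enn2real_mono[OF le] j by simp
  then have "enn2real ?I powr (1 / q) \<le> (A powr (q - 1) * j) powr (1 / q)"
    using q by (intro powr_mono2) auto
  also have "\<dots> = A powr (1 - 1 / q) * j powr (1 / q)"
    using j q by (simp add: powr_mult powr_powr diff_divide_distrib)
  finally show ?thesis using fin by (simp add: Lq_norm_def Let_def ennreal_leI)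
qed

lemma Lq_norm_cong_AE:
  assumes "AE x in lborel. f x = g x"
  shows "Lq_norm q f = Lq_norm q g"
proof -
  have "(\<integral>\<^sup>+x. ennreal (\<bar>f x\<bar> powr q) \<partial>lborel) = (\<integral>\<^sup>+x. ennreal (\<bar>g x\<bar> powr q) \<partial>lborel)"
    by (rule nn_integral_cong_AE) (use assms in eventually_elim, simp)
  then show ?thesis by (simp add: Lq_norm_def)
qed

text \<open>The decay \<open>K t powr (- (d / a))\<close> of the sup norm, raised to the power
  \<open>1 - 1 / r\<close> by interpolation, cancels the weight exactly. What remains is a constant
  times the power \<open>1 / r\<close> of the L1 distance. The given density is first replaced by
  its continuous version.\<close>

lemma (in absorption_problem) Lq_asymptotics:
  assumes r: "1 \<le> r"
  shows "((\<lambda>t. ennreal (K t powr (real CARD('n) / a * (1 - 1 / r))) *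
      Lq_norm r (\<lambda>x. u t x - mass_inf * p (K t) x)) \<longlongrightarrow> 0) at_top"
proof -
  obtain A where A: "0 < A" "\<And>t x. 0 \<le> t \<Longrightarrow> 0 < K t \<Longrightarrow>
      \<bar>u t x - mass_inf * stable_density a (K t) x\<bar> \<le> A * K t powr (- (real CARD('n) / a))"
    using sup_bound by blast
  define J where "J t = (\<integral>\<^sup>+x. ennreal \<bar>u t x - mass_inf * stable_density a (K t) x\<bar> \<partial>lborel)" for t
  have J: "(J \<longlongrightarrow> 0) at_top" unfolding J_def[abs_def] by (rule L1_asymptotics)
  have "((\<lambda>t. enn2real (J t)) \<longlongrightarrow> 0) at_top" using tendsto_enn2real[of J 0 at_top] J by simp
  then have "((\<lambda>t. A powr (1 - 1 / r) * enn2real (J t) powr (1 / r)) \<longlongrightarrow> A powr (1 - 1 / r) * 0 powr (1 / r)) at_top"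
    using r by (intro tendsto_mult_left tendsto_powr2 tendsto_const) auto
  then have lim: "((\<lambda>t. ennreal (A powr (1 - 1 / r) * enn2real (J t) powr (1 / r))) \<longlongrightarrow> 0) at_top"
    using tendsto_ennrealI by fastforce
  show ?thesis
  proof (rule tendsto_sandwich[OF _ _ tendsto_const lim])
    \<comment> \<open>Any finite bound would do: it rules out the value infinity, which
      \<open>enn2real\<close> maps to 0.\<close>
    have "\<forall>\<^sub>F t in at_top. J t < 1" using order_tendstoD(2)[OF J, of 1] by simp
    moreover have "\<forall>\<^sub>F t in at_top. 0 < K t" using filterlim_K by (simp add: filterlim_at_top_dense)
    moreover have "\<forall>\<^sub>F t::real in at_top. 0 \<le> t" by (rule eventually_ge_at_top)
    ultimately show "\<forall>\<^sub>F t in at_top. ennreal (K t powr (real CARD('n) / a * (1 - 1 / r))) *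
        Lq_norm r (\<lambda>x. u t x - mass_inf * p (K t) x) \<le> ennreal (A powr (1 - 1 / r) * enn2real (J t) powr (1 / r))"
    proof eventually_elim
      case (elim t)
      let ?d = "real CARD('n) / a"
      let ?g = "\<lambda>x. u t x - mass_inf * stable_density a (K t) x"
      have [measurable]: "u t \<in> borel_measurable borel" by (rule u_measurable[OF elim(3)])
      have [measurable]: "(stable_density a (K t) :: real^'n \<Rightarrow> real) \<in> borel_measurable borel"
        by (rule borel_measurable_continuous_onI[OF continuous_on_stable_density[OF a(1) elim(2)]])
      have "AE x in lborel. u t x - mass_inf * p (K t) x = ?g x"
        using symmetric_stable_density_AE_eq[OF a(1) elim(2) p[OF elim(2)]] by eventually_elim simp
      then have "Lq_norm r (\<lambda>x. u t x - mass_inf * p (K t) x) = Lq_norm r ?g" by (rule Lq_norm_cong_AE)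
      also have "\<dots> \<le> ennreal ((A * K t powr (- ?d)) powr (1 - 1 / r) * enn2real (J t) powr (1 / r))"
      proof (rule Lq_norm_le_interpolation[OF r])
        show "0 < A * K t powr (- ?d)" using A elim by simp
        show "AE x in lborel. \<bar>?g x\<bar> \<le> A * K t powr (- ?d)" using A(2)[OF elim(3,2)] by simp
        show "(\<integral>\<^sup>+x. ennreal \<bar>?g x\<bar> \<partial>lborel) = ennreal (enn2real (J t))"
          using less_trans[OF elim(1) ennreal_one_less_top] by (simp add: J_def[symmetric])
      qed auto
      finally have "ennreal (K t powr (?d * (1 - 1 / r))) * Lq_norm r (\<lambda>x. u t x - mass_inf * p (K t) x)
         \<le> ennreal (K t powr (?d * (1 - 1 / r))) * ennreal ((A * K t powr (- ?d)) powr (1 - 1 / r) * enn2real (J t) powr (1 / r))"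
        by (rule mult_left_mono) simp
      also have "\<dots> = ennreal (K t powr (?d * (1 - 1 / r)) * (A * K t powr (- ?d)) powr (1 - 1 / r) * enn2real (J t) powr (1 / r))"
        by (simp add: ennreal_mult[symmetric] mult.assoc)
      also have "K t powr (?d * (1 - 1 / r)) * (A * K t powr (- ?d)) powr (1 - 1 / r)
         = (K t powr (?d * (1 - 1 / r)) * K t powr (- ?d * (1 - 1 / r))) * A powr (1 - 1 / r)"
        using A by (simp add: powr_mult powr_powr mult_ac)
      also have "K t powr (?d * (1 - 1 / r)) * K t powr (- ?d * (1 - 1 / r)) = 1"
        using elim(2) by (simp add: powr_add[symmetric])
      finally show ?case by simp
    qed
  qed (simp add: always_eventually)
qed

theorem theorem3:
  fixes \<alpha> q :: real
    and \<phi> h k :: "real \<Rightarrow> real"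
    and u\<^sub>0 :: "real^'n \<Rightarrow> real"
    and u p :: "real \<Rightarrow> real^'n \<Rightarrow> real"
  defines "K \<equiv> \<lambda>t. LINT s:{0..t}|lborel. k s"
    and "M_inf \<equiv> Lim at_top (\<lambda>t. LINT x|lborel. u t x)"
  assumes "0 < \<alpha>" and "\<alpha> < 2"
    and "convex_on UNIV \<phi>" and "\<And>x. \<phi> differentiable (at x)"
    and "\<And>x. 0 \<le> \<phi> x" and "\<phi> 0 = 0" and "\<And>x. x \<noteq> 0 \<Longrightarrow> 0 < \<phi> x"
    and "continuous_on {0..} h" and "\<And>t. 0 \<le> t \<Longrightarrow> 0 \<le> h t"
    and "\<And>t. 0 \<le> t \<Longrightarrow> t \<noteq> 0 \<Longrightarrow> 0 < h t"
    and "continuous_on {0..} k" and "\<And>t. 0 \<le> t \<Longrightarrow> 0 \<le> k t"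
    and "\<And>T. 0 < T \<Longrightarrow> (SUP t\<in>{0..T}. smoothing_integral \<alpha> k t) < \<infinity>"
    and "u\<^sub>0 \<in> Cb" and "integrable lborel u\<^sub>0"
    and "\<And>x. 0 \<le> u\<^sub>0 x" and "Lq_norm 1 u\<^sub>0 > 0"
    and "classical_solution \<alpha> k h \<phi> u\<^sub>0 u"
    and "\<And>t. 0 < t \<Longrightarrow> symmetric_stable_density \<alpha> t (p t)"
    and "(\<integral>\<^sup>+s\<in>{1..}. ennreal (k s) \<partial>lborel) = \<infinity>"
    and "1 \<le> q"
  shows "((\<lambda>t. ennreal (K t powr (real CARD('n) / \<alpha> * (1 - 1 / q))) *
               Lq_norm q (\<lambda>x. u t x - M_inf * p (K t) x)) \<longlongrightarrow> 0) at_top"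
proof -
  interpret P: absorption_problem \<alpha> p \<phi> h k u\<^sub>0 u
    by unfold_locales (use assms in auto)
  have "M_inf = P.mass_inf"
    unfolding M_inf_def using tendsto_Lim[OF _ P.mass_tendsto] by (simp add: P.mass_def[abs_def])
  moreover have "K = P.K" by (simp add: K_def P.K_def[abs_def])
  ultimately show ?thesis using P.Lq_asymptotics[OF \<open>1 \<le> q\<close>] by simp
qed

end
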